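(* Let $S$ be a set and let $r\in F(S)'\setminus\{e\}$. Then $$\|G_r\|<4\cdot\operatorname{scl}_S(r).$$
   Context: For a set $S$, $F(S)$ is the free group on $S$, $F(S)'$ its commutator subgroup and $e$ the neutral element. For $r\in F(S)'\setminus\{e\}$ let $G_r:=\langle S\mid r\rangle$. Let $P_r$ be the presentation complex (one vertex, one $1$-cell for each element of $S$, one $2$-cell attached along $r$) and let $X_r$ be a classifying space of $G_r$ obtained from $P_r$ by attaching cells of dimension $\ge 3$, with inclusion $c_r\colon P_r\to X_r$. Since $r\in F(S)'$, the $2$-cell of $P_r$ defines a class $\widetilde\alpha_r\in H_2(P_r;\mathbb Z)$; the fundamental class is $\alpha_r:=H_2(c_r;\mathbb Z)(\widetilde\alpha_r)\in H_2(X_r;\mathbb Z)=H_2(G_r;\mathbb Z)$ (this group is infinite cyclic, generated by $\alpha_r$), and $\alpha_{r,\mathbb R}\in H_2(G_r;\mathbb R)$ is its image under change of coefficients. The simplicial volume of $G_r$ is $\|G_r\|:=\|\alpha_{r,\mathbb R}\|_1$, where $\|\alpha\|_1$ is the infimum of the $\ell^1$-norms (with respect to the basis of singular simplices) of all real singular cycles representing $\alpha$. For $w\in F(S)'$, $\operatorname{cl}_S(w)$ is the minimal $n\in\mathbb N$ such that $w$ is a product of $n$ commutators in $F(S)$, and $\operatorname{scl}_S(w):=\lim_{n\to\infty}\operatorname{cl}_S(w^n)/n$. *)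

theory Defs
  imports "HOL-Homology.Homology" "HOL-Analysis.Analysis"
begin

section \<open>Free groups, commutator length and one-relator groups\<close>

text \<open>
  A letter \<open>(s, True)\<close> stands for the generator \<open>s\<close>, and \<open>(s, False)\<close> for its inverse.
  Elements of the free group are the reduced words.
\<close>

type_synonym 'a word = "('a \<times> bool) list"

definition flip :: "'a \<times> bool \<Rightarrow> 'a \<times> bool" where
  "flip x = (fst x, \<not> snd x)"

definition reduced_word :: "'a word \<Rightarrow> bool" where
  "reduced_word w \<longleftrightarrow> successively (\<lambda>x y. y \<noteq> flip x) w"

fun push :: "'a \<times> bool \<Rightarrow> 'a word \<Rightarrow> 'a word" where
  "push x [] = [x]"
| "push x (y # w) = (if y = flip x then w else x # y # w)"

definition free_group :: "'a set \<Rightarrow> 'a word monoid" where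
  "free_group S =
     \<lparr>carrier = {w. reduced_word w \<and> fst ` set w \<subseteq> S},
      monoid.mult = (\<lambda>u v. foldr push u v),
      one = []\<rparr>"

lemma flip_flip [simp]: "flip (flip x) = x"
  by (simp add: flip_def)

lemma fst_flip [simp]: "fst (flip x) = fst x"
  by (simp add: flip_def)

lemma reduced_Nil [simp]: "reduced_word []"
  by (simp add: reduced_word_def)

lemma reduced_Cons: "reduced_word (x # w) \<longleftrightarrow> reduced_word w \<and> (w = [] \<or> hd w \<noteq> flip x)"
  by (cases w) (auto simp: reduced_word_def)

lemma reduced_push: "reduced_word w \<Longrightarrow> reduced_word (push x w)"
  by (cases w) (auto simp: reduced_Cons)

lemma reduced_foldr_push: "reduced_word w \<Longrightarrow> reduced_word (foldr push u w)"
  by (induction u) (auto intro: reduced_push)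

lemma set_push: "fst ` set (push x w) \<subseteq> insert (fst x) (fst ` set w)"
  by (cases w) auto

lemma set_foldr_push: "fst ` set (foldr push u w) \<subseteq> fst ` set u \<union> fst ` set w"
proof (induction u)
  case (Cons x u)
  then show ?case
    using set_push[of x "foldr push u w"] by (simp add: subset_iff) blast
qed simp

lemma push_flip: "reduced_word w \<Longrightarrow> push x (push (flip x) w) = w"
  by (cases w; cases "tl w") (auto simp: reduced_Cons)

lemma push_Cons_reduced: "reduced_word (x # w) \<Longrightarrow> push x w = x # w"
  by (cases w) (auto simp: reduced_Cons)

lemma foldr_push_Nil: "reduced_word w \<Longrightarrow> foldr push w [] = w"
  by (induction w) (auto simp: reduced_Cons push_Cons_reduced)

lemma foldr_push_push:
  assumes "reduced_word w"
  shows "foldr push (push x v) w = push x (foldr push v w)"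
proof (cases v)
  case (Cons y v')
  then show ?thesis
    using push_flip[OF reduced_foldr_push[OF assms, of v'], of x] by auto
qed simp

lemma foldr_push_assoc:
  assumes "reduced_word w"
  shows "foldr push (foldr push u v) w = foldr push u (foldr push v w)"
  by (induction u) (auto simp: foldr_push_push[OF assms])

lemma foldr_push_inverse:
  assumes "reduced_word v"
  shows "foldr push (rev (map flip u)) (foldr push u v) = v"
proof (induction u)
  case (Cons x u)
  then show ?case
    using push_flip[OF reduced_foldr_push[OF assms, of u], of "flip x"] by simp
qed (simp add: assms)

lemma group_free_group: "group (free_group S)"
proof (rule groupI)
  fix u assume u: "u \<in> carrier (free_group S)"
  define v where "v = foldr push (rev (map flip u)) []"
  have "v \<in> carrier (free_group S)"
    using u set_foldr_push[of "rev (map flip u)" "[]"]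
    by (fastforce simp: v_def free_group_def intro!: reduced_foldr_push)
  moreover have "foldr push v u = []"
    using u foldr_push_assoc[of u "rev (map flip u)" "[]"]
      foldr_push_inverse[of "[]" u] foldr_push_Nil[of u]
    by (simp add: v_def free_group_def)
  ultimately show "\<exists>v\<in>carrier (free_group S). v \<otimes>\<^bsub>free_group S\<^esub> u = \<one>\<^bsub>free_group S\<^esub>"
    by (auto simp: free_group_def)
next
  fix u v assume "u \<in> carrier (free_group S)" "v \<in> carrier (free_group S)"
  then show "u \<otimes>\<^bsub>free_group S\<^esub> v \<in> carrier (free_group S)"
    using set_foldr_push[of u v] reduced_foldr_push[of v u]
    unfolding free_group_def by simp (meson Un_least subset_trans)
qed (auto simp: free_group_def foldr_push_assoc)

definition commutator_length :: "('g, 'b) monoid_scheme \<Rightarrow> 'g \<Rightarrow> nat" where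
  "commutator_length G w =
     (LEAST n. \<exists>cs. length cs = n \<and> set cs \<subseteq> derived_set G (carrier G) \<and>
                    foldr (monoid.mult G) cs \<one>\<^bsub>G\<^esub> = w)"

definition stable_commutator_length :: "('g, 'b) monoid_scheme \<Rightarrow> 'g \<Rightarrow> real" where
  "stable_commutator_length G w = lim (\<lambda>n. real (commutator_length G (w [^]\<^bsub>G\<^esub> n)) / real n)"

definition normal_closure :: "('g, 'b) monoid_scheme \<Rightarrow> 'g set \<Rightarrow> 'g set" where
  "normal_closure G R = generate G (\<Union>g\<in>carrier G. \<Union>x\<in>R. {g \<otimes>\<^bsub>G\<^esub> x \<otimes>\<^bsub>G\<^esub> inv\<^bsub>G\<^esub> g})"

definition one_relator_group :: "'a set \<Rightarrow> 'a word \<Rightarrow> 'a word set monoid" where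
  "one_relator_group S r = free_group S Mod normal_closure (free_group S) {r}"


section \<open>The presentation complex\<close>

text \<open>
  Points of the presentation complex: the vertex, the points of the open 1-cells
  \<open>{s} \<times> (0, 1)\<close>, and the points of the open 2-cell, the open unit disc in the complex plane.
\<close>

datatype 'a pres_point = Vertex | Edge 'a real | Face complex

definition pres_skeleton1 :: "'a set \<Rightarrow> 'a pres_point set" where
  "pres_skeleton1 S = insert Vertex {Edge s t |s t. s \<in> S \<and> 0 < t \<and> t < 1}"

definition pres_points :: "'a set \<Rightarrow> 'a pres_point set" where
  "pres_points S = pres_skeleton1 S \<union> Face ` ball 0 1"

definition edge_map :: "'a \<Rightarrow> real \<Rightarrow> 'a pres_point" where
  "edge_map s t = (if 0 < t \<and> t < 1 then Edge s t else Vertex)"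

text \<open>
  The attaching map of the 2-cell reads \<open>r\<close> once counterclockwise: the unit circle is divided
  into \<open>length r\<close> arcs of equal length, and the \<open>j\<close>-th arc runs through the edge of the
  \<open>j\<close>-th letter of \<open>r\<close>, backwards if that letter is the inverse of a generator.
  The word \<open>r\<close> is assumed to be nonempty.
\<close>

definition attaching_loop :: "'a word \<Rightarrow> complex \<Rightarrow> 'a pres_point" where
  "attaching_loop r z =
     (let u = real (length r) * Arg2pi z / (2 * pi);
          x = r ! nat \<lfloor>u\<rfloor>
      in edge_map (fst x) (if snd x then frac u else 1 - frac u))"

definition face_map :: "'a word \<Rightarrow> complex \<Rightarrow> 'a pres_point" where
  "face_map r z = (if norm z < 1 then Face z else attaching_loop r z)"

text \<open>The quotient topology with respect to the characteristic maps of all cells.\<close>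

definition pres_open :: "'a set \<Rightarrow> 'a word \<Rightarrow> 'a pres_point set \<Rightarrow> bool" where
  "pres_open S r U \<longleftrightarrow>
     U \<subseteq> pres_points S \<and>
     (\<forall>s\<in>S. openin (top_of_set {0..1}) {t \<in> {0..1}. edge_map s t \<in> U}) \<and>
     openin (top_of_set (cball 0 1)) {z \<in> cball 0 1. face_map r z \<in> U}"

definition pres_complex :: "'a set \<Rightarrow> 'a word \<Rightarrow> 'a pres_point topology" where
  "pres_complex S r = topology (pres_open S r)"

lemma istopology_pres_open: "istopology (pres_open S r)"
proof -
  have int: "{x \<in> A. f x \<in> U \<inter> V} = {x \<in> A. f x \<in> U} \<inter> {x \<in> A. f x \<in> V}"
    for A :: "'c set" and f :: "'c \<Rightarrow> 'd" and U V by auto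
  have un: "{x \<in> A. f x \<in> \<Union>\<K>} = (\<Union>U\<in>\<K>. {x \<in> A. f x \<in> U})"
    for A :: "'c set" and f :: "'c \<Rightarrow> 'd" and \<K> by auto
  show ?thesis
    unfolding istopology_def pres_open_def int un by (auto intro!: openin_Int openin_Union)
qed

lemma openin_pres_complex: "openin (pres_complex S r) U \<longleftrightarrow> pres_open S r U"
  by (simp add: pres_complex_def istopology_pres_open topology_inverse')


section \<open>Classifying spaces obtained by attaching cells\<close>

definition ndisc :: "nat \<Rightarrow> (nat \<Rightarrow> real) topology" where
  "ndisc n = subtopology (Euclidean_space n) {x. (\<Sum>i<n. (x i)\<^sup>2) \<le> 1}"

definition open_ndisc :: "nat \<Rightarrow> (nat \<Rightarrow> real) set" where
  "open_ndisc n = {x \<in> topspace (ndisc n). (\<Sum>i<n. (x i)\<^sup>2) < 1}"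

text \<open>
  The subspace \<open>B\<close> of \<open>X\<close> arises from the subspace \<open>A\<close> by attaching a family of \<open>n\<close>-cells;
  \<open>\<Phi>s\<close> is the set of characteristic maps. The last clause says that \<open>B\<close> carries the
  quotient topology of the disjoint union of \<open>A\<close> and the discs.
\<close>

definition attaches_cells :: "'x topology \<Rightarrow> nat \<Rightarrow> 'x set \<Rightarrow> 'x set \<Rightarrow> bool" where
  "attaches_cells X n A B \<longleftrightarrow>
     A \<subseteq> B \<and> B \<subseteq> topspace X \<and>
     (\<exists>\<Phi>s. (\<forall>\<Phi>\<in>\<Phi>s. continuous_map (ndisc n) (subtopology X B) \<Phi> \<and>
                    \<Phi> ` (topspace (ndisc n) - open_ndisc n) \<subseteq> A) \<and>
           bij_betw (\<lambda>(\<Phi>, x). \<Phi> x) (\<Phi>s \<times> open_ndisc n) (B - A) \<and>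
           (\<forall>U\<subseteq>B. openin (subtopology X B) U \<longleftrightarrow>
              openin (subtopology X A) (U \<inter> A) \<and>
              (\<forall>\<Phi>\<in>\<Phi>s. openin (ndisc n) {x \<in> topspace (ndisc n). \<Phi> x \<in> U})))"

text \<open>
  \<open>X\<close> is obtained from (the image under \<open>c\<close> of) \<open>P\<close> by attaching cells of dimension at least \<open>3\<close>:
  \<open>F n\<close> is the union of \<open>P\<close> with all cells of dimension at most \<open>n\<close>.
\<close>

definition attaches_cells_ge3 :: "'p topology \<Rightarrow> 'x topology \<Rightarrow> ('p \<Rightarrow> 'x) \<Rightarrow> bool" where
  "attaches_cells_ge3 P X c \<longleftrightarrow>
     embedding_map P X c \<and>
     (\<exists>F. F 2 = c ` topspace P \<and>
          (\<forall>n\<ge>3. attaches_cells X n (F (n - 1)) (F n)) \<and>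
          topspace X = (\<Union>n\<in>{2..}. F n) \<and>
          (\<forall>U\<subseteq>topspace X. openin X U \<longleftrightarrow>
             (\<forall>n\<ge>2. openin (subtopology X (F n)) (U \<inter> F n))))"

definition loop_at :: "'x topology \<Rightarrow> 'x \<Rightarrow> (real \<Rightarrow> 'x) \<Rightarrow> bool" where
  "loop_at X x p \<longleftrightarrow> pathin X p \<and> p 0 = x \<and> p 1 = x"

definition loop_class :: "'x topology \<Rightarrow> 'x \<Rightarrow> (real \<Rightarrow> 'x) \<Rightarrow> (real \<Rightarrow> 'x) set" where
  "loop_class X x p =
     {q. homotopic_with (\<lambda>h. h 0 = x \<and> h 1 = x) (top_of_set {0..1}) X p q}"

definition concat_paths :: "(real \<Rightarrow> 'x) \<Rightarrow> (real \<Rightarrow> 'x) \<Rightarrow> real \<Rightarrow> 'x" where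
  "concat_paths p q t = (if t \<le> 1 / 2 then p (2 * t) else q (2 * t - 1))"

definition fundamental_group :: "'x topology \<Rightarrow> 'x \<Rightarrow> (real \<Rightarrow> 'x) set monoid" where
  "fundamental_group X x =
     \<lparr>carrier = loop_class X x ` Collect (loop_at X x),
      monoid.mult = (\<lambda>A B. \<Union>p\<in>A. \<Union>q\<in>B. loop_class X x (concat_paths p q)),
      one = loop_class X x (\<lambda>_. x)\<rparr>"

text \<open>Triviality of the higher homotopy groups, in terms of free homotopies.\<close>

definition aspherical :: "'x topology \<Rightarrow> bool" where
  "aspherical X \<longleftrightarrow>
     path_connected_space X \<and>
     (\<forall>n\<ge>2. \<forall>f. continuous_map (nsphere n) X f \<longrightarrow>
        (\<exists>a\<in>topspace X. homotopic_with (\<lambda>_. True) (nsphere n) X f (\<lambda>_. a)))"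

text \<open>
  \<open>X\<close> is a classifying space of \<open>\<langle>S | r\<rangle>\<close> obtained from the presentation complex by attaching
  cells of dimension at least \<open>3\<close>, and \<open>c\<close> is the inclusion of the presentation complex.
\<close>

definition classifying_complex ::
    "'a set \<Rightarrow> 'a word \<Rightarrow> 'x topology \<Rightarrow> ('a pres_point \<Rightarrow> 'x) \<Rightarrow> bool" where
  "classifying_complex S r X c \<longleftrightarrow>
     attaches_cells_ge3 (pres_complex S r) X c \<and>
     aspherical X \<and>
     fundamental_group X (c Vertex) \<cong> one_relator_group S r"


section \<open>The fundamental class\<close>

text \<open>
  \<open>disc_class\<close> is the generator of the second homology of the closed unit disc \<open>D\<close> relative to
  its boundary circle whose boundary is represented by the counterclockwise loop.
\<close>

definition circle_simplex :: "(nat \<Rightarrow> real) \<Rightarrow> complex" where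
  "circle_simplex = restrict (\<lambda>x. cis (2 * pi * x 1)) (standard_simplex 1)"

definition disc_class :: "complex chain set" where
  "disc_class =
     (let D = top_of_set (cball 0 1) in
      THE g. g \<in> carrier (relative_homology_group 2 D (sphere 0 1)) \<and>
             hom_boundary 2 D (sphere 0 1) g =
               homologous_rel_set 1 (subtopology D (sphere 0 1)) {} (frag_of circle_simplex))"

text \<open>
  As \<open>r\<close> lies in the commutator subgroup, the relative class of the 2-cell modulo the 1-skeleton
  lifts to the absolute second homology; the lift is unique because the second homology of the
  1-skeleton vanishes.
\<close>

definition pres_class :: "'a set \<Rightarrow> 'a word \<Rightarrow> 'a pres_point chain set" where
  "pres_class S r =
     (let P = pres_complex S r in
      THE a. a \<in> carrier (homology_group 2 P) \<and>
             hom_induced 2 P {} P (pres_skeleton1 S) id a =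
               hom_induced 2 (top_of_set (cball 0 1)) (sphere 0 1) P (pres_skeleton1 S)
                 (face_map r) disc_class)"

definition fundamental_class ::
    "'a set \<Rightarrow> 'a word \<Rightarrow> 'x topology \<Rightarrow> ('a pres_point \<Rightarrow> 'x) \<Rightarrow> 'x chain set" where
  "fundamental_class S r X c = hom_induced 2 (pres_complex S r) {} X {} c (pres_class S r)"


section \<open>Real singular homology and simplicial volume\<close>

type_synonym 'x real_chain = "((nat \<Rightarrow> real) \<Rightarrow> 'x) \<Rightarrow>\<^sub>0 real"

definition real_singular_chain :: "nat \<Rightarrow> 'x topology \<Rightarrow> 'x real_chain \<Rightarrow> bool" where
  "real_singular_chain p X z \<longleftrightarrow> Poly_Mapping.keys z \<subseteq> singular_simplex_set p X"

definition real_chain_boundary :: "nat \<Rightarrow> 'x real_chain \<Rightarrow> 'x real_chain" where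
  "real_chain_boundary p z =
     (if p = 0 then 0
      else \<Sum>\<sigma>\<in>Poly_Mapping.keys z. \<Sum>k\<le>p.
             Poly_Mapping.single (singular_face p k \<sigma>) ((-1) ^ k * Poly_Mapping.lookup z \<sigma>))"

definition real_singular_cycle :: "nat \<Rightarrow> 'x topology \<Rightarrow> 'x real_chain \<Rightarrow> bool" where
  "real_singular_cycle p X z \<longleftrightarrow> real_singular_chain p X z \<and> real_chain_boundary p z = 0"

definition real_singular_boundary :: "nat \<Rightarrow> 'x topology \<Rightarrow> 'x real_chain \<Rightarrow> bool" where
  "real_singular_boundary p X z \<longleftrightarrow>
     (\<exists>b. real_singular_chain (Suc p) X b \<and> real_chain_boundary (Suc p) b = z)"

text \<open>
  Like an integral homology class, a real homology class is the set of cycles representing it.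
  \<open>real_class p X a\<close> is the image of the integral class \<open>a\<close> under change of coefficients.
\<close>

definition real_class :: "nat \<Rightarrow> 'x topology \<Rightarrow> 'x chain set \<Rightarrow> 'x real_chain set" where
  "real_class p X a =
     {z. real_singular_cycle p X z \<and>
         (\<exists>y\<in>a. real_singular_boundary p X (z - Poly_Mapping.map real_of_int y))}"

definition l1_norm :: "'x real_chain \<Rightarrow> real" where
  "l1_norm z = (\<Sum>\<sigma>\<in>Poly_Mapping.keys z. \<bar>Poly_Mapping.lookup z \<sigma>\<bar>)"

definition l1_seminorm :: "'x real_chain set \<Rightarrow> real" where
  "l1_seminorm \<alpha> = (INF z\<in>\<alpha>. l1_norm z)"

definition simplicial_volume ::
    "'a set \<Rightarrow> 'a word \<Rightarrow> 'x topology \<Rightarrow> ('a pres_point \<Rightarrow> 'x) \<Rightarrow> real" where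
  "simplicial_volume S r X c = l1_seminorm (real_class 2 X (fundamental_class S r X c))"

end

theory Submission
  imports Defs
begin

text \<open>
  If a product of \<open>n\<close> conjugates of \<open>r\<close> is also a product of \<open>t\<close> commutators, then a closed
  surface of genus \<open>t\<close> maps to the presentation complex with degree \<open>n\<close>, and it is triangulated
  economically: each commutator contributes four triangles, and the discs bounded by the
  conjugates of \<open>r\<close> can be combined into a single singular triangle. Hence
  \<open>\<parallel>G\<^sub>r\<parallel> \<le> (4 t + 2) / n\<close>. For \<open>t = k + 1\<close>, a cyclic cover of degree \<open>m\<close> replaces \<open>(n, k)\<close> by
  \<open>(m n, m k)\<close>, so \<open>\<parallel>G\<^sub>r\<parallel> \<le> 4 k / n\<close>, and it suffices to find a closed surface with
  \<open>k < n scl(r)\<close>.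

  Surfaces bounding powers of \<open>r\<close> are glued from finitely many types of polygons, and by Dickson's
  lemma the monoid of gluings is finitely generated. Therefore the infimum defining \<open>scl(r)\<close> is
  attained by a surface \<open>\<Sigma>\<close> with \<open>- \<chi>(\<Sigma>) \<le> 2 n scl(r)\<close>. Capping off its boundary circles, of which
  there is at least one, increases the Euler characteristic; this gives the strict inequality.
\<close>

section \<open>Products of commutators and of conjugates\<close>

text \<open>Approximating scl(r) by cl(r^N)/N gives only the bound 4 scl(r): capping the one
  boundary circle of such a surface gains O(1/N), which vanishes in the limit. A fixed surface
  realising scl(r) is needed, so that its caps are worth a fixed amount. It is found by
  contradiction: if all gluings missed the optimal ratio, finite generation would yield a gap
  proportional to N, against convergence to scl(r). Polygons record only pairs of positions in
  \<open>r\<close>, so they are finite in number and the matching conditions are linear over the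
  natural numbers. Surfaces never appear as spaces. They are finite sets of letters with an
  involution without fixed points and a labelling of vertices, and Euler characteristics are counts.
  Labels may identify too many vertices, so all genus statements are inequalities. The other
  obstacle is to recognise the class of the resulting cycle. Degrees are computed relative to the
  1-skeleton, where a triangle in the graph counts 0 and the 2-cell counts 1; the return to absolute
  classes rests on the vanishing of H_2 of a possibly infinite graph.\<close>

definition comm_prod :: "('g, 'b) monoid_scheme \<Rightarrow> nat \<Rightarrow> 'g \<Rightarrow> bool" where
  "comm_prod G t w \<longleftrightarrow>
     (\<exists>cs. length cs = t \<and> set cs \<subseteq> derived_set G (carrier G) \<and> foldr (monoid.mult G) cs \<one>\<^bsub>G\<^esub> = w)"

text \<open>Only conjugates of \<open>r\<close> itself are allowed, never of its inverse, so the
  index is the degree with which the capped surface covers the 2-cell.\<close>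

inductive conj_prod :: "('g, 'b) monoid_scheme \<Rightarrow> 'g \<Rightarrow> nat \<Rightarrow> 'g \<Rightarrow> bool" for G r where
  conj_prod_one: "conj_prod G r 0 \<one>\<^bsub>G\<^esub>"
| conj_prod_step: "conj_prod G r n w \<Longrightarrow> h \<in> carrier G \<Longrightarrow>
     conj_prod G r (Suc n) (w \<otimes>\<^bsub>G\<^esub> (h \<otimes>\<^bsub>G\<^esub> r \<otimes>\<^bsub>G\<^esub> inv\<^bsub>G\<^esub> h))"

lemma commutator_length_eq: "commutator_length G w = (LEAST t. comm_prod G t w)"
  unfolding commutator_length_def comm_prod_def ..

context group
begin

lemma inv_cancel_left [simp]: "x \<in> carrier G \<Longrightarrow> y \<in> carrier G \<Longrightarrow> inv x \<otimes> (x \<otimes> y) = y"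
  by (simp add: m_assoc[symmetric])

lemma cancel_inv_left [simp]: "x \<in> carrier G \<Longrightarrow> y \<in> carrier G \<Longrightarrow> x \<otimes> (inv x \<otimes> y) = y"
  by (simp add: m_assoc[symmetric])

lemma conj_mult:
  "\<lbrakk>h \<in> carrier G; x \<in> carrier G; y \<in> carrier G\<rbrakk> \<Longrightarrow>
     h \<otimes> (x \<otimes> y) \<otimes> inv h = (h \<otimes> x \<otimes> inv h) \<otimes> (h \<otimes> y \<otimes> inv h)"
  by (simp add: m_assoc)

lemma comm_prod_0 [simp]: "comm_prod G 0 w \<longleftrightarrow> w = \<one>"
  by (auto simp: comm_prod_def)

lemma comm_prod_Suc:
  "comm_prod G (Suc t) w \<longleftrightarrow>
     (\<exists>a\<in>carrier G. \<exists>b\<in>carrier G. \<exists>v. comm_prod G t v \<and> w = (a \<otimes> b \<otimes> inv a \<otimes> inv b) \<otimes> v)"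
  (is "?L \<longleftrightarrow> ?R")
proof
  assume ?L
  then obtain cs where cs: "length cs = Suc t" "set cs \<subseteq> derived_set G (carrier G)"
      "foldr (\<otimes>) cs \<one> = w"
    by (auto simp: comm_prod_def)
  then obtain c cs' where c: "cs = c # cs'" by (cases cs) auto
  then obtain a b where "a \<in> carrier G" "b \<in> carrier G" "c = a \<otimes> b \<otimes> inv a \<otimes> inv b"
    using cs by auto
  moreover have "comm_prod G t (foldr (\<otimes>) cs' \<one>)"
    using cs c by (auto simp: comm_prod_def)
  ultimately show ?R using cs(3) c by auto
next
  assume ?R
  then obtain a b v cs where *: "a \<in> carrier G" "b \<in> carrier G" "w = (a \<otimes> b \<otimes> inv a \<otimes> inv b) \<otimes> v"
      "length cs = t" "set cs \<subseteq> derived_set G (carrier G)" "foldr (\<otimes>) cs \<one> = v"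
    by (auto simp: comm_prod_def)
  then show ?L unfolding comm_prod_def
    by (intro exI[of _ "(a \<otimes> b \<otimes> inv a \<otimes> inv b) # cs"]) auto
qed

lemma comm_prod_SucI:
  "\<lbrakk>a \<in> carrier G; b \<in> carrier G; comm_prod G t v\<rbrakk> \<Longrightarrow>
     comm_prod G (Suc t) ((a \<otimes> b \<otimes> inv a \<otimes> inv b) \<otimes> v)"
  unfolding comm_prod_Suc by blast

lemma comm_prod_closed: "comm_prod G t w \<Longrightarrow> w \<in> carrier G"
  by (induction t arbitrary: w) (auto simp: comm_prod_Suc)

lemma comm_prod_mult: "comm_prod G s u \<Longrightarrow> comm_prod G t v \<Longrightarrow> comm_prod G (s + t) (u \<otimes> v)"
proof (induction s arbitrary: u)
  case 0
  then show ?case using comm_prod_closed[OF "0"(2)] by simp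
next
  case (Suc s)
  then obtain a b u' where *: "a \<in> carrier G" "b \<in> carrier G" "comm_prod G s u'"
      "u = (a \<otimes> b \<otimes> inv a \<otimes> inv b) \<otimes> u'"
    unfolding comm_prod_Suc by blast
  have "comm_prod G (s + t) (u' \<otimes> v)" using Suc * by blast
  moreover have "u \<otimes> v = (a \<otimes> b \<otimes> inv a \<otimes> inv b) \<otimes> (u' \<otimes> v)"
    using * Suc.prems comm_prod_closed[of s u'] comm_prod_closed[of t v] by (simp add: m_assoc)
  ultimately show ?case using * by (auto simp: comm_prod_Suc)
qed

lemma comm_prod_conj:
  "comm_prod G t w \<Longrightarrow> h \<in> carrier G \<Longrightarrow> comm_prod G t (h \<otimes> w \<otimes> inv h)"
proof (induction t arbitrary: w)
  case (Suc t)
  then obtain a b v where *: "a \<in> carrier G" "b \<in> carrier G" "comm_prod G t v"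
      "w = (a \<otimes> b \<otimes> inv a \<otimes> inv b) \<otimes> v"
    unfolding comm_prod_Suc by blast
  define a' b' where "a' = h \<otimes> a \<otimes> inv h" and "b' = h \<otimes> b \<otimes> inv h"
  have "h \<otimes> w \<otimes> inv h = (a' \<otimes> b' \<otimes> inv a' \<otimes> inv b') \<otimes> (h \<otimes> v \<otimes> inv h)"
    using * Suc.prems comm_prod_closed[of t v] by (simp add: m_assoc inv_mult_group a'_def b'_def)
  moreover have "a' \<in> carrier G" "b' \<in> carrier G" using * Suc.prems by (auto simp: a'_def b'_def)
  ultimately show ?case using Suc * unfolding comm_prod_Suc by blast
qed simp

lemma comm_prod_1_inv: "comm_prod G (Suc 0) w \<Longrightarrow> comm_prod G (Suc 0) (inv w)"
proof -
  assume "comm_prod G (Suc 0) w"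
  then obtain a b where "a \<in> carrier G" "b \<in> carrier G" "w = a \<otimes> b \<otimes> inv a \<otimes> inv b"
    unfolding comm_prod_Suc by auto
  then have "inv w = b \<otimes> a \<otimes> inv b \<otimes> inv a \<otimes> \<one>" "a \<in> carrier G" "b \<in> carrier G"
    by (auto simp: m_assoc inv_mult_group)
  then show ?thesis unfolding comm_prod_Suc by auto
qed

lemma comm_prod_inv: "comm_prod G t w \<Longrightarrow> comm_prod G t (inv w)"
proof (induction t arbitrary: w)
  case (Suc t)
  then obtain a b v where *: "a \<in> carrier G" "b \<in> carrier G" "comm_prod G t v"
      "w = (a \<otimes> b \<otimes> inv a \<otimes> inv b) \<otimes> v"
    unfolding comm_prod_Suc by blast
  have "comm_prod G (Suc 0) (a \<otimes> b \<otimes> inv a \<otimes> inv b)"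
    using * unfolding comm_prod_Suc by auto
  then have "comm_prod G (t + Suc 0) (inv v \<otimes> inv (a \<otimes> b \<otimes> inv a \<otimes> inv b))"
    by (intro comm_prod_mult comm_prod_1_inv Suc.IH[OF *(3)])
  then show ?case using * comm_prod_closed[of t v] by (simp add: inv_mult_group)
qed simp

lemma comm_prod_mono: "comm_prod G s w \<Longrightarrow> s \<le> t \<Longrightarrow> comm_prod G t w"
proof -
  assume w: "comm_prod G s w" and "s \<le> t"
  have "comm_prod G k \<one>" for k
    by (induction k) (auto simp: comm_prod_Suc intro!: bexI[of _ \<one>] exI[of _ \<one>])
  from comm_prod_mult[OF w this[of "t - s"]] show ?thesis
    using \<open>s \<le> t\<close> comm_prod_closed[OF w] by simp
qed

lemma comm_prod_derived: "w \<in> derived G (carrier G) \<Longrightarrow> \<exists>t. comm_prod G t w"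
  unfolding derived_def
proof (induction w rule: generate.induct)
  case one
  then show ?case using comm_prod_0 by blast
next
  case (incl h)
  then have "comm_prod G (Suc 0) h" by (auto simp: comm_prod_Suc)
  then show ?case ..
next
  case (inv h)
  then have "comm_prod G (Suc 0) h" by (auto simp: comm_prod_Suc)
  then show ?case using comm_prod_inv by blast
next
  case (eng h1 h2)
  then show ?case using comm_prod_mult by blast
qed

lemma commutator_length_le: "comm_prod G t w \<Longrightarrow> commutator_length G w \<le> t"
  by (simp add: commutator_length_eq Least_le)

lemma commutator_length_conj:
  assumes "w \<in> carrier G" "h \<in> carrier G"
  shows "commutator_length G (h \<otimes> w \<otimes> inv h) = commutator_length G w"
proof -
  have "comm_prod G t (h \<otimes> w \<otimes> inv h) \<longleftrightarrow> comm_prod G t w" for t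
  proof
    assume "comm_prod G t (h \<otimes> w \<otimes> inv h)"
    then have "comm_prod G t (inv h \<otimes> (h \<otimes> w \<otimes> inv h) \<otimes> inv (inv h))"
      by (rule comm_prod_conj) (use assms in auto)
    also have "inv h \<otimes> (h \<otimes> w \<otimes> inv h) \<otimes> inv (inv h) = w"
      using assms by (simp add: m_assoc)
    finally show "comm_prod G t w" .
  qed (rule comm_prod_conj[OF _ assms(2)])
  then show ?thesis by (simp add: commutator_length_eq)
qed

lemma conj_pow:
  assumes "w \<in> carrier G" "h \<in> carrier G"
  shows "(h \<otimes> w \<otimes> inv h) [^] (n::nat) = h \<otimes> w [^] n \<otimes> inv h"
  by (induction n) (use assms in \<open>auto simp: m_assoc\<close>)

lemma stable_commutator_length_conj:
  assumes "w \<in> carrier G" "h \<in> carrier G"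
  shows "stable_commutator_length G (h \<otimes> w \<otimes> inv h) = stable_commutator_length G w"
  using assms by (simp add: stable_commutator_length_def conj_pow commutator_length_conj)

lemma conj_prod_closed: "conj_prod G r n w \<Longrightarrow> r \<in> carrier G \<Longrightarrow> w \<in> carrier G"
  by (induction rule: conj_prod.induct) auto

lemma conj_prod_mult:
  assumes "r \<in> carrier G" "conj_prod G r m u"
  shows "conj_prod G r n v \<Longrightarrow> conj_prod G r (m + n) (u \<otimes> v)"
proof (induction rule: conj_prod.induct)
  case conj_prod_one
  then show ?case using assms conj_prod_closed[OF assms(2)] by simp
next
  case (conj_prod_step n w h)
  then have "conj_prod G r (Suc (m + n)) (u \<otimes> w \<otimes> (h \<otimes> r \<otimes> inv h))"
    by (intro conj_prod.conj_prod_step)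
  then show ?case using assms conj_prod_step.hyps conj_prod_closed[of r m u] conj_prod_closed[of r n w] by (simp add: m_assoc)
qed

lemma conj_prod_conj:
  assumes "r \<in> carrier G" "g \<in> carrier G"
  shows "conj_prod G r n w \<Longrightarrow> conj_prod G r n (g \<otimes> w \<otimes> inv g)"
proof (induction rule: conj_prod.induct)
  case conj_prod_one
  then show ?case using assms by (simp add: conj_prod.conj_prod_one)
next
  case (conj_prod_step n w h)
  have "conj_prod G r (Suc n) (g \<otimes> w \<otimes> inv g \<otimes> ((g \<otimes> h) \<otimes> r \<otimes> inv (g \<otimes> h)))"
    using conj_prod_step assms by (intro conj_prod.conj_prod_step) auto
  then show ?case
    using assms conj_prod_step.hyps conj_prod_closed[of r n w] by (simp add: m_assoc inv_mult_group)
qed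

lemma conj_prod_self: "r \<in> carrier G \<Longrightarrow> conj_prod G r 1 r"
  using conj_prod_step[OF conj_prod_one, of \<one> G r] by simp

lemma conj_prod_pow: "r \<in> carrier G \<Longrightarrow> conj_prod G r n (r [^] n)"
proof (induction n)
  case (Suc n)
  then show ?case using conj_prod_mult[OF _ Suc.IH conj_prod_self] by simp
qed (simp add: conj_prod_one)

text \<open>Since \<open>u y v = (u v) (v^-1 y v)\<close>, inserting a factor in the middle costs
  only a conjugation. This is what gluing a further disc along a boundary edge does to the boundary
  word.\<close>

lemma conj_prod_insert:
  assumes "r \<in> carrier G" "u \<in> carrier G" "v \<in> carrier G"
    and "conj_prod G r m (u \<otimes> v)" "conj_prod G r n y"
  shows "conj_prod G r (m + n) (u \<otimes> y \<otimes> v)"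
proof -
  have "conj_prod G r (m + n) ((u \<otimes> v) \<otimes> (inv v \<otimes> y \<otimes> inv (inv v)))"
    by (rule conj_prod_mult[OF assms(1,4) conj_prod_conj[OF assms(1) _ assms(5)]]) (use assms in auto)
  then show ?thesis using assms conj_prod_closed[of r n y] by (simp add: m_assoc)
qed

text \<open>A conjugate of \<open>r\<close> by \<open>g\<close> is a conjugate of
  \<open>h r h^-1\<close> by \<open>g h^-1\<close>; this makes the degree insensitive to cyclic
  reduction.\<close>

lemma conj_prod_conj_base:
  assumes "r \<in> carrier G" "h \<in> carrier G"
  shows "conj_prod G r n w \<Longrightarrow> conj_prod G (h \<otimes> r \<otimes> inv h) n w"
proof (induction rule: conj_prod.induct)
  case conj_prod_one
  then show ?case by (rule conj_prod.conj_prod_one)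
next
  case (conj_prod_step n w g)
  have "conj_prod G (h \<otimes> r \<otimes> inv h) (Suc n)
          (w \<otimes> ((g \<otimes> inv h) \<otimes> (h \<otimes> r \<otimes> inv h) \<otimes> inv (g \<otimes> inv h)))"
    using conj_prod_step assms by (intro conj_prod.conj_prod_step) auto
  then show ?case
    using assms conj_prod_step.hyps conj_prod_closed[of r n w] by (simp add: m_assoc inv_mult_group)
qed

text \<open>This is the algebraic form of passing to a cyclic cover of degree \<open>k\<close> of a closed surface
  of genus \<open>Suc t\<close>: the Euler characteristic is multiplied by \<open>k\<close>.\<close>

lemma cyclic_cover:
  assumes r: "r \<in> carrier G" and w: "conj_prod G r n w" "comm_prod G (Suc t) w"
  shows "\<exists>v. conj_prod G r (k * n) v \<and> comm_prod G (k * t + 1) v"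
proof -
  obtain a b c where ab: "a \<in> carrier G" "b \<in> carrier G" and c: "comm_prod G t c"
      and weq: "w = (a \<otimes> b \<otimes> inv a \<otimes> inv b) \<otimes> c"
    using w(2) unfolding comm_prod_Suc by blast
  have cc: "c \<in> carrier G" and wc: "w \<in> carrier G"
    using comm_prod_closed[OF c] comm_prod_closed[OF w(2)] .
  \<comment> \<open>The commutator of \<open>a^k\<close> and \<open>b\<close> is a single commutator
    for every \<open>k\<close>: it contributes the constant 1 in \<open>k * t + 1\<close>.\<close>
  define x where "x k = a [^] (k::nat) \<otimes> b \<otimes> inv (a [^] k) \<otimes> inv b" for k
  have xc: "x k \<in> carrier G" for k using ab by (simp add: x_def)
  \<comment> \<open>This is \<open>[a^(k+1), b] = a [a^k, b] a^-1 [a, b]\<close>, with the last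
    factor written as \<open>w c^-1\<close>.\<close>
  have xS: "x (Suc k) = (a \<otimes> x k \<otimes> inv a) \<otimes> w \<otimes> inv c" for k
    using ab cc unfolding x_def weq nat_pow_Suc2[OF ab(1)] by (simp add: inv_mult_group m_assoc)
  have "\<exists>d. comm_prod G (k * t) d \<and> conj_prod G r (k * n) (x k \<otimes> d)" for k
  proof (induction k)
    case 0
    then show ?case using ab by (simp add: x_def conj_prod_one)
  next
    case (Suc k)
    then obtain d where d: "comm_prod G (k * t) d" "conj_prod G r (k * n) (x k \<otimes> d)" by blast
    have dc: "d \<in> carrier G" using comm_prod_closed[OF d(1)] .
    \<comment> \<open>The leading \<open>c\<close> cancels the \<open>c^-1\<close> of the recursion,
      so that \<open>w\<close> with its \<open>n\<close> conjugates remains in the middle.\<close>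
    define d' where "d' = c \<otimes> (a \<otimes> d \<otimes> inv a)"
    have 1: "comm_prod G (t + k * t) d'"
      unfolding d'_def by (rule comm_prod_mult[OF c comm_prod_conj[OF d(1) ab(1)]])
    have "conj_prod G r (k * n + n) ((a \<otimes> x k \<otimes> inv a) \<otimes> w \<otimes> (a \<otimes> d \<otimes> inv a))"
    proof (rule conj_prod_insert)
      have "conj_prod G r (k * n) (a \<otimes> (x k \<otimes> d) \<otimes> inv a)"
        by (rule conj_prod_conj[OF r ab(1) d(2)])
      then show "conj_prod G r (k * n) ((a \<otimes> x k \<otimes> inv a) \<otimes> (a \<otimes> d \<otimes> inv a))"
        using ab xc dc by (simp add: conj_mult)
    qed (use r ab xc dc w in auto)
    moreover have "x (Suc k) \<otimes> d' = (a \<otimes> x k \<otimes> inv a) \<otimes> w \<otimes> (a \<otimes> d \<otimes> inv a)"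
      using ab xc dc wc cc unfolding xS d'_def by (simp add: m_assoc)
    ultimately have "conj_prod G r (Suc k * n) (x (Suc k) \<otimes> d')" by (simp add: add.commute)
    with 1 show ?case by auto
  qed
  then obtain d where d: "comm_prod G (k * t) d" "conj_prod G r (k * n) (x k \<otimes> d)" by blast
  have "comm_prod G (Suc (k * t)) (x k \<otimes> d)"
    unfolding x_def by (rule comm_prod_SucI[OF _ ab(2) d(1)]) (use ab in simp)
  with d show ?thesis by auto
qed

end

section \<open>Words in the free group\<close>

definition reduce :: "'a word \<Rightarrow> 'a word" where
  "reduce u = foldr push u []"

lemma reduce_Nil [simp]: "reduce [] = []"
  by (simp add: reduce_def)

lemma reduced_reduce [simp]: "reduced_word (reduce u)"
  by (simp add: reduce_def reduced_foldr_push)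

lemma reduce_reduced: "reduced_word w \<Longrightarrow> reduce w = w"
  by (simp add: reduce_def foldr_push_Nil)

lemma foldr_push_reduce: "reduced_word w \<Longrightarrow> foldr push (reduce u) w = foldr push u w"
  using foldr_push_assoc[of w u "[]"] by (simp add: reduce_def)

lemma one_free_group: "\<one>\<^bsub>free_group S\<^esub> = []"
  by (simp add: free_group_def)

lemma carrier_free_group: "w \<in> carrier (free_group S) \<longleftrightarrow> reduced_word w \<and> fst ` set w \<subseteq> S"
  by (simp add: free_group_def)

lemma mult_free_group: "u \<otimes>\<^bsub>free_group S\<^esub> v = foldr push u v"
  by (simp add: free_group_def)

lemma reduce_in_carrier: "fst ` set u \<subseteq> S \<Longrightarrow> reduce u \<in> carrier (free_group S)"
  using set_foldr_push[of u "[]"] by (auto simp: carrier_free_group reduce_def reduced_foldr_push)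

lemma reduce_append: "reduce (u @ v) = reduce u \<otimes>\<^bsub>free_group S\<^esub> reduce v"
  by (simp add: mult_free_group foldr_push_reduce) (simp add: reduce_def)

lemma inv_free_group:
  assumes "w \<in> carrier (free_group S)"
  shows "inv\<^bsub>free_group S\<^esub> w = reduce (rev (map flip w))"
proof -
  interpret group "free_group S" by (rule group_free_group)
  have "reduce (rev (map flip w)) \<in> carrier (free_group S)"
    using assms by (intro reduce_in_carrier) (auto simp: carrier_free_group)
  moreover have "reduce (rev (map flip w)) \<otimes>\<^bsub>free_group S\<^esub> w = \<one>\<^bsub>free_group S\<^esub>"
    using assms foldr_push_inverse[of "[]" w]
    by (simp add: mult_free_group carrier_free_group foldr_push_reduce foldr_push_Nil one_free_group)
  ultimately show ?thesis using assms inv_equality by blast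
qed

lemma reduce_single_flip: "reduce [flip x] = inv\<^bsub>free_group S\<^esub> (reduce [x])"
  if "fst x \<in> S"
  using that by (subst inv_free_group) (auto simp: carrier_free_group reduce_def reduced_word_def)

lemma reduce_concat_replicate:
  assumes "w \<in> carrier (free_group S)"
  shows "reduce (concat (replicate n w)) = w [^]\<^bsub>free_group S\<^esub> n"
proof (induction n)
  case (Suc n)
  interpret group "free_group S" by (rule group_free_group)
  show ?case
    using Suc assms nat_pow_Suc2[OF assms, of n] reduce_append[of w _ S] reduce_reduced[of w]
    by (simp add: carrier_free_group)
qed (simp add: one_free_group)

section \<open>Surface words\<close>

text \<open>
  Oriented edges \<open>x\<close> come with their reversals \<open>\<pi> x\<close> and their initial vertices \<open>h x\<close>. In a
  surface word the edges form the boundary of a polygon that is glued along \<open>\<pi>\<close>, and the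
  inequality bounds the genus of the resulting surface by its Euler characteristic.
\<close>

primrec walk :: "('d \<Rightarrow> 'd) \<Rightarrow> ('d \<Rightarrow> 'c) \<Rightarrow> 'c \<Rightarrow> 'd list \<Rightarrow> 'c \<Rightarrow> bool" where
  "walk \<pi> h a [] b \<longleftrightarrow> a = b"
| "walk \<pi> h a (x # xs) b \<longleftrightarrow> h x = a \<and> walk \<pi> h (h (\<pi> x)) xs b"

lemma walk_append: "walk \<pi> h a (xs @ ys) b \<longleftrightarrow> (\<exists>c. walk \<pi> h a xs c \<and> walk \<pi> h c ys b)"
  by (induction xs arbitrary: a) auto

lemma walk_start: "walk \<pi> h a xs b \<Longrightarrow> a \<in> insert b (h ` set xs)"
  by (cases xs) auto

lemma walk_map:
  assumes "\<And>x. x \<in> set xs \<Longrightarrow> h' x = f (h x) \<and> h' (\<pi>' x) = f (h (\<pi> x))"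
  shows "walk \<pi> h a xs b \<Longrightarrow> walk \<pi>' h' (f a) xs (f b)"
  using assms by (induction xs arbitrary: a) auto

definition surface_word :: "nat \<Rightarrow> 'a word \<Rightarrow> bool" where
  "surface_word g w \<longleftrightarrow>
     (\<exists>(ds::nat list) \<pi> (h::nat \<Rightarrow> nat) l a.
        distinct ds \<and> walk \<pi> h a ds a \<and>
        (\<forall>x\<in>set ds. \<pi> x \<in> set ds \<and> \<pi> (\<pi> x) = x \<and> l (\<pi> x) = flip (l x)) \<and>
        map l ds = w \<and> length ds + 2 \<le> 4 * g + 2 * card (insert a (h ` set ds)))"

lemma flip_neq [simp]: "flip x \<noteq> x" "x \<noteq> flip x"
  by (auto simp: flip_def prod_eq_iff)

lemma surface_word_Nil: "surface_word 0 []"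
  unfolding surface_word_def by (rule exI[of _ "[]"]) auto

section \<open>Effect of cancellation and exchange of subwords on the Euler characteristic\<close>

lemma card_le_Suc_if_subset_insert: "A \<subseteq> insert c B \<Longrightarrow> finite B \<Longrightarrow> card A \<le> Suc (card B)"
  by (metis card_insert_le_m1 card_insert_if card_mono finite_insert le_SucI le_refl le_trans)

text \<open>If the two cancelling sides are glued to each other, their edge folds away together with
  its tip. Otherwise their partners become the two sides of one edge, which identifies two vertices.
  Either way one edge and at most one vertex disappear, so the inequality survives.\<close>

lemma surface_word_delete:
  assumes "surface_word g (u @ x # flip x # v)"
  shows "surface_word g (u @ v)"
proof -
  obtain ds :: "nat list" and \<pi> and h :: "nat \<Rightarrow> nat" and l a where
    dist: "distinct ds" and wk: "walk \<pi> h a ds a" and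
    inv: "\<And>x. x \<in> set ds \<Longrightarrow> \<pi> x \<in> set ds \<and> \<pi> (\<pi> x) = x \<and> l (\<pi> x) = flip (l x)" and
    lds: "map l ds = u @ x # flip x # v" and
    len: "length ds + 2 \<le> 4 * g + 2 * card (insert a (h ` set ds))"
    using assms unfolding surface_word_def by metis
  obtain us p q vs where ds: "ds = us @ p # q # vs" and us: "map l us = u" and vs: "map l vs = v"
      and lp: "l p = x" and lq: "l q = flip x"
    using lds by (auto simp: map_eq_append_conv map_eq_Cons_conv)
  define ds' where "ds' = us @ vs"
  have dist': "distinct ds'" and pq: "p \<notin> set ds'" "q \<notin> set ds'" "p \<noteq> q"
    using dist by (auto simp: ds ds'_def)
  have set_ds: "set ds = insert p (insert q (set ds'))" by (auto simp: ds ds'_def)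
  from wk have w1: "walk \<pi> h a us (h p)" and w2: "h q = h (\<pi> p)" and w3: "walk \<pi> h (h (\<pi> q)) vs a"
    by (auto simp: ds walk_append)
  have len': "length ds = length ds' + 2" by (simp add: ds ds'_def)
  show ?thesis
  proof (cases "\<pi> p = q")
    case True
    then have \<pi>q: "\<pi> q = p" using inv[of p] by (auto simp: set_ds)
    have inv': "\<pi> y \<in> set ds' \<and> \<pi> (\<pi> y) = y \<and> l (\<pi> y) = flip (l y)" if "y \<in> set ds'" for y
    proof -
      have "y \<in> set ds" using that by (simp add: set_ds)
      note i = inv[OF this]
      have "\<pi> y \<noteq> p" "\<pi> y \<noteq> q" using i that pq \<pi>q True by metis+
      then show ?thesis using i by (simp add: set_ds)
    qed
    have wk': "walk \<pi> h a ds' a"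
      using w1 w3 \<pi>q by (auto simp: ds'_def walk_append)
    have "h p \<in> insert a (h ` set vs)" using walk_start[OF w3] \<pi>q by simp
    then have "insert a (h ` set ds) \<subseteq> insert (h q) (insert a (h ` set ds'))"
      by (auto simp: set_ds ds'_def)
    from card_le_Suc_if_subset_insert[OF this] have "length ds' + 2 \<le> 4 * g + 2 * card (insert a (h ` set ds'))"
      using len len' by simp
    then show ?thesis
      unfolding surface_word_def using dist' wk' inv' us vs
      by (intro exI[of _ ds'] exI[of _ \<pi>] exI[of _ h] exI[of _ l] exI[of _ a]) (auto simp: ds'_def)
  next
    case False
    define p' q' where "p' = \<pi> p" and "q' = \<pi> q"
    have p': "p' \<in> set ds'" "\<pi> p' = p" "l p' = flip x"
      using inv[of p] False lp flip_neq(1)[of "l p"] by (auto simp: p'_def set_ds)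
    have q': "q' \<in> set ds'" "\<pi> q' = q" "l q' = x"
      using inv[of q] inv[of p] False lq pq by (auto simp: q'_def set_ds)
    have pq': "p' \<noteq> q'" using p' q' pq by auto
    \<comment> \<open>Gluing \<open>p'\<close> to \<open>q'\<close> forces their end points
      together: the start of \<open>q'\<close> is merged into the start of \<open>p\<close>. The
      other two end points, \<open>h q\<close> and \<open>h p'\<close>, coincide already.\<close>
    define f where "f c = (if c = h q' then h p else c)" for c
    define h' where "h' y = f (h y)" for y
    define \<pi>' where "\<pi>' = \<pi>(p' := q', q' := p')"
    have \<pi>other: "\<pi> y \<in> set ds' \<and> \<pi> y \<noteq> p' \<and> \<pi> y \<noteq> q'" if "y \<in> set ds'" "y \<noteq> p'" "y \<noteq> q'" for y
    proof -
      have "y \<in> set ds" using that by (simp add: set_ds)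
      note i = inv[OF this]
      have "\<pi> y \<noteq> p" "\<pi> y \<noteq> q" using i that pq unfolding p'_def q'_def by metis+
      moreover have "\<pi> y \<noteq> p'" "\<pi> y \<noteq> q'" using i that p' q' pq by metis+
      ultimately show ?thesis using i by (simp add: set_ds)
    qed
    have inv': "\<pi>' y \<in> set ds' \<and> \<pi>' (\<pi>' y) = y \<and> l (\<pi>' y) = flip (l y)" if "y \<in> set ds'" for y
    proof (cases "y = p' \<or> y = q'")
      case True
      then show ?thesis using p' q' pq' by (auto simp: \<pi>'_def)
    next
      case False
      have "y \<in> set ds" using that by (simp add: set_ds)
      note i = inv[OF this]
      from False show ?thesis using i \<pi>other[OF that] by (simp add: \<pi>'_def)
    qed
    have hq: "h q = h p'" using w2 by (simp add: p'_def)
    have hc: "h' y = f (h y) \<and> h' (\<pi>' y) = f (h (\<pi> y))" if "y \<in> set ds'" for y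
      using that p' q' pq' hq by (auto simp: h'_def \<pi>'_def f_def)
    have "walk \<pi>' h' (f a) us (f (h p))" "walk \<pi>' h' (f (h (\<pi> q))) vs (f a)"
      by (rule walk_map[OF hc w1] walk_map[OF hc w3]; simp add: ds'_def)+
    moreover have "f (h (\<pi> q)) = f (h p)" by (simp add: f_def q'_def)
    ultimately have wk': "walk \<pi>' h' (f a) ds' (f a)" by (auto simp: ds'_def walk_append)
    have "insert a (h ` set ds) \<subseteq> insert (h q') (insert (f a) (h' ` set ds'))"
    proof
      fix c assume "c \<in> insert a (h ` set ds)"
      then consider "c = a" | "c = h p" | y where "y \<in> set ds'" "c = h y"
        using hq p'(1) by (auto simp: set_ds)
      then show "c \<in> insert (h q') (insert (f a) (h' ` set ds'))"
      proof cases
        case 2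
        then have "c = h' q'" by (simp add: h'_def f_def)
        then show ?thesis using q' by auto
      qed (auto simp: h'_def f_def)
    qed
    from card_le_Suc_if_subset_insert[OF this] have "length ds' + 2 \<le> 4 * g + 2 * card (insert (f a) (h' ` set ds'))"
      using len len' by simp
    then show ?thesis
      unfolding surface_word_def using dist' wk' inv' us vs
      by (intro exI[of _ ds'] exI[of _ \<pi>'] exI[of _ h'] exI[of _ l] exI[of _ "f a"]) (auto simp: ds'_def)
  qed
qed

text \<open>The inserted pair bounds a new edge with a free tip: one edge more, and one fresh vertex
  \<open>e\<close>.\<close>

lemma surface_word_insert:
  assumes "surface_word g (u @ v)"
  shows "surface_word g (u @ x # flip x # v)"
proof -
  obtain ds :: "nat list" and \<pi> and h :: "nat \<Rightarrow> nat" and l a where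
    dist: "distinct ds" and wk: "walk \<pi> h a ds a" and
    inv: "\<And>x. x \<in> set ds \<Longrightarrow> \<pi> x \<in> set ds \<and> \<pi> (\<pi> x) = x \<and> l (\<pi> x) = flip (l x)" and
    lds: "map l ds = u @ v" and
    len: "length ds + 2 \<le> 4 * g + 2 * card (insert a (h ` set ds))"
    using assms unfolding surface_word_def by metis
  obtain us vs where ds: "ds = us @ vs" and us: "map l us = u" and vs: "map l vs = v"
    using lds by (auto simp: map_eq_append_conv)
  obtain p where p: "p \<notin> set ds"
    using ex_new_if_finite[of "set ds"] by (auto simp: infinite_UNIV_nat)
  obtain q where q: "q \<notin> insert p (set ds)"
    using ex_new_if_finite[of "insert p (set ds)"] by (auto simp: infinite_UNIV_nat)
  obtain e where e: "e \<notin> insert a (h ` set ds)"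
    using ex_new_if_finite[of "insert a (h ` set ds)"] by (auto simp: infinite_UNIV_nat)
  obtain c where w1: "walk \<pi> h a us c" and w2: "walk \<pi> h c vs a"
    using wk by (auto simp: ds walk_append)
  define \<pi>' h' l' ds' where "\<pi>' = \<pi>(p := q, q := p)" and "h' = h(p := c, q := e)"
    and "l' = l(p := x, q := flip x)" and "ds' = us @ p # q # vs"
  have inv': "\<pi>' y \<in> set ds' \<and> \<pi>' (\<pi>' y) = y \<and> l' (\<pi>' y) = flip (l' y)" if "y \<in> set ds'" for y
  proof (cases "y \<in> set ds")
    case True
    then show ?thesis
      using inv[OF True] p q ds by (auto simp: \<pi>'_def l'_def ds'_def)
  next
    case False
    then show ?thesis using that q by (auto simp: \<pi>'_def l'_def ds'_def ds)
  qed
  have hc: "h' y = h y \<and> h' (\<pi>' y) = h (\<pi> y)" if "y \<in> set ds" for y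
    using that inv[OF that] p q by (auto simp: h'_def \<pi>'_def)
  have "walk \<pi>' h' a us c" "walk \<pi>' h' c vs a"
    using walk_map[where f = id, of us h' h \<pi>' \<pi> a c] walk_map[where f = id, of vs h' h \<pi>' \<pi> c a] hc w1 w2
    by (auto simp: ds)
  then have wk': "walk \<pi>' h' a ds' a"
    using q by (auto simp: ds'_def walk_append h'_def \<pi>'_def)
  have "insert e (insert a (h ` set ds)) \<subseteq> insert a (h' ` set ds')"
    using hc q by (force simp: ds'_def ds h'_def)
  then have "card (insert e (insert a (h ` set ds))) \<le> card (insert a (h' ` set ds'))"
    by (intro card_mono) auto
  then have "length ds' + 2 \<le> 4 * g + 2 * card (insert a (h' ` set ds'))"
    using len e by (simp add: ds'_def ds)
  moreover have "map l' us = u" "map l' vs = v"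
    using us vs p q by (auto simp: l'_def ds intro!: map_cong)
  then have "map l' ds' = u @ x # flip x # v"
    using q by (auto simp: l'_def ds'_def)
  moreover have "distinct ds'" using dist p q by (auto simp: ds'_def ds)
  ultimately show ?thesis
    unfolding surface_word_def using wk' inv'
    by (intro exI[of _ ds'] exI[of _ \<pi>'] exI[of _ h'] exI[of _ l'] exI[of _ a]) auto
qed

lemma map_eq_appendE:
  assumes "map f xs = us @ vs"
  obtains ys zs where "xs = ys @ zs" "map f ys = us" "map f zs = vs"
  using assms by (auto simp: map_eq_append_conv)

text \<open>Exchanging the two middle segments is possible once the three vertices at their ends
  have become one. At most two vertices are lost, and the price is one handle.\<close>

lemma surface_word_swap:
  assumes "surface_word g (u1 @ u2 @ u3 @ u4)"
  shows "surface_word (Suc g) (u1 @ u3 @ u2 @ u4)"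
proof -
  obtain ds :: "nat list" and \<pi> and h :: "nat \<Rightarrow> nat" and l a where
    dist: "distinct ds" and wk: "walk \<pi> h a ds a" and
    inv: "\<And>x. x \<in> set ds \<Longrightarrow> \<pi> x \<in> set ds \<and> \<pi> (\<pi> x) = x \<and> l (\<pi> x) = flip (l x)" and
    lds: "map l ds = u1 @ u2 @ u3 @ u4" and
    len: "length ds + 2 \<le> 4 * g + 2 * card (insert a (h ` set ds))"
    using assms unfolding surface_word_def by metis
  obtain d1 e1 where d1: "ds = d1 @ e1" "map l d1 = u1" "map l e1 = u2 @ u3 @ u4"
    using map_eq_appendE[OF lds] .
  obtain d2 e2 where d2: "e1 = d2 @ e2" "map l d2 = u2" "map l e2 = u3 @ u4"
    using map_eq_appendE[OF d1(3)] .
  obtain d3 d4 where d3: "e2 = d3 @ d4" "map l d3 = u3" "map l d4 = u4"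
    using map_eq_appendE[OF d2(3)] .
  note u = d1(2) d2(2) d3(2,3)
  have ds: "ds = d1 @ d2 @ d3 @ d4" using d1 d2 d3 by simp
  obtain c1 c2 c3 where w: "walk \<pi> h a d1 c1" "walk \<pi> h c1 d2 c2" "walk \<pi> h c2 d3 c3" "walk \<pi> h c3 d4 a"
    using wk by (auto simp: ds walk_append)
  define f where "f c = (if c = c2 \<or> c = c3 then c1 else c)" for c
  define h' where "h' = f \<circ> h"
  define ds' where "ds' = d1 @ d3 @ d2 @ d4"
  have "walk \<pi> h' (f x) d (f y)" if "walk \<pi> h x d y" for x d y
    by (rule walk_map[OF _ that]) (auto simp: h'_def)
  from this[OF w(1)] this[OF w(2)] this[OF w(3)] this[OF w(4)]
  have wk': "walk \<pi> h' (f a) ds' (f a)"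
    by (auto simp: ds'_def walk_append f_def split: if_splits)
  have "insert a (h ` set ds) \<subseteq> insert c2 (insert c3 (insert (f a) (h' ` set ds')))"
    by (auto simp: h'_def f_def ds ds'_def)
  then have "card (insert a (h ` set ds)) \<le> Suc (Suc (card (insert (f a) (h' ` set ds'))))"
    by (meson card_le_Suc_if_subset_insert finite.intros finite_imageI finite_set le_trans Suc_le_mono subset_refl)
  then have "length ds' + 2 \<le> 4 * Suc g + 2 * card (insert (f a) (h' ` set ds'))"
    using len by (simp add: ds ds'_def)
  then show ?thesis
    unfolding surface_word_def using wk' inv u dist
    by (intro exI[of _ ds'] exI[of _ \<pi>] exI[of _ h'] exI[of _ l] exI[of _ "f a"]) (auto simp: ds'_def ds)
qed

lemma surface_word_push: "surface_word g (u @ x # v) \<longleftrightarrow> surface_word g (u @ push x v)"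
  by (cases v) (auto dest: surface_word_delete surface_word_insert)

lemma surface_word_foldr_push: "surface_word g (p @ u @ v) \<longleftrightarrow> surface_word g (p @ foldr push u v)"
proof (induction u arbitrary: p)
  case (Cons x u)
  have "surface_word g (p @ (x # u) @ v) \<longleftrightarrow> surface_word g ((p @ [x]) @ u @ v)" by simp
  also have "\<dots> \<longleftrightarrow> surface_word g ((p @ [x]) @ foldr push u v)" by (rule Cons)
  also have "\<dots> \<longleftrightarrow> surface_word g (p @ push x (foldr push u v))"
    using surface_word_push[of g p x] by simp
  finally show ?case by simp
qed simp

lemma surface_word_reduce: "surface_word g (reduce u) \<longleftrightarrow> surface_word g u"
  using surface_word_foldr_push[of g "[]" u "[]"] by (simp add: reduce_def)

text \<open>The word \<open>[a, b] v\<close> arises from \<open>a b b^-1 a^-1 v\<close>, which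
  represents \<open>v\<close>, by exchanging \<open>b^-1\<close> and \<open>a^-1\<close>; so each
  commutator costs one exchange.\<close>

lemma surface_word_comm_prod: "comm_prod (free_group S) g w \<Longrightarrow> surface_word g w"
proof (induction g arbitrary: w)
  interpret group "free_group S" by (rule group_free_group)
  case 0
  then show ?case using surface_word_Nil by (simp add: one_free_group)
next
  interpret group "free_group S" by (rule group_free_group)
  case (Suc g)
  then obtain a b v where a: "a \<in> carrier (free_group S)" and b: "b \<in> carrier (free_group S)"
      and v: "comm_prod (free_group S) g v" "w = (a \<otimes>\<^bsub>free_group S\<^esub> b \<otimes>\<^bsub>free_group S\<^esub>
        inv\<^bsub>free_group S\<^esub> a \<otimes>\<^bsub>free_group S\<^esub> inv\<^bsub>free_group S\<^esub> b) \<otimes>\<^bsub>free_group S\<^esub> v"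
    unfolding comm_prod_Suc by blast
  define A B where "A = rev (map flip a)" and "B = rev (map flip b)"
  have red: "reduced_word a" "reduced_word b" "reduced_word v"
    using a b comm_prod_closed[OF v(1)] by (auto simp: carrier_free_group)
  have "reduce A = inv\<^bsub>free_group S\<^esub> a" "reduce B = inv\<^bsub>free_group S\<^esub> b"
    by (simp_all add: A_def B_def inv_free_group[OF a] inv_free_group[OF b])
  then have w: "w = reduce (a @ b @ A @ B @ v)"
    unfolding v(2) reduce_append[of _ _ S]
    using red a b comm_prod_closed[OF v(1)] by (simp add: m_assoc reduce_reduced)
  have "foldr push (a @ b @ B @ A) v = v"
  proof -
    have *: "foldr push u (foldr push (rev (map flip u)) z) = z" if "reduced_word z" for u z :: "'a word"
      using foldr_push_inverse[OF that, of "rev (map flip u)"] by (simp add: rev_map comp_def)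
    show ?thesis
      using *[of v a] *[of "foldr push A v" b] red by (simp add: A_def B_def reduced_foldr_push)
  qed
  then have "surface_word g (a @ b @ B @ A @ v)"
    using surface_word_foldr_push[of g "[]" "a @ b @ B @ A" v] Suc.IH[OF v(1)] by simp
  then have "surface_word (Suc g) (a @ b @ A @ B @ v)"
    using surface_word_swap[of g "a @ b" B A v] by simp
  then show ?case by (simp add: w surface_word_reduce)
qed

section \<open>From one-faced surfaces back to products of commutators\<close>

context group
begin

definition list_prod :: "('d \<Rightarrow> 'a) \<Rightarrow> 'd list \<Rightarrow> 'a" where
  "list_prod e xs = foldr (\<lambda>x. (\<otimes>) (e x)) xs \<one>"

lemma list_prod_simps [simp]:
  "list_prod e [] = \<one>" "list_prod e (x # xs) = e x \<otimes> list_prod e xs"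
  by (simp_all add: list_prod_def)

lemma list_prod_closed [simp]: "e ` set xs \<subseteq> carrier G \<Longrightarrow> list_prod e xs \<in> carrier G"
  by (induction xs) auto

lemma list_prod_append:
  "e ` set xs \<subseteq> carrier G \<Longrightarrow> e ` set ys \<subseteq> carrier G \<Longrightarrow>
    list_prod e (xs @ ys) = list_prod e xs \<otimes> list_prod e ys"
  by (induction xs) (auto simp: m_assoc)

end

text \<open>An innermost pair \<open>x\<close>, \<open>\<pi> x\<close> is either adjacent or
  encloses some \<open>y\<close>; by minimality the partner of \<open>y\<close> lies outside, so the
  two pairs interleave.\<close>

lemma ex_adjacent_or_linked_pair:
  assumes "distinct ds" "ds \<noteq> []" and inv: "\<And>x. x \<in> set ds \<Longrightarrow> \<pi> x \<in> set ds \<and> \<pi> (\<pi> x) = x \<and> \<pi> x \<noteq> x"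
  shows "(\<exists>A x B. ds = A @ x # \<pi> x # B) \<or>
         (\<exists>A x B y C D E. ds = A @ x # B @ y # C @ \<pi> x # D @ \<pi> y # E)"
proof (rule ccontr)
  assume neg: "\<not> ?thesis"
  define P where "P n \<longleftrightarrow> (\<exists>A x B E. ds = A @ x # B @ \<pi> x # E \<and> length B = n)" for n
  have "\<exists>n. P n"
  proof -
    obtain x xs where ds: "ds = x # xs" using assms by (cases ds) auto
    then have "\<pi> x \<in> set xs" using inv[of x] by auto
    then obtain B E where "xs = B @ \<pi> x # E" by (meson split_list)
    then have "ds = [] @ x # B @ \<pi> x # E" using ds by simp
    then show ?thesis unfolding P_def by blast
  qed
  define n where "n = (LEAST n. P n)"
  have "P n" unfolding n_def by (rule LeastI_ex) fact
  then obtain A x B E where ds: "ds = A @ x # B @ \<pi> x # E" and "length B = n"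
    by (auto simp: P_def)
  have "B \<noteq> []" using neg ds by fastforce
  then obtain y B' where "B = y # B'" by (cases B) auto
  then have "y \<in> set B" by simp
  then obtain B1 B2 where B: "B = B1 @ y # B2" by (meson split_list)
  have y: "y \<in> set ds" using B ds by simp
  have "\<pi> y \<notin> set B"
  proof
    assume "\<pi> y \<in> set B"
    then consider "\<pi> y \<in> set B1" | "\<pi> y \<in> set B2" using B inv[OF y] by auto
    then have "\<exists>m<n. P m"
    proof cases
      case 1
      then obtain B3 B4 where "B1 = B3 @ \<pi> y # B4" by (meson split_list)
      then have "ds = (A @ x # B3) @ \<pi> y # B4 @ \<pi> (\<pi> y) # (B2 @ \<pi> x # E)" "length B4 < n"
        using ds B \<open>length B = n\<close> inv[OF y] by auto
      then show ?thesis unfolding P_def by blast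
    next
      case 2
      then obtain B3 B4 where "B2 = B3 @ \<pi> y # B4" by (meson split_list)
      then have "ds = (A @ x # B1) @ y # B3 @ \<pi> y # (B4 @ \<pi> x # E)" "length B3 < n"
        using ds B \<open>length B = n\<close> by auto
      then show ?thesis unfolding P_def by blast
    qed
    then show False unfolding n_def using not_less_Least by blast
  qed
  moreover have "\<pi> y \<noteq> x" "\<pi> y \<noteq> \<pi> x"
  proof -
    have x: "x \<in> set ds" using ds by simp
    have "y \<noteq> x" "y \<noteq> \<pi> x" using assms(1) ds B by auto
    then show "\<pi> y \<noteq> x" "\<pi> y \<noteq> \<pi> x" using inv[OF x] inv[OF y] by metis+
  qed
  ultimately consider "\<pi> y \<in> set A" | "\<pi> y \<in> set E" using inv[OF y] ds by auto
  then show False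
  proof cases
    case 1
    then obtain A1 A2 where "A = A1 @ \<pi> y # A2" by (meson split_list)
    then have "ds = A1 @ \<pi> y # A2 @ x # B1 @ \<pi> (\<pi> y) # B2 @ \<pi> x # E"
      using ds B inv[OF y] by simp
    then show False using neg by blast
  next
    case 2
    then obtain E1 E2 where "E = E1 @ \<pi> y # E2" by (meson split_list)
    then have "ds = A @ x # B1 @ y # B2 @ \<pi> x # E1 @ \<pi> y # E2"
      using ds B by simp
    then show False using neg by blast
  qed
qed

context group
begin

text \<open>The cut-and-paste normal form of a handle. With \<open>a = E A x B\<close> and
  \<open>b = y C B\<close>, the given word conjugated by \<open>E\<close> equals
  \<open>[a, b]\<close> times \<open>b (E A D C B) b^-1\<close>, and the latter is conjugate to the
  remaining word.\<close>

lemma handle_identity: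
  assumes "A \<in> carrier G" "B \<in> carrier G" "C \<in> carrier G" "D \<in> carrier G" "E \<in> carrier G"
    and "x \<in> carrier G" "y \<in> carrier G"
    and rest: "comm_prod G t (A \<otimes> D \<otimes> C \<otimes> B \<otimes> E)"
  shows "comm_prod G (Suc t) (A \<otimes> x \<otimes> B \<otimes> y \<otimes> C \<otimes> inv x \<otimes> D \<otimes> inv y \<otimes> E)"
proof -
  define a b where "a = E \<otimes> A \<otimes> x \<otimes> B" and "b = y \<otimes> C \<otimes> B"
  have ab: "a \<in> carrier G" "b \<in> carrier G" using assms by (auto simp: a_def b_def)
  have "comm_prod G t (E \<otimes> (A \<otimes> D \<otimes> C \<otimes> B \<otimes> E) \<otimes> inv E)"
    by (rule comm_prod_conj[OF rest]) fact
  then have "comm_prod G t (b \<otimes> (E \<otimes> (A \<otimes> D \<otimes> C \<otimes> B \<otimes> E) \<otimes> inv E) \<otimes> inv b)"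
    by (rule comm_prod_conj) fact
  from comm_prod_SucI[OF ab this]
  have "comm_prod G (Suc t) (a \<otimes> b \<otimes> inv a \<otimes> inv b \<otimes>
      (b \<otimes> (E \<otimes> (A \<otimes> D \<otimes> C \<otimes> B \<otimes> E) \<otimes> inv E) \<otimes> inv b))" .
  from comm_prod_conj[OF this, of "inv E"]
  have "comm_prod G (Suc t) (inv E \<otimes> (a \<otimes> b \<otimes> inv a \<otimes> inv b \<otimes>
      (b \<otimes> (E \<otimes> (A \<otimes> D \<otimes> C \<otimes> B \<otimes> E) \<otimes> inv E) \<otimes> inv b)) \<otimes> inv (inv E))"
    using assms by simp
  also have "inv E \<otimes> (a \<otimes> b \<otimes> inv a \<otimes> inv b \<otimes>
      (b \<otimes> (E \<otimes> (A \<otimes> D \<otimes> C \<otimes> B \<otimes> E) \<otimes> inv E) \<otimes> inv b)) \<otimes> inv (inv E) =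
      A \<otimes> x \<otimes> B \<otimes> y \<otimes> C \<otimes> inv x \<otimes> D \<otimes> inv y \<otimes> E"
    using assms(1-7) unfolding a_def b_def by (simp add: m_assoc inv_mult_group)
  finally show ?thesis .
qed

text \<open>A closed walk traversing every edge once in each direction is the boundary word of a
  one-faced surface; cutting off handles one by one realises its genus.\<close>

lemma comm_prod_closed_walk:
  fixes h :: "'d \<Rightarrow> 'c"
  assumes "distinct ds" "walk \<pi> h a ds a"
    and "\<And>x. x \<in> set ds \<Longrightarrow> \<pi> x \<in> set ds \<and> \<pi> (\<pi> x) = x \<and> \<pi> x \<noteq> x"
    and "\<And>x. x \<in> set ds \<Longrightarrow> e x \<in> carrier G \<and> e (\<pi> x) = inv (e x)"
  shows "\<exists>t. 4 * t + 2 * card (insert a (h ` set ds)) \<le> length ds + 2 \<and> comm_prod G t (list_prod e ds)"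
  using assms
proof (induction "length ds" arbitrary: ds rule: less_induct)
  case less
  note dist = less.prems(1) and wk = less.prems(2) and inv = less.prems(3) and e = less.prems(4)
  have ec: "e ` set ds \<subseteq> carrier G" using e by auto
  show ?case
  proof (cases "ds = []")
    case True
    then show ?thesis by (intro exI[of _ 0]) auto
  next
    case False
    consider A x B where "ds = A @ x # \<pi> x # B"
      | A x B y C D E where "ds = A @ x # B @ y # C @ \<pi> x # D @ \<pi> y # E"
      using ex_adjacent_or_linked_pair[of ds \<pi>, OF dist False inv] by blast
    then show ?thesis
    proof cases
      \<comment> \<open>A folded edge: two sides and at most one vertex go, and the product is
        unchanged.\<close>
      case 1
      define q where "q = \<pi> x"
      define ds' where "ds' = A @ B"
      have ds: "ds = A @ x # q # B" by (simp add: 1 q_def)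
      have set_ds: "set ds = insert x (insert q (set ds'))" by (auto simp: ds ds'_def)
      have nin: "x \<notin> set ds'" "q \<notin> set ds'" using dist by (auto simp: ds ds'_def)
      have inx: "\<pi> x = q" "\<pi> q = x" using inv[of x] by (auto simp: q_def ds)
      from wk have w: "walk \<pi> h a A (h x)" "walk \<pi> h (h x) B a"
        using inx by (auto simp: ds walk_append)
      have inv': "\<pi> y \<in> set ds' \<and> \<pi> (\<pi> y) = y \<and> \<pi> y \<noteq> y" if "y \<in> set ds'" for y
      proof -
        have "y \<in> set ds" using that by (simp add: set_ds)
        note i = inv[OF this]
        have "\<pi> y \<noteq> x" "\<pi> y \<noteq> q" using i that nin inx by metis+
        then show ?thesis using i by (simp add: set_ds)
      qed
      have "\<exists>t. 4 * t + 2 * card (insert a (h ` set ds')) \<le> length ds' + 2 \<and> comm_prod G t (list_prod e ds')"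
      proof (rule less.hyps)
        show "walk \<pi> h a ds' a" using w by (auto simp: ds'_def walk_append)
      qed (use dist inv' e in \<open>auto simp: ds ds'_def\<close>)
      then obtain t where t: "4 * t + 2 * card (insert a (h ` set ds')) \<le> length ds' + 2"
          "comm_prod G t (list_prod e ds')" by blast
      have "e ` set A \<subseteq> carrier G" "e ` set B \<subseteq> carrier G" using ec by (auto simp: ds)
      then have "list_prod e ds = list_prod e ds'"
        using e[of x] inx by (simp add: ds ds'_def list_prod_append)
      moreover have "h x \<in> insert a (h ` set B)" using walk_start[OF w(2)] .
      then have "insert a (h ` set ds) \<subseteq> insert (h q) (insert a (h ` set ds'))"
        by (auto simp: set_ds ds'_def)
      from card_le_Suc_if_subset_insert[OF this]
      have "card (insert a (h ` set ds)) \<le> Suc (card (insert a (h ` set ds')))" by simp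
      ultimately show ?thesis using t by (intro exI[of _ t]) (auto simp: ds ds'_def)
    next
      \<comment> \<open>Two interleaved edges form a handle: \<open>t\<close> grows by one, four
        sides go and no vertex is lost, which balances exactly.\<close>
      case 2
      define p q where "p = \<pi> x" and "q = \<pi> y"
      define ds' where "ds' = A @ D @ C @ B @ E"
      have ds: "ds = A @ x # B @ y # C @ p # D @ q # E" by (simp add: 2 p_def q_def)
      have set_ds: "set ds = {x, y, p, q} \<union> set ds'" by (auto simp: ds ds'_def)
      have nin: "{x, y, p, q} \<inter> set ds' = {}" using dist by (auto simp: ds ds'_def)
      have inx: "\<pi> x = p" "\<pi> p = x" "\<pi> y = q" "\<pi> q = y"
        using inv[of x] inv[of y] by (auto simp: p_def q_def ds)
      from wk have w: "walk \<pi> h a A (h x)" "walk \<pi> h (h p) B (h y)" "walk \<pi> h (h q) C (h p)"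
         "walk \<pi> h (h x) D (h q)" "walk \<pi> h (h y) E a"
        using inx by (auto simp: ds walk_append)
      have inv': "\<pi> z \<in> set ds' \<and> \<pi> (\<pi> z) = z \<and> \<pi> z \<noteq> z" if "z \<in> set ds'" for z
      proof -
        have "z \<in> set ds" using that by (simp add: set_ds)
        note i = inv[OF this]
        have "z \<notin> {x, y, p, q}" using that nin by blast
        then have "\<pi> z \<notin> {x, y, p, q}" using i inx by auto
        then show ?thesis using i by (simp add: set_ds)
      qed
      have "\<exists>t. 4 * t + 2 * card (insert a (h ` set ds')) \<le> length ds' + 2 \<and> comm_prod G t (list_prod e ds')"
      proof (rule less.hyps)
        show "walk \<pi> h a ds' a" using w by (auto simp: ds'_def walk_append)
      qed (use dist inv' e in \<open>auto simp: ds ds'_def\<close>)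
      then obtain t where t: "4 * t + 2 * card (insert a (h ` set ds')) \<le> length ds' + 2"
          "comm_prod G t (list_prod e ds')" by blast
      have ey: "e x \<in> carrier G" "e y \<in> carrier G" "e p = inv (e x)" "e q = inv (e y)"
        using e[of x] e[of y] inx by (auto simp: ds)
      have sub: "e ` set A \<subseteq> carrier G" "e ` set B \<subseteq> carrier G" "e ` set C \<subseteq> carrier G"
         "e ` set D \<subseteq> carrier G" "e ` set E \<subseteq> carrier G" using ec by (auto simp: ds)
      have "comm_prod G t (list_prod e A \<otimes> list_prod e D \<otimes> list_prod e C \<otimes> list_prod e B \<otimes> list_prod e E)"
        using t(2) sub by (simp add: ds'_def list_prod_append image_Un m_assoc)
      then have "comm_prod G (Suc t) (list_prod e A \<otimes> e x \<otimes> list_prod e B \<otimes> e y \<otimes> list_prod e C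
          \<otimes> inv (e x) \<otimes> list_prod e D \<otimes> inv (e y) \<otimes> list_prod e E)"
        using sub ey by (intro handle_identity) auto
      then have "comm_prod G (Suc t) (list_prod e ds)"
        using sub ey by (simp add: ds list_prod_append image_Un m_assoc)
      \<comment> \<open>Each of these vertices is the start of a segment of the remaining walk, or
        its end if the segment is empty. In the order \<open>E\<close>, \<open>B\<close>,
        \<open>C\<close>, \<open>D\<close> the end is always known already.\<close>
      moreover have "{h x, h y, h p, h q} \<subseteq> insert a (h ` set ds')"
      proof -
        have "h y \<in> insert a (h ` set E)" using walk_start[OF w(5)] .
        then have y: "h y \<in> insert a (h ` set ds')" by (auto simp: ds'_def)
        then have p: "h p \<in> insert a (h ` set ds')" using walk_start[OF w(2)] by (auto simp: ds'_def)
        then have q: "h q \<in> insert a (h ` set ds')" using walk_start[OF w(3)] by (auto simp: ds'_def)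
        then have "h x \<in> insert a (h ` set ds')" using walk_start[OF w(4)] by (auto simp: ds'_def)
        then show ?thesis using y p q by simp
      qed
      then have "insert a (h ` set ds) = insert a (h ` set ds')" by (auto simp: set_ds)
      ultimately show ?thesis using t by (intro exI[of _ "Suc t"]) (auto simp: ds ds'_def)
    qed
  qed
qed

end

section \<open>Balanced sets of arcs\<close>

text \<open>The elements of \<open>C\<close> are arcs of a directed multigraph; at every node the
  outdegree equals the indegree.\<close>

definition balanced :: "('d \<Rightarrow> 'k) \<Rightarrow> ('d \<Rightarrow> 'k) \<Rightarrow> 'd set \<Rightarrow> bool" where
  "balanced src tgt C \<longleftrightarrow> (\<forall>a. card {x \<in> C. src x = a} = card {x \<in> C. tgt x = a})"

lemma balanced_if_inj:
  assumes "inj_on src A" "inj_on tgt A" "src ` A = tgt ` A"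
  shows "balanced src tgt A"
proof -
  have "card {x \<in> A. f x = a} = (if a \<in> f ` A then 1 else 0)" if f: "inj_on f A" for f :: "'a \<Rightarrow> 'b" and a
  proof (cases "a \<in> f ` A")
    case True
    then obtain x where "x \<in> A" "f x = a" by blast
    then have "{x \<in> A. f x = a} = {x}" using f by (auto simp: inj_on_def)
    then show ?thesis using True by simp
  next
    case False
    then have "{x \<in> A. f x = a} = {}" by blast
    then show ?thesis using False by (metis card.empty)
  qed
  then show ?thesis unfolding balanced_def using assms by metis
qed

lemma balanced_Diff:
  assumes "balanced src tgt C" "balanced src tgt A" "A \<subseteq> C" "finite C"
  shows "balanced src tgt (C - A)"
proof -
  have *: "card {x \<in> C - A. f x = a} = card {x \<in> C. f x = a} - card {x \<in> A. f x = a}" for f :: "'a \<Rightarrow> 'b" and a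
  proof -
    have "{x \<in> C - A. f x = a} = {x \<in> C. f x = a} - {x \<in> A. f x = a}" by blast
    moreover have "finite {x \<in> A. f x = a}" using assms(3,4) by (simp add: finite_subset)
    moreover have "{x \<in> A. f x = a} \<subseteq> {x \<in> C. f x = a}" using assms(3) by blast
    ultimately show ?thesis by (simp add: card_Diff_subset)
  qed
  show ?thesis using assms(1,2) unfolding balanced_def * by simp
qed

text \<open>A balanced multigraph contains a directed cycle. Choosing one outgoing arc at each node
  gives a self-map \<open>g\<close> of the nodes; a minimal nonempty invariant set is permuted by
  \<open>g\<close> and carries the cycle.\<close>

lemma balanced_imp_simple_subset:
  assumes "finite C" "C \<noteq> {}" "balanced src tgt C"
  shows "\<exists>A\<subseteq>C. A \<noteq> {} \<and> inj_on src A \<and> inj_on tgt A \<and> src ` A = tgt ` A"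
proof -
  define f where "f a = (SOME x. x \<in> C \<and> src x = a)" for a
  have f: "f a \<in> C" "src (f a) = a" if "a \<in> src ` C" for a
    using someI_ex[of "\<lambda>x. x \<in> C \<and> src x = a"] that unfolding f_def by auto
  define g where "g a = tgt (f a)" for a
  have g: "g a \<in> src ` C" if "a \<in> src ` C" for a
  proof -
    have "f a \<in> {x \<in> C. tgt x = g a}" using f[OF that] by (simp add: g_def)
    then have "card {x \<in> C. tgt x = g a} \<noteq> 0" using assms(1) by auto
    then have "card {x \<in> C. src x = g a} \<noteq> 0" using assms(3) by (simp add: balanced_def)
    then have "{x \<in> C. src x = g a} \<noteq> {}" by (metis card.empty)
    then obtain x where "x \<in> C" "src x = g a" by blast
    then show ?thesis by (metis imageI)
  qed
  define \<B> where "\<B> = {B. B \<subseteq> src ` C \<and> B \<noteq> {} \<and> g ` B \<subseteq> B}"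
  have "finite \<B>" unfolding \<B>_def using assms(1) by (auto intro: finite_subset[of _ "Pow (src ` C)"])
  moreover have "src ` C \<in> \<B>" using assms g by (auto simp: \<B>_def)
  ultimately obtain B where B: "B \<in> \<B>" and min: "\<And>B'. B' \<in> \<B> \<Longrightarrow> B' \<subseteq> B \<Longrightarrow> B = B'"
    using finite_has_minimal[of \<B>] by (metis empty_iff)
  have Bg: "g ` B \<subseteq> B" using B by (simp add: \<B>_def)
  then have "g ` B \<in> \<B>" using B by (auto simp: \<B>_def)
  then have gB: "g ` B = B" using min Bg by metis
  have Bsub: "B \<subseteq> src ` C" "B \<noteq> {}" using B by (auto simp: \<B>_def)
  have "finite B" using Bsub assms(1) finite_subset by blast
  then have ginj: "inj_on g B" using gB by (simp add: eq_card_imp_inj_on)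
  have srcf: "src (f a) = a" if "a \<in> B" for a using f Bsub that by blast
  have "inj_on src (f ` B)" by (rule inj_on_inverseI[of _ f]) (use srcf in auto)
  moreover have "inj_on tgt (f ` B)"
    using ginj by (auto simp: inj_on_def g_def)
  moreover have "src ` f ` B = B" using srcf by force
  moreover have "tgt ` f ` B = B" using gB by (simp add: g_def image_image)
  moreover have "f ` B \<subseteq> C" using f Bsub by blast
  ultimately show ?thesis using Bsub by (intro exI[of _ "f ` B"]) auto
qed

text \<open>Colours will be vertices of a ribbon graph, and more of them means a larger Euler
  characteristic. In a balanced colouring with the greatest number of colours every class is simple,
  for otherwise a simple part could be split off with a fresh colour.\<close>

lemma refine_colouring:
  fixes h :: "'d \<Rightarrow> nat"
  assumes "finite D" "\<And>c. balanced src tgt {x \<in> D. h x = c}"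
  shows "\<exists>h' :: 'd \<Rightarrow> nat. card (h ` D) \<le> card (h' ` D) \<and>
     (\<forall>c. let C = {x \<in> D. h' x = c} in inj_on src C \<and> inj_on tgt C \<and> src ` C = tgt ` C)"
proof -
  define P where "P h \<longleftrightarrow> (\<forall>c. balanced src tgt {x \<in> D. h x = c})" for h :: "'d \<Rightarrow> nat"
  have Ph: "P h" unfolding P_def by (intro allI assms(2))
  have "\<forall>h. P h \<longrightarrow> card (h ` D) < Suc (card D)"
    by (simp add: less_Suc_eq_le card_image_le[OF assms(1)])
  from ex_has_greatest_nat[of P h "\<lambda>h. card (h ` D)", OF Ph this]
  obtain h' where h': "P h'" and max: "\<And>h''. P h'' \<Longrightarrow> card (h'' ` D) \<le> card (h' ` D)"
    by blast
  have "let C = {x \<in> D. h' x = c} in inj_on src C \<and> inj_on tgt C \<and> src ` C = tgt ` C" for c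
  proof (cases "{x \<in> D. h' x = c} = {}")
    case True
    show ?thesis unfolding Let_def True by simp
  next
    case False
    define C where "C = {x \<in> D. h' x = c}"
    have C: "finite C" "C \<noteq> {}" "balanced src tgt C" using False h' assms(1) by (auto simp: C_def P_def)
    from balanced_imp_simple_subset[OF this]
    obtain A where A: "A \<subseteq> C" "A \<noteq> {}" "inj_on src A" "inj_on tgt A" "src ` A = tgt ` A"
      by blast
    have "A = C"
    proof (rule ccontr)
      assume ne: "A \<noteq> C"
      obtain e where e: "e \<notin> h' ` D"
        using ex_new_if_finite[of "h' ` D"] assms(1) by (auto simp: infinite_UNIV_nat)
      define h'' where "h'' x = (if x \<in> A then e else h' x)" for x
      have AD: "A \<subseteq> D" using A by (auto simp: C_def)
      have "balanced src tgt {x \<in> D. h'' x = c'}" for c'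
      proof -
        consider "c' = e" | "c' = c" "c' \<noteq> e" | "c' \<noteq> c" "c' \<noteq> e" by blast
        then show ?thesis
        proof cases
          case 1
          have "{x \<in> D. h'' x = c'} = A" using 1 e AD by (auto simp: h''_def)
          then show ?thesis using balanced_if_inj A by metis
        next
          case 2
          have "{x \<in> D. h'' x = c'} = C - A" using 2 by (auto simp: h''_def C_def)
          then show ?thesis using balanced_Diff[OF C(3) balanced_if_inj] A C by simp
        next
          case 3
          have "{x \<in> D. h'' x = c'} = {x \<in> D. h' x = c'}" using 3 A by (auto simp: h''_def C_def)
          then show ?thesis using h' by (simp add: P_def)
        qed
      qed
      then have "card (h'' ` D) \<le> card (h' ` D)" by (intro max) (simp add: P_def)
      moreover have "insert e (h' ` D) \<subseteq> h'' ` D"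
      proof
        fix y assume "y \<in> insert e (h' ` D)"
        then consider "y = e" | "y = c" | x where "x \<in> D" "y = h' x" "y \<noteq> c" by blast
        then show "y \<in> h'' ` D"
        proof cases
          case 1
          then show ?thesis using A AD by (force simp: h''_def)
        next
          case 2
          obtain x where "x \<in> C" "x \<notin> A" using ne A by blast
          then show ?thesis using 2 by (force simp: h''_def C_def)
        next
          case 3
          then have "x \<notin> A" using A by (auto simp: C_def)
          then show ?thesis using 3 by (force simp: h''_def)
        qed
      qed
      then have "card (insert e (h' ` D)) \<le> card (h'' ` D)" using assms(1) by (intro card_mono) auto
      ultimately show False using e assms(1) by simp
    qed
    then show ?thesis using A by (simp add: C_def[symmetric])
  qed
  then show ?thesis using max[OF Ph] by blast
qed

section \<open>Dickson's lemma\<close>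

text \<open>Some subsequence is monotone; if it decreases, it is constant from its least value
  on.\<close>

lemma nat_mono_subseq:
  fixes f :: "nat \<Rightarrow> nat"
  shows "\<exists>\<phi> :: nat \<Rightarrow> nat. strict_mono \<phi> \<and> mono (\<lambda>n. f (\<phi> n))"
proof -
  obtain \<phi> where \<phi>: "strict_mono \<phi>" "monoseq (\<lambda>n. f (\<phi> n))"
    using seq_monosub[of f] by blast
  show ?thesis
  proof (cases "incseq (\<lambda>n. f (\<phi> n))")
    case True
    then show ?thesis using \<phi> by blast
  next
    case False
    then have dec: "decseq (\<lambda>n. f (\<phi> n))" using \<phi> by (auto simp: monoseq_iff)
    obtain k where k: "\<And>n. f (\<phi> k) \<le> f (\<phi> n)"
      using ex_has_least_nat[of "\<lambda>_. True" 0 "\<lambda>n. f (\<phi> n)"] by auto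
    have "f (\<phi> (k + n)) = f (\<phi> k)" for n
      using decseqD[OF dec, of k "k + n"] k[of "k + n"] by simp
    then have "mono (\<lambda>n. f (\<phi> (k + n)))" by (simp add: mono_def)
    moreover have "strict_mono (\<lambda>n. \<phi> (k + n))" using \<phi>(1) by (simp add: strict_mono_def)
    ultimately show ?thesis by (intro exI[of _ "\<lambda>n. \<phi> (k + n)"]) auto
  qed
qed

lemma dickson_sequence:
  fixes f :: "nat \<Rightarrow> 'q \<Rightarrow> nat"
  assumes "finite Q"
  shows "\<exists>\<phi> :: nat \<Rightarrow> nat. strict_mono \<phi> \<and> (\<forall>q\<in>Q. mono (\<lambda>n. f (\<phi> n) q))"
  using assms
proof (induction Q)
  case empty
  then show ?case using strict_mono_id by auto
next
  case (insert q Q)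
  then obtain \<phi> :: "nat \<Rightarrow> nat" where \<phi>: "strict_mono \<phi>" "\<And>p. p \<in> Q \<Longrightarrow> mono (\<lambda>n. f (\<phi> n) p)"
    by metis
  obtain \<psi> :: "nat \<Rightarrow> nat" where \<psi>: "strict_mono \<psi>" "mono (\<lambda>n. f (\<phi> (\<psi> n)) q)"
    using nat_mono_subseq[of "\<lambda>n. f (\<phi> n) q"] by metis
  have "mono (\<lambda>n. f (\<phi> (\<psi> n)) p)" if "p \<in> Q" for p
    using \<phi>(2)[OF that] strict_mono_mono[OF \<psi>(1)] by (auto simp: mono_def)
  then show ?case using \<phi>(1) \<psi> by (intro exI[of _ "\<phi> \<circ> \<psi>"]) (auto simp: strict_mono_def)
qed

text \<open>Multisets supported in \<open>Q\<close> are vectors of multiplicities. Along a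
  subsequence all coordinates are monotone, which makes two members comparable; injectivity of the
  enumeration makes the comparison strict.\<close>

lemma dickson_multiset:
  assumes "finite Q" "infinite M" "\<And>v. v \<in> M \<Longrightarrow> set_mset v \<subseteq> Q"
  shows "\<exists>u\<in>M. \<exists>v\<in>M. u \<subset># v"
proof -
  obtain f :: "nat \<Rightarrow> 'a multiset" where f: "inj f" "range f \<subseteq> M"
    using assms(2) infinite_countable_subset by blast
  obtain \<phi> :: "nat \<Rightarrow> nat" where \<phi>: "strict_mono \<phi>" "\<And>q. q \<in> Q \<Longrightarrow> mono (\<lambda>n. count (f (\<phi> n)) q)"
    using dickson_sequence[OF assms(1), of "\<lambda>n. count (f n)"] by metis
  have "count (f (\<phi> 0)) q \<le> count (f (\<phi> 1)) q" for q
  proof (cases "q \<in> Q")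
    case True
    then show ?thesis using \<phi>(2)[OF True] by (auto simp: mono_def)
  next
    case False
    then have "q \<notin># f (\<phi> 0)" using assms(3) f by blast
    then show ?thesis by (simp add: not_in_iff)
  qed
  then have "f (\<phi> 0) \<subseteq># f (\<phi> 1)" by (simp add: mset_subset_eqI)
  moreover have "\<phi> 0 \<noteq> \<phi> 1" using \<phi>(1) by (simp add: strict_mono_eq)
  then have "f (\<phi> 0) \<noteq> f (\<phi> 1)" using f(1) by (auto dest: injD)
  ultimately have "f (\<phi> 0) \<subset># f (\<phi> 1)" by (simp add: subset_mset.less_le)
  then show ?thesis using f(2) by blast
qed

text \<open>A linear functional that is positive on all nonzero elements of such a submonoid of
  \<open>\<nat>\<^sup>Q\<close> is bounded below by a multiple of the weight, since the submonoid is generated by its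
  finitely many irreducible elements.\<close>

lemma uniform_positivity:
  fixes e w :: "'q \<Rightarrow> real" and Sys :: "'q multiset \<Rightarrow> bool"
  assumes "finite Q"
    and Q: "\<And>v. Sys v \<Longrightarrow> set_mset v \<subseteq> Q"
    and diff: "\<And>u v. Sys u \<Longrightarrow> Sys v \<Longrightarrow> u \<subseteq># v \<Longrightarrow> Sys (v - u)"
    and w: "\<And>v q. Sys v \<Longrightarrow> q \<in># v \<Longrightarrow> w q > 0"
    and pos: "\<And>v. Sys v \<Longrightarrow> v \<noteq> {#} \<Longrightarrow> (\<Sum>q\<in>#v. e q) > 0"
  shows "\<exists>\<delta>>0. \<forall>v. Sys v \<longrightarrow> \<delta> * (\<Sum>q\<in>#v. w q) \<le> (\<Sum>q\<in>#v. e q)"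
proof -
  \<comment> \<open>The irreducible elements. They form an antichain, so Dickson's lemma makes
    \<open>M\<close> finite.\<close>
  define M where "M = {v. Sys v \<and> v \<noteq> {#} \<and> (\<forall>u. Sys u \<and> u \<subset># v \<longrightarrow> u = {#})}"
  have "finite M"
  proof (rule ccontr)
    assume "infinite M"
    from dickson_multiset[OF assms(1) this] obtain u v where "u \<in> M" "v \<in> M" "u \<subset># v"
      using Q by (auto simp: M_def)
    then show False by (auto simp: M_def)
  qed
  have wpos: "(\<Sum>q\<in>#v. w q) > 0" if "Sys v" "v \<noteq> {#}" for v
  proof -
    have "v \<noteq> {#} \<Longrightarrow> (\<forall>q\<in>#v. w q > 0) \<Longrightarrow> (\<Sum>q\<in>#v. w q) > 0"
    proof (induction v)
      case (add q v)
      then show ?case by (cases "v = {#}") (auto simp: add_pos_pos)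
    qed simp
    then show ?thesis using w that by blast
  qed
  \<comment> \<open>The additional element 1 keeps the minimum meaningful and positive if
    \<open>M\<close> is empty.\<close>
  define \<delta> where "\<delta> = Min (insert 1 ((\<lambda>v. (\<Sum>q\<in>#v. e q) / (\<Sum>q\<in>#v. w q)) ` M))"
  have "\<delta> > 0" unfolding \<delta>_def
    using \<open>finite M\<close> pos wpos by (subst Min_gr_iff) (auto simp: M_def)
  have irr: "\<delta> * (\<Sum>q\<in>#v. w q) \<le> (\<Sum>q\<in>#v. e q)" if "v \<in> M" for v
  proof -
    have "\<delta> \<le> (\<Sum>q\<in>#v. e q) / (\<Sum>q\<in>#v. w q)"
      unfolding \<delta>_def using \<open>finite M\<close> that by (intro Min_le) auto
    moreover have "(\<Sum>q\<in>#v. w q) > 0" using wpos that by (simp add: M_def)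
    ultimately show ?thesis by (simp add: field_simps)
  qed
  have "Sys v \<Longrightarrow> \<delta> * (\<Sum>q\<in>#v. w q) \<le> (\<Sum>q\<in>#v. e q)" for v
  proof (induction "size v" arbitrary: v rule: less_induct)
    case less
    show ?case
    proof (cases "v = {#} \<or> v \<in> M")
      case True
      then show ?thesis using irr by auto
    next
      case False
      then obtain u where u: "Sys u" "u \<subset># v" "u \<noteq> {#}" using less.prems by (auto simp: M_def)
      then have sub: "u \<subseteq># v" by (simp add: subset_mset.less_imp_le)
      have "size u < size v" using u(2) by (rule mset_subset_size)
      moreover have "size (v - u) < size v"
        using u(3) sub by (simp add: size_Diff_submset) (metis \<open>size u < size v\<close> diff_less nonempty_has_size order.strict_trans)
      ultimately have "\<delta> * (\<Sum>q\<in>#u. w q) \<le> (\<Sum>q\<in>#u. e q)"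
          "\<delta> * (\<Sum>q\<in>#v - u. w q) \<le> (\<Sum>q\<in>#v - u. e q)"
        using less.hyps u(1) diff[OF u(1) less.prems sub] by blast+
      moreover have v: "v = u + (v - u)" using sub by simp
      have "(\<Sum>q\<in>#v. w q) = (\<Sum>q\<in>#u. w q) + (\<Sum>q\<in>#v - u. w q)"
          "(\<Sum>q\<in>#v. e q) = (\<Sum>q\<in>#u. e q) + (\<Sum>q\<in>#v - u. e q)"
        by (subst v, simp)+
      ultimately show ?thesis by (simp add: distrib_left)
    qed
  qed
  then show ?thesis using \<open>\<delta> > 0\<close> by blast
qed

section \<open>Ribbon structures\<close>

text \<open>
  A ribbon graph each of whose boundary circles reads a power of \<open>r\<close>: \<open>D\<close> is the set of sides of
  edges, i.e. of letters along the boundary, \<open>\<sigma>\<close> the successor along the boundary, \<open>\<pi> x\<close> the side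
  opposite to \<open>x\<close>, \<open>p x\<close> the position of the letter \<open>x\<close> in \<open>r\<close>, and \<open>h x\<close> its initial vertex.
\<close>

definition ribbon ::
    "'a word \<Rightarrow> 'd set \<Rightarrow> ('d \<Rightarrow> 'd) \<Rightarrow> ('d \<Rightarrow> 'd) \<Rightarrow> ('d \<Rightarrow> nat) \<Rightarrow> ('d \<Rightarrow> nat) \<Rightarrow> bool" where
  "ribbon r D \<sigma> \<pi> p h \<longleftrightarrow> finite D \<and> bij_betw \<sigma> D D \<and>
     (\<forall>x\<in>D. \<pi> x \<in> D \<and> \<pi> (\<pi> x) = x \<and> p x < length r \<and> r ! p (\<pi> x) = flip (r ! p x) \<and>
        p (\<sigma> x) = Suc (p x) mod length r \<and> h (\<sigma> x) = h (\<pi> x))"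

text \<open>
  A vertex of a ribbon graph is recorded as the set of the pairs \<open>(p x, p (\<pi> x))\<close> for the edges \<open>x\<close>
  leaving it. The boundary arrives at the vertex along \<open>\<pi> x\<close> and leaves it at the next position of
  \<open>r\<close>, which gives the cyclic order of the edges.
\<close>

definition next_corner :: "'a word \<Rightarrow> nat \<times> nat \<Rightarrow> nat" where
  "next_corner r e = Suc (snd e) mod length r"

text \<open>The pairs are arcs from \<open>fst e\<close> to \<open>next_corner r e\<close>, and they
  form a permutation of the positions involved. As no position repeats, there are only finitely many
  polygons. The permutation may have several cycles; they count as one vertex, which only
  underestimates the Euler characteristic.\<close>

definition polygon :: "'a word \<Rightarrow> (nat \<times> nat) set \<Rightarrow> bool" where
  "polygon r q \<longleftrightarrow> q \<noteq> {} \<and> q \<subseteq> {..<length r} \<times> {..<length r} \<and>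
     (\<forall>e\<in>q. r ! snd e = flip (r ! fst e)) \<and>
     inj_on fst q \<and> inj_on (next_corner r) q \<and> fst ` q = next_corner r ` q"

text \<open>An edge appears at its two ends with the opposite pairs \<open>(a, b)\<close> and
  \<open>(b, a)\<close>. Equality of their numbers suffices for gluing, and it is a homogeneous
  linear condition, hence stable under differences.\<close>

definition gluing :: "'a word \<Rightarrow> (nat \<times> nat) set multiset \<Rightarrow> bool" where
  "gluing r v \<longleftrightarrow> (\<forall>q\<in>#v. polygon r q) \<and>
     (\<forall>a b. size {#q \<in># v. (a, b) \<in> q#} = size {#q \<in># v. (b, a) \<in> q#})"

text \<open>The rotation \<open>\<sigma> \<circ> \<pi>\<close> about a vertex takes an edge to one
  that starts at its next corner, so every vertex is balanced. Splitting the vertices into simple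
  ones yields polygons and does not decrease their number.\<close>

lemma gluing_of_ribbon:
  assumes "ribbon r D \<sigma> \<pi> p h"
  shows "\<exists>v. gluing r v \<and> (\<Sum>q\<in>#v. card q) = card D \<and> card (h ` D) \<le> size v"
proof -
  have fin: "finite D" and \<sigma>: "bij_betw \<sigma> D D"
    and R: "\<And>x. x \<in> D \<Longrightarrow> \<pi> x \<in> D \<and> \<pi> (\<pi> x) = x \<and> p x < length r \<and> r ! p (\<pi> x) = flip (r ! p x) \<and>
        p (\<sigma> x) = Suc (p x) mod length r \<and> h (\<sigma> x) = h (\<pi> x)"
    using assms by (auto simp: ribbon_def)
  have \<pi>: "bij_betw \<pi> D D"
    by (rule bij_betw_byWitness[of _ \<pi>]) (use R in auto)
  define ty where "ty x = (p x, p (\<pi> x))" for x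
  define tgt where "tgt x = next_corner r (ty x)" for x
  define \<tau> where "\<tau> = \<sigma> \<circ> \<pi>"
  have \<tau>: "bij_betw \<tau> D D" using bij_betw_trans[OF \<pi> \<sigma>] by (simp add: \<tau>_def)
  have R\<tau>: "h (\<tau> x) = h x" "p (\<tau> x) = tgt x" if "x \<in> D" for x
    using R[OF that] R[of "\<pi> x"] by (auto simp: \<tau>_def tgt_def ty_def next_corner_def)
  have "balanced p tgt {x \<in> D. h x = c}" for c
    unfolding balanced_def
  proof
    fix a
    have "bij_betw \<tau> {x \<in> {x \<in> D. h x = c}. tgt x = a} {x \<in> {x \<in> D. h x = c}. p x = a}"
    proof (rule bij_betw_imageI)
      show "inj_on \<tau> {x \<in> {x \<in> D. h x = c}. tgt x = a}"
        using \<tau> by (auto simp: bij_betw_def inj_on_def)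
      show "\<tau> ` {x \<in> {x \<in> D. h x = c}. tgt x = a} = {x \<in> {x \<in> D. h x = c}. p x = a}"
      proof (intro equalityI subsetI)
        fix y assume "y \<in> \<tau> ` {x \<in> {x \<in> D. h x = c}. tgt x = a}"
        then show "y \<in> {x \<in> {x \<in> D. h x = c}. p x = a}"
          using R\<tau> \<tau> by (auto simp: bij_betw_def)
      next
        fix y assume y: "y \<in> {x \<in> {x \<in> D. h x = c}. p x = a}"
        then obtain x where "x \<in> D" "y = \<tau> x" using \<tau> by (auto simp: bij_betw_def)
        then show "y \<in> \<tau> ` {x \<in> {x \<in> D. h x = c}. tgt x = a}" using y R\<tau> by auto
      qed
    qed
    then show "card {x \<in> {x \<in> D. h x = c}. p x = a} = card {x \<in> {x \<in> D. h x = c}. tgt x = a}"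
      by (rule sym[OF bij_betw_same_card])
  qed
  from refine_colouring[OF fin this] obtain h' :: "'b \<Rightarrow> nat" where
    h': "card (h ` D) \<le> card (h' ` D) \<and>
      (\<forall>c. let C = {x \<in> D. h' x = c} in inj_on p C \<and> inj_on tgt C \<and> p ` C = tgt ` C)"
    by (rule exE)
  define C where "C c = {x \<in> D. h' x = c}" for c
  have C: "inj_on p (C c)" "inj_on tgt (C c)" "p ` C c = tgt ` C c" for c
    using h' unfolding C_def Let_def by blast+
  have tyC: "inj_on ty (C c)" for c
    using C(1)[of c] by (auto simp: inj_on_def ty_def)
  define v where "v = image_mset (\<lambda>c. ty ` C c) (mset_set (h' ` D))"
  have poly: "polygon r (ty ` C c)" if "c \<in> h' ` D" for c
  proof -
    have fst: "fst (ty x) = p x" for x by (simp add: ty_def)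
    have nc: "next_corner r (ty x) = tgt x" for x by (simp add: tgt_def)
    have "inj_on fst (ty ` C c)" using C(1)[of c] by (auto simp: inj_on_def fst)
    moreover have "inj_on (next_corner r) (ty ` C c)" using C(2)[of c] by (auto simp: inj_on_def nc)
    moreover have "fst ` ty ` C c = next_corner r ` ty ` C c"
      using C(3)[of c] by (simp add: image_image fst nc)
    moreover have "ty ` C c \<noteq> {}" using that by (auto simp: C_def)
    moreover have "ty ` C c \<subseteq> {..<length r} \<times> {..<length r}"
      using R by (auto simp: C_def ty_def)
    moreover have "\<forall>e\<in>ty ` C c. r ! snd e = flip (r ! fst e)"
      using R by (auto simp: C_def ty_def)
    ultimately show ?thesis unfolding polygon_def by blast
  qed
  \<comment> \<open>Within one colour class the type determines the side, so the polygons containing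
    \<open>e\<close> correspond to the sides of type \<open>e\<close>.\<close>
  have sz: "size {#q \<in># v. e \<in> q#} = card {x \<in> D. ty x = e}" for e
  proof -
    have "size {#q \<in># v. e \<in> q#} = card {c \<in> h' ` D. e \<in> ty ` C c}"
      using fin by (simp add: v_def filter_mset_image_mset)
    also have "{c \<in> h' ` D. e \<in> ty ` C c} = h' ` {x \<in> D. ty x = e}"
    proof (intro equalityI subsetI)
      fix c assume "c \<in> {c \<in> h' ` D. e \<in> ty ` C c}"
      then obtain x where "x \<in> C c" "ty x = e" by blast
      then have "c = h' x" "x \<in> {x \<in> D. ty x = e}" by (auto simp: C_def)
      then show "c \<in> h' ` {x \<in> D. ty x = e}" by (rule image_eqI)
    qed (auto simp: C_def)
    also have "card \<dots> = card {x \<in> D. ty x = e}"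
    proof (rule card_image)
      show "inj_on h' {x \<in> D. ty x = e}"
      proof (rule inj_onI)
        fix x y assume "x \<in> {x \<in> D. ty x = e}" "y \<in> {x \<in> D. ty x = e}" "h' x = h' y"
        then show "x = y" using tyC[of "h' x"] by (auto simp: inj_on_def C_def)
      qed
    qed
    finally show ?thesis .
  qed
  have "card {x \<in> D. ty x = (a, b)} = card {x \<in> D. ty x = (b, a)}" for a b
    by (rule bij_betw_same_card[of \<pi>], rule bij_betw_byWitness[of _ \<pi>])
      (use R in \<open>auto simp: ty_def\<close>)
  then have "gluing r v"
    unfolding gluing_def sz using poly fin by (auto simp: v_def)
  moreover have "(\<Sum>q\<in>#v. card q) = card D"
  proof -
    have "(\<Sum>q\<in>#v. card q) = (\<Sum>c\<in>h' ` D. card (ty ` C c))"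
      by (simp add: v_def image_mset.compositionality comp_def sum_unfold_sum_mset)
    also have "\<dots> = (\<Sum>c\<in>h' ` D. card (C c))" using tyC by (simp add: card_image)
    also have "\<dots> = card D"
      using sum.image_gen[OF fin, of "\<lambda>_. 1::nat" h'] by (simp add: C_def)
    finally show ?thesis .
  qed
  moreover have "size v = card (h' ` D)" by (simp add: v_def)
  ultimately show ?thesis using h' by (intro exI[of _ v]) auto
qed

text \<open>Equal numbers give a bijection from the elements of type \<open>(a, b)\<close> to those
  of type \<open>(b, a)\<close>. Since \<open>a \<noteq> b\<close>, it can be used for
  \<open>a < b\<close> and its inverse for \<open>a > b\<close>, so that the pairing is an
  involution.\<close>

lemma ex_pairing:
  fixes T :: "'d \<Rightarrow> nat \<times> nat"
  assumes ne: "\<And>x. x \<in> D \<Longrightarrow> fst (T x) \<noteq> snd (T x)" and fin: "finite D"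
    and card: "\<And>a b. card {x \<in> D. T x = (a, b)} = card {x \<in> D. T x = (b, a)}"
  shows "\<exists>\<pi>. \<forall>x\<in>D. \<pi> x \<in> D \<and> \<pi> (\<pi> x) = x \<and> T (\<pi> x) = prod.swap (T x)"
proof -
  have "\<exists>f. bij_betw f {x \<in> D. T x = e} {x \<in> D. T x = prod.swap e}" for e
    using finite_same_card_bij[of "{x \<in> D. T x = e}" "{x \<in> D. T x = prod.swap e}"] fin
      card[of "fst e" "snd e"] by (simp add: prod.swap_def)
  then obtain f where f: "\<And>e. bij_betw (f e) {x \<in> D. T x = e} {x \<in> D. T x = prod.swap e}"
    by metis
  define F where "F e = {x \<in> D. T x = e}" for e
  have f: "bij_betw (f e) (F e) (F (prod.swap e))" for e using f by (simp add: F_def)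
  define \<pi> where "\<pi> x = (if fst (T x) < snd (T x) then f (T x) x
      else inv_into (F (prod.swap (T x))) (f (prod.swap (T x))) x)" for x
  have "\<pi> x \<in> D \<and> \<pi> (\<pi> x) = x \<and> T (\<pi> x) = prod.swap (T x)" if x: "x \<in> D" for x
  proof (cases "fst (T x) < snd (T x)")
    case True
    have "x \<in> F (T x)" using x by (simp add: F_def)
    then have 1: "f (T x) x \<in> F (prod.swap (T x))" using f[of "T x"] by (auto simp: bij_betw_def)
    then have 2: "f (T x) x \<in> D" "T (f (T x) x) = prod.swap (T x)" by (auto simp: F_def)
    have "inv_into (F (T x)) (f (T x)) (f (T x) x) = x"
      using f[of "T x"] \<open>x \<in> F (T x)\<close> by (simp add: bij_betw_inv_into_left)
    then show ?thesis using True 2 by (simp add: \<pi>_def)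
  next
    case False
    then have lt: "snd (T x) < fst (T x)" using ne[OF x] by simp
    define e where "e = prod.swap (T x)"
    define y where "y = inv_into (F e) (f e) x"
    have "x \<in> F (prod.swap e)" using x by (simp add: F_def e_def)
    then have 1: "y \<in> F e" "f e y = x"
      using f[of e] unfolding y_def by (auto simp: bij_betw_def inv_into_into f_inv_into_f)
    have "\<pi> x = y" using False by (simp add: \<pi>_def y_def e_def)
    moreover have "y \<in> D" "T y = e" using 1 by (auto simp: F_def)
    moreover have "\<pi> y = x" using lt 1 \<open>T y = e\<close> by (simp add: \<pi>_def e_def)
    ultimately show ?thesis by (simp add: e_def)
  qed
  then show ?thesis by blast
qed

text \<open>The polygons are made disjoint by their position in a list, and \<open>\<tau>\<close>
  rotates about each of them. The boundary successor is then \<open>\<tau> \<circ> \<pi>\<close>: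
  cross the edge and turn to the next corner.\<close>

lemma ribbon_of_gluing:
  assumes "gluing r v"
  shows "\<exists>(D :: (nat \<times> nat \<times> nat) set) \<sigma> \<pi> p h. ribbon r D \<sigma> \<pi> p h \<and>
     card D = (\<Sum>q\<in>#v. card q) \<and> card (h ` D) = size v"
proof -
  obtain vs where vs: "mset vs = v" using ex_mset by blast
  have poly: "polygon r (vs ! i)" if "i < length vs" for i
    using assms that vs by (auto simp: gluing_def)
  define D where "D = (SIGMA i:{..<length vs}. vs ! i)"
  have finq: "finite (vs ! i)" if "i < length vs" for i
    using poly[OF that] by (auto simp: polygon_def intro: finite_subset)
  then have fin: "finite D" by (auto simp: D_def)
  have cardD: "card D = (\<Sum>q\<in>#v. card q)"
  proof -
    have "card D = (\<Sum>i<length vs. card (vs ! i))" using finq by (simp add: D_def)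
    also have "\<dots> = sum_list (map card vs)" by (simp add: sum_list_sum_nth atLeast0LessThan)
    also have "\<dots> = (\<Sum>q\<in>#v. card q)" unfolding vs[symmetric] by (simp flip: mset_map add: sum_mset_sum_list)
    finally show ?thesis .
  qed
  have T: "\<exists>\<pi>. \<forall>x\<in>D. \<pi> x \<in> D \<and> \<pi> (\<pi> x) = x \<and> snd (\<pi> x) = prod.swap (snd x)"
  proof (rule ex_pairing[OF _ fin])
    fix x assume "x \<in> D"
    then have "r ! snd (snd x) = flip (r ! fst (snd x))"
      using poly by (fastforce simp: D_def polygon_def)
    then show "fst (snd x) \<noteq> snd (snd x)" by auto
  next
    fix a b
    have *: "card {x \<in> D. snd x = e} = size {#q \<in># v. e \<in> q#}" for e
    proof -
      have "card {x \<in> D. snd x = e} = card {i. i < length vs \<and> e \<in> vs ! i}"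
        by (rule bij_betw_same_card[of fst], rule bij_betw_byWitness[of _ "\<lambda>i. (i, e)"])
          (auto simp: D_def)
      also have "\<dots> = length (filter (\<lambda>q. e \<in> q) vs)" by (simp add: length_filter_conv_card)
      also have "\<dots> = size {#q \<in># v. e \<in> q#}" unfolding vs[symmetric] by (simp flip: mset_filter)
      finally show ?thesis .
    qed
    show "card {x \<in> D. snd x = (a, b)} = card {x \<in> D. snd x = (b, a)}"
      using assms unfolding * gluing_def by blast
  qed
  then obtain \<pi> where \<pi>: "\<And>x. x \<in> D \<Longrightarrow> \<pi> x \<in> D \<and> \<pi> (\<pi> x) = x \<and> snd (\<pi> x) = prod.swap (snd x)"
    by metis
  define \<tau> where "\<tau> x = (fst x, SOME e. e \<in> vs ! fst x \<and> fst e = next_corner r (snd x))" for x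
  have \<tau>: "\<tau> x \<in> D \<and> fst (\<tau> x) = fst x \<and> fst (snd (\<tau> x)) = next_corner r (snd x)" if "x \<in> D" for x
  proof -
    have i: "fst x < length vs" "snd x \<in> vs ! fst x" using that by (auto simp: D_def)
    then have "next_corner r (snd x) \<in> fst ` (vs ! fst x)"
      using poly[OF i(1)] by (auto simp: polygon_def)
    then have "\<exists>e. e \<in> vs ! fst x \<and> fst e = next_corner r (snd x)" by auto
    from someI_ex[OF this] show ?thesis using i unfolding \<tau>_def D_def by auto
  qed
  have "inj_on \<tau> D"
  proof (rule inj_onI)
    fix x y assume x: "x \<in> D" and y: "y \<in> D" and eq: "\<tau> x = \<tau> y"
    have f: "fst x = fst y" "next_corner r (snd x) = next_corner r (snd y)"
      using \<tau>[OF x] \<tau>[OF y] eq by auto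
    have "fst x < length vs" "snd x \<in> vs ! fst x" "snd y \<in> vs ! fst x" using x y f by (auto simp: D_def)
    then have "snd x = snd y" using poly[of "fst x"] f by (auto simp: polygon_def inj_on_def)
    then show "x = y" using f by (simp add: prod_eq_iff)
  qed
  moreover have "\<tau> ` D \<subseteq> D" using \<tau> by auto
  ultimately have \<tau>bij: "bij_betw \<tau> D D" using fin by (simp add: bij_betw_def endo_inj_surj)
  have \<pi>bij: "bij_betw \<pi> D D" by (rule bij_betw_byWitness[of _ \<pi>]) (use \<pi> in auto)
  define \<sigma> where "\<sigma> = \<tau> \<circ> \<pi>"
  have "bij_betw \<sigma> D D" using bij_betw_trans[OF \<pi>bij \<tau>bij] by (simp add: \<sigma>_def)
  moreover have "r ! fst (snd (\<pi> x)) = flip (r ! fst (snd x))" "fst (snd x) < length r"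
    if "x \<in> D" for x
    using that \<pi>[OF that] poly by (auto simp: D_def polygon_def) fastforce+
  moreover have "fst (snd (\<sigma> x)) = Suc (fst (snd x)) mod length r" "fst (\<sigma> x) = fst (\<pi> x)"
    if "x \<in> D" for x
    using \<pi>[OF that] \<tau>[of "\<pi> x"] by (auto simp: \<sigma>_def next_corner_def)
  ultimately have "ribbon r D \<sigma> \<pi> (\<lambda>x. fst (snd x)) fst"
    unfolding ribbon_def using fin \<pi> by blast
  moreover have "fst ` D = {..<length vs}"
  proof (intro equalityI subsetI)
    fix i assume "i \<in> {..<length vs}"
    moreover from this obtain e where "e \<in> vs ! i" using poly[of i] by (auto simp: polygon_def)
    ultimately have "(i, e) \<in> D" by (simp add: D_def)
    then show "i \<in> fst ` D" by force
  qed (auto simp: D_def)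
  then have "card (fst ` D) = size v" by (simp flip: vs)
  ultimately show ?thesis using cardD
    by (intro exI[of _ D] exI[of _ \<sigma>] exI[of _ \<pi>] exI[of _ "\<lambda>x. fst (snd x)"] exI[of _ fst]) simp
qed

section \<open>Merging the faces of a ribbon structure\<close>

lemma ribbonD:
  assumes "ribbon r D \<sigma> \<pi> p h"
  shows "finite D" "bij_betw \<sigma> D D"
    and "\<And>x. x \<in> D \<Longrightarrow> \<pi> x \<in> D" "\<And>x. x \<in> D \<Longrightarrow> \<pi> (\<pi> x) = x" "\<And>x. x \<in> D \<Longrightarrow> p x < length r"
      "\<And>x. x \<in> D \<Longrightarrow> r ! p (\<pi> x) = flip (r ! p x)"
      "\<And>x. x \<in> D \<Longrightarrow> p (\<sigma> x) = Suc (p x) mod length r"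
      "\<And>x. x \<in> D \<Longrightarrow> h (\<sigma> x) = h (\<pi> x)" "\<And>x. x \<in> D \<Longrightarrow> \<sigma> x \<in> D"
  using assms by (auto simp: ribbon_def bij_betw_def)

lemma ribbon_subset:
  assumes "ribbon r D \<sigma> \<pi> p h" "M \<subseteq> D" "\<And>x. x \<in> M \<Longrightarrow> \<sigma> x \<in> M \<and> \<pi> x \<in> M"
  shows "ribbon r M \<sigma> \<pi> p h"
proof -
  have fin: "finite M" using ribbonD(1)[OF assms(1)] assms(2) finite_subset by blast
  have "inj_on \<sigma> M" using ribbonD(2)[OF assms(1)] assms(2) by (auto simp: bij_betw_def inj_on_subset)
  moreover have "\<sigma> ` M \<subseteq> M" using assms(3) by blast
  ultimately have "bij_betw \<sigma> M M" using fin by (simp add: bij_betw_def endo_inj_surj)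
  then show ?thesis
    using fin assms(2,3) ribbonD[OF assms(1)] unfolding ribbon_def by (meson subsetD)
qed

text \<open>On a finite set an injective map that preserves \<open>M\<close> permutes
  \<open>M\<close>, so nothing enters it from outside.\<close>

lemma closed_Diff:
  assumes "finite D" "bij_betw f D D" "M \<subseteq> D" "f ` M \<subseteq> M" "x \<in> D - M"
  shows "f x \<in> D - M"
proof -
  have "inj_on f M" using assms(2,3) by (auto simp: bij_betw_def inj_on_subset)
  then have "f ` M = M" using assms by (simp add: endo_inj_surj finite_subset)
  moreover have "f x \<in> D" using assms(2,5) by (auto simp: bij_betw_def)
  moreover have "f x \<notin> f ` M"
    using assms(2,3,5) by (auto simp: bij_betw_def inj_on_def)
  ultimately show ?thesis by simp
qed

lemma ribbon_Diff:
  assumes R: "ribbon r D \<sigma> \<pi> p h" and M: "M \<subseteq> D" "\<And>x. x \<in> M \<Longrightarrow> \<sigma> x \<in> M \<and> \<pi> x \<in> M"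
  shows "ribbon r (D - M) \<sigma> \<pi> p h"
proof (rule ribbon_subset[OF R])
  fix x assume x: "x \<in> D - M"
  have "\<pi> x \<notin> M" using M(2)[of "\<pi> x"] ribbonD(4)[OF R, of x] x by auto
  moreover have "\<sigma> x \<in> D - M"
    using closed_Diff[OF ribbonD(1,2)[OF R] M(1) _ x] M(2) by blast
  ultimately show "\<sigma> x \<in> D - M \<and> \<pi> x \<in> D - M" using ribbonD(3)[OF R] x by blast
qed auto

section \<open>Boundary circles and the words along them\<close>

lemma funpow_period:
  assumes "finite D" "bij_betw f D D" "y \<in> D"
  shows "\<exists>k\<ge>1. (f ^^ k) y = y \<and> inj_on (\<lambda>i. (f ^^ i) y) {..<k}"
proof -
  have mem: "(f ^^ i) y \<in> D" for i
    using assms(2,3) by (induction i) (auto simp: bij_betw_def)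
  have cancel: "(f ^^ (j - i)) y = y" if "(f ^^ i) y = (f ^^ j) y" "i \<le> j" for i j
    using that
  proof (induction i arbitrary: j)
    case (Suc i)
    then obtain j' where j': "j = Suc j'" by (cases j) auto
    have "(f ^^ i) y = (f ^^ j') y"
      using Suc.prems assms(2) mem unfolding j' by (auto simp: bij_betw_def inj_on_def)
    then show ?case using Suc j' by simp
  qed simp
  have "\<not> inj (\<lambda>i. (f ^^ i) y)"
    using mem assms(1) by (metis (no_types, lifting) finite_imageD finite_subset image_subsetI infinite_UNIV_nat)
  then obtain i j where "i < j" "(f ^^ i) y = (f ^^ j) y"
    unfolding inj_def by (metis linorder_neqE_nat)
  then have ex: "\<exists>k. k \<ge> 1 \<and> (f ^^ k) y = y"
    using cancel[of i j] by (intro exI[of _ "j - i"]) auto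
  define k where "k = (LEAST k. k \<ge> 1 \<and> (f ^^ k) y = y)"
  have k: "k \<ge> 1" "(f ^^ k) y = y" using LeastI_ex[OF ex] by (auto simp: k_def)
  have "inj_on (\<lambda>i. (f ^^ i) y) {..<k}"
  proof (rule ccontr)
    assume "\<not> ?thesis"
    then obtain i j where "i < j" "j < k" "(f ^^ i) y = (f ^^ j) y"
      unfolding inj_on_def by (metis lessThan_iff linorder_neqE_nat)
    then have "(f ^^ (j - i)) y = y" "j - i \<ge> 1" "j - i < k" using cancel[of i j] by auto
    then show False unfolding k_def using not_less_Least by blast
  qed
  then show ?thesis using k by blast
qed

context
  fixes S :: "'a set" and r :: "'a word"
  assumes r: "r \<in> carrier (free_group S)" "r \<noteq> []"
begin

interpretation group "free_group S" by (rule group_free_group)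

abbreviation (input) letter_val :: "('d \<Rightarrow> nat) \<Rightarrow> 'd \<Rightarrow> 'a word" where
  "letter_val p x \<equiv> reduce [r ! p x]"

lemma letter_val_closed: "i < length r \<Longrightarrow> reduce [r ! i] \<in> carrier (free_group S)"
  by (rule reduce_in_carrier) (use r in \<open>auto simp: carrier_free_group\<close>)

lemma prefix_closed: "reduce (take i r) \<in> carrier (free_group S)"
  by (rule reduce_in_carrier) (use r in \<open>auto simp: carrier_free_group dest: in_set_takeD\<close>)

text \<open>Reading a letter lengthens the prefix; at the end of \<open>r\<close> the prefix becomes
  empty and a full copy of \<open>r\<close> is split off. The exponent
  \<open>Suc i div length r\<close> is 1 in that case and 0 otherwise.\<close>

lemma prefix_step:
  assumes "i < length r"
  shows "reduce (take i r) \<otimes>\<^bsub>free_group S\<^esub> reduce [r ! i] =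
         r [^]\<^bsub>free_group S\<^esub> (Suc i div length r) \<otimes>\<^bsub>free_group S\<^esub> reduce (take (Suc i mod length r) r)"
proof -
  have *: "reduce (take i r) \<otimes>\<^bsub>free_group S\<^esub> reduce [r ! i] = reduce (take (Suc i) r)"
    using assms by (simp add: take_Suc_conv_app_nth reduce_append[of _ _ S])
  show ?thesis
  proof (cases "Suc i = length r")
    case True
    then have "reduce (take (Suc i) r) = r" using r reduce_reduced by (auto simp: carrier_free_group)
    then show ?thesis using * r True nat_pow_eone[OF r(1)] r_one[OF r(1)] by (simp add: one_free_group)
  next
    case False
    then show ?thesis using * assms prefix_closed by simp
  qed
qed

lemma list_prod_face:
  assumes "\<And>i. i < k \<Longrightarrow> p (xs i) = (j + i) mod length r" "j < length r"
  shows "list_prod (letter_val p) (map xs [0..<k]) =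
     inv\<^bsub>free_group S\<^esub> (reduce (take j r)) \<otimes>\<^bsub>free_group S\<^esub>
     r [^]\<^bsub>free_group S\<^esub> ((j + k) div length r) \<otimes>\<^bsub>free_group S\<^esub> reduce (take ((j + k) mod length r) r)"
  using assms(1)
proof (induction k)
  case 0
  then show ?case
    using assms(2) prefix_closed by simp
next
  case (Suc k)
  define i where "i = (j + k) mod length r"
  have i: "i < length r" using r by (simp add: i_def)
  have val: "letter_val p ` set (map xs [0..<k]) \<subseteq> carrier (free_group S)"
  proof -
    have "p (xs l) < length r" if "l < k" for l using Suc.prems[of l] that r by simp
    then show ?thesis using letter_val_closed by auto
  qed
  have pk: "p (xs k) = i" using Suc.prems[of k] by (simp add: i_def)
  define P where "P = inv\<^bsub>free_group S\<^esub> (reduce (take j r))"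
  define R where "R = r [^]\<^bsub>free_group S\<^esub> ((j + k) div length r)"
  have c: "P \<in> carrier (free_group S)" "R \<in> carrier (free_group S)"
    using prefix_closed r by (auto simp: P_def R_def)
  have "list_prod (letter_val p) (map xs [0..<Suc k]) =
      list_prod (letter_val p) (map xs [0..<k]) \<otimes>\<^bsub>free_group S\<^esub> reduce [r ! i]"
    using val letter_val_closed[OF i] pk by (simp add: list_prod_append)
  also have "\<dots> = P \<otimes>\<^bsub>free_group S\<^esub> R \<otimes>\<^bsub>free_group S\<^esub> reduce (take i r) \<otimes>\<^bsub>free_group S\<^esub> reduce [r ! i]"
    using Suc by (simp add: P_def R_def i_def)
  also have "\<dots> = P \<otimes>\<^bsub>free_group S\<^esub> R \<otimes>\<^bsub>free_group S\<^esub> (r [^]\<^bsub>free_group S\<^esub> (Suc i div length r) \<otimes>\<^bsub>free_group S\<^esub> reduce (take (Suc i mod length r) r))"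
    using c prefix_closed letter_val_closed[OF i] r by (simp add: m_assoc prefix_step[OF i])
  also have "\<dots> = P \<otimes>\<^bsub>free_group S\<^esub> (R \<otimes>\<^bsub>free_group S\<^esub> r [^]\<^bsub>free_group S\<^esub> (Suc i div length r)) \<otimes>\<^bsub>free_group S\<^esub> reduce (take (Suc i mod length r) r)"
    using c prefix_closed r by (simp add: m_assoc)
  also have "R \<otimes>\<^bsub>free_group S\<^esub> r [^]\<^bsub>free_group S\<^esub> (Suc i div length r) =
      r [^]\<^bsub>free_group S\<^esub> ((j + k) div length r + Suc i div length r)"
    using r by (simp add: R_def nat_pow_mult)
  also have "(j + k) div length r + Suc i div length r = (j + Suc k) div length r"
  proof -
    have "j + Suc k = Suc i + (j + k) div length r * length r"
      by (simp add: i_def mod_div_mult_eq)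
    moreover have "\<dots> div length r = (j + k) div length r + Suc i div length r"
      by (rule div_mult_self1) (use r in simp)
    ultimately show ?thesis by simp
  qed
  also have "Suc i mod length r = (j + Suc k) mod length r"
    by (simp add: i_def mod_Suc_eq)
  finally show ?case by (simp add: P_def)
qed

text \<open>The list is the orbit of \<open>y\<close> under \<open>\<sigma>\<close>. Positions
  advance by one modulo \<open>length r\<close>, so its length is some \<open>n * length r\<close>,
  and the circle reads a conjugate of \<open>r^n\<close> by the inverse of a prefix. It starts at
  \<open>y\<close> so that \<open>y\<close> can later cancel against its opposite side.\<close>

lemma face_of_dart:
  assumes R: "ribbon r D \<sigma> \<pi> p h" and y: "y \<in> D"
  shows "\<exists>B n. distinct (y # B) \<and> set (y # B) \<subseteq> D \<and> (\<forall>x\<in>set (y # B). \<sigma> x \<in> set (y # B)) \<and>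
     (\<forall>M\<subseteq>D. \<sigma> ` M \<subseteq> M \<longrightarrow> y \<notin> M \<longrightarrow> set (y # B) \<inter> M = {}) \<and>
     walk \<pi> h (h y) (y # B) (h y) \<and> length (y # B) = n * length r \<and>
     conj_prod (free_group S) r n (list_prod (letter_val p) (y # B))"
proof -
  obtain k where k: "k \<ge> 1" "(\<sigma> ^^ k) y = y" and inj: "inj_on (\<lambda>i. (\<sigma> ^^ i) y) {..<k}"
    using funpow_period[OF ribbonD(1,2)[OF R] y] by blast
  define xs where "xs = (\<lambda>i. (\<sigma> ^^ i) y)"
  have xs0: "xs 0 = y" and xsS: "xs (Suc i) = \<sigma> (xs i)" and xsk: "xs k = y" for i
    using k by (simp_all add: xs_def)
  have xsD: "xs i \<in> D" for i
    by (induction i) (use y ribbonD(9)[OF R] in \<open>auto simp: xs0 xsS\<close>)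
  define B where "B = map xs [1..<k]"
  have yB: "y # B = map xs [0..<k]"
    using k(1) by (simp add: B_def upt_conv_Cons xs0)
  have L: "length r > 0" using r by simp
  have pxs: "p (xs i) = (p y + i) mod length r" for i
  proof (induction i)
    case 0
    then show ?case using ribbonD(5)[OF R y] by (simp add: xs0)
  next
    case (Suc i)
    then show ?case using ribbonD(7)[OF R xsD[of i]] by (simp add: xsS mod_Suc_eq)
  qed
  have "walk \<pi> h (h y) (map xs [0..<l]) (h (xs l))" for l
  proof (induction l)
    case (Suc l)
    then show ?case using ribbonD(8)[OF R xsD[of l]] by (auto simp: walk_append xsS)
  qed (simp add: xs0)
  from this[of k] have wk: "walk \<pi> h (h y) (y # B) (h y)" by (simp add: yB xsk)
  have "(p y + k) mod length r = p y" using pxs[of k] by (simp add: xsk)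
  then have "(p y + k) mod length r = (p y + 0) mod length r" using ribbonD(5)[OF R y] by simp
  then have "length r dvd k" using mod_eq_dvd_iff_nat[of "p y + 0" "p y + k" "length r"] by simp
  then obtain n where n: "k = n * length r" by (metis dvd_def mult.commute)
  have "list_prod (letter_val p) (y # B) =
     inv\<^bsub>free_group S\<^esub> (reduce (take (p y) r)) \<otimes>\<^bsub>free_group S\<^esub>
     r [^]\<^bsub>free_group S\<^esub> ((p y + k) div length r) \<otimes>\<^bsub>free_group S\<^esub> reduce (take ((p y + k) mod length r) r)"
    unfolding yB by (rule list_prod_face) (use pxs ribbonD(5)[OF R y] in auto)
  also have "(p y + k) div length r = n" using ribbonD(5)[OF R y] L by (simp add: n)
  also have "(p y + k) mod length r = p y" by fact
  finally have lp: "list_prod (letter_val p) (y # B) =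
     inv\<^bsub>free_group S\<^esub> (reduce (take (p y) r)) \<otimes>\<^bsub>free_group S\<^esub>
     r [^]\<^bsub>free_group S\<^esub> n \<otimes>\<^bsub>free_group S\<^esub> reduce (take (p y) r)" .
  have "conj_prod (free_group S) r n (inv\<^bsub>free_group S\<^esub> (reduce (take (p y) r)) \<otimes>\<^bsub>free_group S\<^esub>
     r [^]\<^bsub>free_group S\<^esub> n \<otimes>\<^bsub>free_group S\<^esub> inv\<^bsub>free_group S\<^esub> (inv\<^bsub>free_group S\<^esub> (reduce (take (p y) r))))"
    by (rule conj_prod_conj[OF r(1) _ conj_prod_pow[OF r(1)]]) (use prefix_closed in simp)
  then have cp: "conj_prod (free_group S) r n (list_prod (letter_val p) (y # B))"
    unfolding lp using prefix_closed by simp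
  have dist: "distinct (y # B)"
    using inj unfolding yB by (simp add: distinct_map xs_def atLeast0LessThan)
  have setB: "set (y # B) = xs ` {..<k}" unfolding yB by auto
  have closed: "\<sigma> x \<in> set (y # B)" if x: "x \<in> set (y # B)" for x
  proof -
    obtain i where i: "i < k" "x = xs i" using x unfolding setB by blast
    then have "\<sigma> x = xs (if Suc i = k then 0 else Suc i)" using xsS[of i] xsk xs0 by auto
    moreover have "(if Suc i = k then 0 else Suc i) < k" using i k by auto
    ultimately show ?thesis unfolding setB by blast
  qed
  have disj: "set (y # B) \<inter> M = {}" if M: "M \<subseteq> D" "\<sigma> ` M \<subseteq> M" "y \<notin> M" for M
  proof -
    have "xs i \<in> D - M" for i
      by (induction i) (use y M closed_Diff[OF ribbonD(1,2)[OF R] M(1,2)] in \<open>auto simp: xs0 xsS\<close>)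
    then show ?thesis unfolding setB by blast
  qed
  have "set (y # B) \<subseteq> D" using xsD unfolding setB by blast
  then show ?thesis
    using dist closed disj wk cp n yB by (intro exI[of _ B] exI[of _ n]) auto
qed

text \<open>
  \<open>M\<close> is a union of boundary circles, capped off by discs and glued along some of the edges between
  them into a single disc with boundary \<open>us\<close>.
\<close>

definition merged :: "'d set \<Rightarrow> ('d \<Rightarrow> 'd) \<Rightarrow> ('d \<Rightarrow> 'd) \<Rightarrow> ('d \<Rightarrow> nat) \<Rightarrow> ('d \<Rightarrow> nat) \<Rightarrow> 'd set \<Rightarrow> bool" where
  "merged D \<sigma> \<pi> p h M \<longleftrightarrow> M \<subseteq> D \<and> M \<noteq> {} \<and> \<sigma> ` M \<subseteq> M \<and>
     (\<exists>us a n. distinct us \<and> set us \<subseteq> M \<and> (\<forall>x\<in>M - set us. \<pi> x \<in> M - set us) \<and>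
        walk \<pi> h a us a \<and> h ` M \<subseteq> insert a (h ` set us) \<and> card M = n * length r \<and>
        conj_prod (free_group S) r n (list_prod (letter_val p) us))"

lemma merged_face:
  assumes R: "ribbon r D \<sigma> \<pi> p h" and y: "y \<in> D"
  shows "\<exists>M. merged D \<sigma> \<pi> p h M"
proof -
  obtain B n where B: "distinct (y # B)" "set (y # B) \<subseteq> D" "\<forall>x\<in>set (y # B). \<sigma> x \<in> set (y # B)"
     "walk \<pi> h (h y) (y # B) (h y)" "length (y # B) = n * length r"
     "conj_prod (free_group S) r n (list_prod (letter_val p) (y # B))"
    using face_of_dart[OF R y] by (elim exE conjE) (rule that; assumption)
  have "card (set (y # B)) = n * length r" using distinct_card[OF B(1)] B(5) by simp
  then have "merged D \<sigma> \<pi> p h (set (y # B))"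
    unfolding merged_def using B
    by (intro conjI exI[of _ "y # B"] exI[of _ "h y"] exI[of _ n]) auto
  then show ?thesis ..
qed

text \<open>The side \<open>y = \<pi> x\<close> lies on another circle \<open>y # B\<close>, whose
  disc is attached along the edge. In the boundary word \<open>x\<close> is replaced by
  \<open>B\<close>, because the letters of \<open>x\<close> and \<open>y\<close> cancel.\<close>

lemma merged_extend:
  assumes R: "ribbon r D \<sigma> \<pi> p h" and M: "merged D \<sigma> \<pi> p h M" and x: "x \<in> M" "\<pi> x \<notin> M"
  shows "\<exists>M'. M \<subset> M' \<and> merged D \<sigma> \<pi> p h M'"
proof -
  have MD: "M \<subseteq> D" and \<sigma>M: "\<sigma> ` M \<subseteq> M" using M by (auto simp: merged_def)
  obtain us a n where us: "distinct us" "set us \<subseteq> M" "\<And>z. z \<in> M - set us \<Longrightarrow> \<pi> z \<in> M - set us"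
      "walk \<pi> h a us a" "h ` M \<subseteq> insert a (h ` set us)" "card M = n * length r"
      "conj_prod (free_group S) r n (list_prod (letter_val p) us)"
    using M unfolding merged_def by (elim exE conjE) (rule that; blast)
  define y where "y = \<pi> x"
  have xD: "x \<in> D" using x MD by blast
  have yD: "y \<in> D" and \<pi>y: "\<pi> y = x" using ribbonD(3,4)[OF R xD] by (auto simp: y_def)
  have \<pi>x: "\<pi> x = y" by (simp add: y_def)
  have yM: "y \<notin> M" using x by (simp add: y_def)
  obtain B m where B: "distinct (y # B)" "set (y # B) \<subseteq> D" "\<And>z. z \<in> set (y # B) \<Longrightarrow> \<sigma> z \<in> set (y # B)"
     "\<And>M. M \<subseteq> D \<Longrightarrow> \<sigma> ` M \<subseteq> M \<Longrightarrow> y \<notin> M \<Longrightarrow> set (y # B) \<inter> M = {}"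
     "walk \<pi> h (h y) (y # B) (h y)" "length (y # B) = m * length r"
     "conj_prod (free_group S) r m (list_prod (letter_val p) (y # B))"
    using face_of_dart[OF R yD] by (elim exE conjE) (rule that; blast)
  have disj: "set (y # B) \<inter> M = {}" by (rule B(4)[OF MD \<sigma>M yM])
  \<comment> \<open>Sides of \<open>M\<close> off its boundary are glued within \<open>M\<close>, so
    \<open>x\<close> lies on the boundary.\<close>
  have "x \<in> set us" using us(3)[of x] x by blast
  then obtain A1 A2 where A: "us = A1 @ x # A2" by (meson split_list)
  define us' where "us' = A1 @ B @ A2"
  define M' where "M' = M \<union> set (y # B)"
  have setus: "set us = insert x (set A1 \<union> set A2)" using A by auto
  have nin: "x \<notin> set A1" "x \<notin> set A2" "y \<notin> set B" using us(1) B(1) A by auto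
  have rest: "M' - set us' = (M - set us) \<union> {x, y}"
    using disj us(2) nin x(1) by (auto simp: M'_def us'_def setus)
  have walks: "walk \<pi> h a A1 (h x)" "walk \<pi> h (h y) A2 a" "walk \<pi> h (h x) B (h y)"
    using us(4) B(5) by (auto simp: A walk_append \<pi>x \<pi>y)
  have wk: "walk \<pi> h a us' a" using walks by (auto simp: us'_def walk_append)
  have hy: "h y \<in> insert a (h ` set us')" using walk_start[OF walks(2)] by (auto simp: us'_def)
  then have hx: "h x \<in> insert a (h ` set us')" using walk_start[OF walks(3)] by (auto simp: us'_def)
  have cols: "h ` M' \<subseteq> insert a (h ` set us')"
  proof -
    have "insert a (h ` set us) \<subseteq> insert a (h ` set us')" using hx by (auto simp: setus us'_def)
    moreover have "h ` set (y # B) \<subseteq> insert a (h ` set us')" using hy by (auto simp: us'_def)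
    ultimately show ?thesis using us(5) unfolding M'_def image_Un by blast
  qed
  have fin: "finite M" using ribbonD(1)[OF R] MD finite_subset by blast
  have card: "card M' = (n + m) * length r"
  proof -
    have "card (set (y # B)) = m * length r" using distinct_card[OF B(1)] B(6) by simp
    then show ?thesis
      using card_Un_disjoint[OF fin finite_set, of "y # B"] disj us(6)
      unfolding M'_def by (simp only: Int_commute distrib_right)
  qed
  have val: "letter_val p ` set zs \<subseteq> carrier (free_group S)" if "set zs \<subseteq> D" for zs
    using that ribbonD(5)[OF R] letter_val_closed by blast
  have subs: "set A1 \<subseteq> D" "set A2 \<subseteq> D" "set B \<subseteq> D"
    using A us(2) MD B(2) by auto
  note v = val[OF subs(1)] val[OF subs(2)] val[OF subs(3)]
  have ex: "letter_val p x \<in> carrier (free_group S)" using letter_val_closed ribbonD(5)[OF R xD] .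
  have ey: "letter_val p y = inv\<^bsub>free_group S\<^esub> letter_val p x"
  proof -
    have "fst (r ! p x) \<in> S"
      using r(1) ribbonD(5)[OF R xD] nth_mem by (fastforce simp: carrier_free_group)
    then show ?thesis using ribbonD(6)[OF R xD] reduce_single_flip by (simp add: y_def)
  qed
  define P1 P2 PB where "P1 = list_prod (letter_val p) A1" and "P2 = list_prod (letter_val p) A2"
    and "PB = list_prod (letter_val p) B"
  have P: "P1 \<in> carrier (free_group S)" "P2 \<in> carrier (free_group S)" "PB \<in> carrier (free_group S)"
    unfolding P1_def P2_def PB_def using v by auto
  have "conj_prod (free_group S) r (n + m) ((P1 \<otimes>\<^bsub>free_group S\<^esub> letter_val p x)
     \<otimes>\<^bsub>free_group S\<^esub> list_prod (letter_val p) (y # B) \<otimes>\<^bsub>free_group S\<^esub> P2)"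
  proof (rule conj_prod_insert[OF r(1) _ P(2) _ B(7)])
    have "list_prod (letter_val p) us = P1 \<otimes>\<^bsub>free_group S\<^esub> letter_val p x \<otimes>\<^bsub>free_group S\<^esub> P2"
      unfolding A P1_def P2_def using v ex by (simp add: list_prod_append m_assoc)
    then show "conj_prod (free_group S) r n (P1 \<otimes>\<^bsub>free_group S\<^esub> letter_val p x \<otimes>\<^bsub>free_group S\<^esub> P2)"
      using us(7) by simp
  qed (use P ex in auto)
  also have "(P1 \<otimes>\<^bsub>free_group S\<^esub> letter_val p x)
     \<otimes>\<^bsub>free_group S\<^esub> list_prod (letter_val p) (y # B) \<otimes>\<^bsub>free_group S\<^esub> P2 = list_prod (letter_val p) us'"
    using P ex v unfolding us'_def
    by (simp add: ey list_prod_append image_Un m_assoc PB_def[symmetric] P1_def[symmetric] P2_def[symmetric])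
  finally have cp: "conj_prod (free_group S) r (n + m) (list_prod (letter_val p) us')" .
  have "distinct us'" using us(1,2) B(1) disj by (auto simp: A us'_def)
  moreover have "set us' \<subseteq> M'" using us(2) by (auto simp: M'_def us'_def setus)
  moreover have "\<forall>z\<in>M' - set us'. \<pi> z \<in> M' - set us'"
    unfolding rest using us(3) \<pi>x \<pi>y by auto
  moreover have "M' \<subseteq> D" "\<sigma> ` M' \<subseteq> M'" using MD B(2,3) \<sigma>M by (auto simp: M'_def)
  ultimately have "merged D \<sigma> \<pi> p h M'"
    unfolding merged_def using wk cols card cp x(1)
    by (intro conjI exI[of _ us'] exI[of _ a] exI[of _ "n + m"]) (auto simp: M'_def)
  moreover have "M \<subset> M'" using yM by (auto simp: M'_def)
  ultimately show ?thesis by blast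
qed

text \<open>The capped circles of a connected ribbon graph merge into one disc, whose boundary walk
  is a product of commutators. In a disconnected graph some component inherits the inequality, as
  the number of sides is additive and that of vertices subadditive.\<close>

lemma comm_prod_of_ribbon:
  fixes D :: "'d set"
  assumes "ribbon r D \<sigma> \<pi> p h" "D \<noteq> {}"
    and "real (card D) - 2 * real (card (h ` D)) \<le> 4 * s * real (card D) / real (length r)"
  shows "\<exists>n t w. n \<ge> 1 \<and> conj_prod (free_group S) r n w \<and> comm_prod (free_group S) t w \<and> real t < n * s + 1"
  using assms
proof (induction "card D" arbitrary: D rule: less_induct)
  case less
  note R = less.prems(1)
  have fin: "finite D" using ribbonD(1)[OF R] .
  have L: "real (length r) > 0" using r by simp
  show ?case
  proof (cases "\<exists>M\<subset>D. M \<noteq> {} \<and> (\<forall>x\<in>M. \<sigma> x \<in> M \<and> \<pi> x \<in> M)")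
    case True
    then obtain M where M: "M \<subset> D" "M \<noteq> {}" "\<And>x. x \<in> M \<Longrightarrow> \<sigma> x \<in> M \<and> \<pi> x \<in> M" by blast
    have R1: "ribbon r M \<sigma> \<pi> p h" using ribbon_subset[OF R] M by blast
    have R2: "ribbon r (D - M) \<sigma> \<pi> p h" using ribbon_Diff[OF R] M by blast
    have c: "card D = card M + card (D - M)"
      using M(1) fin by (metis Diff_disjoint Un_Diff_cancel card_Un_disjoint finite_Diff psubset_imp_subset rev_finite_subset sup.absorb2)
    have "h ` D = h ` M \<union> h ` (D - M)" using M(1) by blast
    then have hc: "card (h ` D) \<le> card (h ` M) + card (h ` (D - M))" by (simp add: card_Un_le)
    have lt: "card M < card D" "card (D - M) < card D"
      using M(1,2) fin by (auto intro!: psubset_card_mono)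
    have "real (card M) - 2 * real (card (h ` M)) \<le> 4 * s * real (card M) / real (length r) \<or>
        real (card (D - M)) - 2 * real (card (h ` (D - M))) \<le> 4 * s * real (card (D - M)) / real (length r)"
    proof (rule ccontr)
      assume "\<not> ?thesis"
      then have "4 * s * real (card M) / real (length r) + 4 * s * real (card (D - M)) / real (length r) <
         real (card M) - 2 * real (card (h ` M)) + (real (card (D - M)) - 2 * real (card (h ` (D - M))))"
        by linarith
      moreover have "4 * s * real (card D) / real (length r) =
          4 * s * real (card M) / real (length r) + 4 * s * real (card (D - M)) / real (length r)"
        by (simp add: c distrib_left add_divide_distrib)
      ultimately show False using less.prems(3) hc c by linarith
    qed
    then show ?thesis
      using less.hyps[OF lt(1) R1 M(2)] less.hyps[OF lt(2) R2] M(1) by blast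
  next
    case False
    obtain y where "y \<in> D" using less.prems by blast
    then obtain M0 where M0: "merged D \<sigma> \<pi> p h M0" using merged_face[OF R] by blast
    have "\<forall>M. merged D \<sigma> \<pi> p h M \<longrightarrow> card M < Suc (card D)"
      using fin by (auto simp: merged_def less_Suc_eq_le intro!: card_mono)
    from ex_has_greatest_nat[of "merged D \<sigma> \<pi> p h" M0 card, OF M0 this]
    obtain M where M: "merged D \<sigma> \<pi> p h M" and max: "\<And>M'. merged D \<sigma> \<pi> p h M' \<Longrightarrow> card M' \<le> card M"
      by blast
    have MD: "M \<subseteq> D" using M by (simp add: merged_def)
    have "\<pi> x \<in> M" if x: "x \<in> M" for x
    proof (rule ccontr)
      assume "\<pi> x \<notin> M"
      then obtain M' where "M \<subset> M'" "merged D \<sigma> \<pi> p h M'" using merged_extend[OF R M x] by blast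
      moreover from this have "finite M'" using fin by (auto simp: merged_def intro: finite_subset)
      ultimately show False using max psubset_card_mono by (metis leD)
    qed
    moreover have "\<sigma> ` M \<subseteq> M" "M \<noteq> {}"
      using M unfolding merged_def by blast+
    ultimately have "M \<noteq> {} \<and> (\<forall>x\<in>M. \<sigma> x \<in> M \<and> \<pi> x \<in> M)"
      by (simp add: image_subset_iff)
    then have MeqD: "M = D" using False MD by (metis psubsetI)
    obtain us a n where us: "distinct us" "set us \<subseteq> D" "\<And>z. z \<in> D - set us \<Longrightarrow> \<pi> z \<in> D - set us"
      "walk \<pi> h a us a" "h ` D \<subseteq> insert a (h ` set us)" "card D = n * length r"
      "conj_prod (free_group S) r n (list_prod (letter_val p) us)"
      using M unfolding MeqD merged_def by (elim exE conjE) (rule that; blast)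
    have inv: "\<pi> x \<in> set us \<and> \<pi> (\<pi> x) = x \<and> \<pi> x \<noteq> x" if "x \<in> set us" for x
    proof -
      have xD: "x \<in> D" using that us(2) by blast
      have "\<pi> x \<in> set us" using us(3)[of "\<pi> x"] ribbonD(3,4)[OF R xD] that by auto
      moreover have "\<pi> x \<noteq> x" using ribbonD(6)[OF R xD] by (metis flip_neq(1))
      ultimately show ?thesis using ribbonD(4)[OF R xD] by simp
    qed
    have val: "letter_val p x \<in> carrier (free_group S) \<and>
        letter_val p (\<pi> x) = inv\<^bsub>free_group S\<^esub> (letter_val p x)" if "x \<in> set us" for x
    proof -
      have xD: "x \<in> D" using that us(2) by blast
      have "fst (r ! p x) \<in> S"
        using r(1) ribbonD(5)[OF R xD] nth_mem by (fastforce simp: carrier_free_group)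
      then show ?thesis
        using ribbonD(6)[OF R xD] reduce_single_flip letter_val_closed[OF ribbonD(5)[OF R xD]] by simp
    qed
    obtain t where t: "4 * t + 2 * card (insert a (h ` set us)) \<le> length us + 2"
        "comm_prod (free_group S) t (list_prod (letter_val p) us)"
      using comm_prod_closed_walk[of us \<pi> h a "letter_val p", OF us(1,4) inv val] by blast
    have "length us \<le> card D" using us(1,2) fin by (metis card_mono distinct_card)
    moreover have "card (h ` D) \<le> card (insert a (h ` set us))" using us(5) by (intro card_mono) auto
    ultimately have "4 * real t \<le> real (card D) - 2 * real (card (h ` D)) + 2"
      using t(1) by linarith
    moreover have "4 * s * real (card D) / real (length r) = 4 * s * n" using us(6) L by simp
    ultimately have "4 * real t \<le> 4 * s * real n + 2" using less.prems(3) by linarith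
    moreover have "4 * s * real n = 4 * (real n * s)" by simp
    \<comment> \<open>In fact \<open>t \<le> n s + 1/2\<close>, that is,
      \<open>k \<le> n s - 1/2\<close> for \<open>t = k + 1\<close>. The half is the contribution of
      a single capping disc.\<close>
    ultimately have "real t < n * s + 1" by linarith
    moreover have "n \<ge> 1" using us(6) less.prems(2) fin by (cases n) auto
    ultimately show ?thesis using us(7) t(2) by blast
  qed
qed

end

section \<open>Stable commutator length\<close>

text \<open>Fekete's lemma: write \<open>n\<close> as a multiple of \<open>m\<close> plus a
  remainder, for an \<open>m\<close> whose quotient is nearly the infimum. The remainder and the
  terms \<open>a 0\<close> left by subadditivity are collected in the constant
  \<open>c\<close>.\<close>

lemma fekete:
  fixes a :: "nat \<Rightarrow> real"
  assumes nonneg: "\<And>n. 0 \<le> a n" and sub: "\<And>m n. a (m + n) \<le> a m + a n"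
  shows "(\<lambda>n. a n / n) \<longlonglongrightarrow> (INF n\<in>{1..}. a n / n)"
proof -
  define I where "I = (INF n\<in>{1..}. a n / real n)"
  have bdd: "bdd_below ((\<lambda>n. a n / real n) ` {1..})"
    by (rule bdd_belowI[of _ 0]) (use nonneg in auto)
  have lower: "I \<le> a n / real n" if "n \<ge> 1" for n
    unfolding I_def by (rule cINF_lower[OF bdd]) (use that in auto)
  have mult: "a (q * m) \<le> q * a m + a 0" for q m
  proof (induction q)
    case (Suc q)
    then show ?case using sub[of m "q * m"] by (simp add: distrib_right)
  qed simp
  have "(\<lambda>n. a n / n) \<longlonglongrightarrow> I"
  proof (rule LIMSEQ_I)
    fix e :: real assume e: "e > 0"
    have "\<exists>y\<in>(\<lambda>n. a n / real n) ` {1..}. y < I + e / 2"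
      unfolding I_def using e by (intro iffD1[OF cInf_less_iff[OF _ bdd]]) auto
    then obtain m where m: "m \<ge> 1" "a m / real m < I + e / 2" by auto
    define c where "c = real m * a 1 + 2 * a 0"
    have c: "c \<ge> 0" using nonneg by (simp add: c_def)
    have up: "a n \<le> real n * (a m / real m) + c" for n
    proof -
      have "a n \<le> a (n div m * m) + a (n mod m)" using sub[of "n div m * m" "n mod m"] by simp
      also have "a (n div m * m) \<le> (n div m) * a m + a 0" by (rule mult)
      also have "real (n div m) * a m \<le> real n / real m * a m"
      proof (rule mult_right_mono[OF _ nonneg])
        have "real (n div m * m) \<le> real n" by (simp only: of_nat_le_iff div_times_less_eq_dividend)
        then show "real (n div m) \<le> real n / real m" using m by (simp add: field_simps)
      qed
      also have "a (n mod m) \<le> (n mod m) * a 1 + a 0" using mult[of "n mod m" 1] by simp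
      also have "real (n mod m) * a 1 \<le> real m * a 1"
        using m by (intro mult_right_mono nonneg) (simp add: less_imp_le)
      finally show ?thesis by (simp add: c_def)
    qed
    obtain N where N: "real N > 2 * c / e" using reals_Archimedean2 by blast
    show "\<exists>no. \<forall>n\<ge>no. norm (a n / real n - I) < e"
    proof (intro exI allI impI)
      fix n assume n: "n \<ge> Suc N"
      then have np: "real n > 0" by simp
      have "real n > 2 * c / e" using N n by simp
      then have "c / real n < e / 2" using e np by (simp add: field_simps)
      moreover have "a n / real n \<le> a m / real m + c / real n"
        using up[of n] np by (simp add: field_simps)
      ultimately have "a n / real n < I + e" using m(2) by linarith
      moreover have "I \<le> a n / real n" using lower n by simp
      ultimately show "norm (a n / real n - I) < e" by simp
    qed
  qed
  then show ?thesis unfolding I_def .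
qed

context group
begin

lemma comm_prod_pow: "comm_prod G t w \<Longrightarrow> comm_prod G (n * t) (w [^] n)"
proof (induction n)
  case (Suc n)
  then have "comm_prod G (n * t + t) (w [^] n \<otimes> w)" by (intro comm_prod_mult) auto
  then show ?case by (simp add: add.commute)
qed simp

lemma comm_prod_in_derived: "comm_prod G t w \<Longrightarrow> w \<in> derived G (carrier G)"
  unfolding derived_def
proof (induction t arbitrary: w)
  case 0
  then show ?case by (simp add: generate.one)
next
  case (Suc t)
  then obtain a b u where ab: "a \<in> carrier G" "b \<in> carrier G" and u: "comm_prod G t u"
      and w: "w = (a \<otimes> b \<otimes> inv a \<otimes> inv b) \<otimes> u"
    unfolding comm_prod_Suc by blast
  have "a \<otimes> b \<otimes> inv a \<otimes> inv b \<in> derived_set G (carrier G)" using ab by blast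
  then show ?case unfolding w by (rule generate.eng[OF generate.incl Suc.IH[OF u]])
qed

text \<open>Commutator length is subadditive along the powers of \<open>w\<close>, so the
  \<open>lim\<close> in the definition is an actual limit.\<close>

lemma stable_commutator_length_LIMSEQ:
  assumes "w \<in> derived G (carrier G)"
  shows "(\<lambda>n. real (commutator_length G (w [^] n)) / real n) \<longlonglongrightarrow> stable_commutator_length G w"
proof -
  obtain t where t: "comm_prod G t w" using comm_prod_derived assms by blast
  have wc: "w \<in> carrier G" using comm_prod_closed[OF t] .
  define a where "a n = real (commutator_length G (w [^] (n::nat)))" for n
  have cl: "comm_prod G (commutator_length G (w [^] (n::nat))) (w [^] n)" for n
    unfolding commutator_length_eq
    using LeastI[of "\<lambda>k. comm_prod G k (w [^] n)", OF comm_prod_pow[OF t]] .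
  have "a (m + n) \<le> a m + a n" for m n
  proof -
    have "commutator_length G (w [^] m \<otimes> w [^] n) \<le>
        commutator_length G (w [^] m) + commutator_length G (w [^] n)"
      by (rule commutator_length_le[OF comm_prod_mult[OF cl cl]])
    then show ?thesis using nat_pow_mult[OF wc, of m n] by (simp add: a_def)
  qed
  then have "(\<lambda>n. a n / real n) \<longlonglongrightarrow> (INF n\<in>{1..}. a n / real n)"
    by (intro fekete) (auto simp: a_def)
  from limI[OF this] this show ?thesis
    by (simp add: stable_commutator_length_def a_def)
qed

end

section \<open>Surfaces of small complexity\<close>

lemma nth_concat_replicate: "i < n * length w \<Longrightarrow> concat (replicate n w) ! i = w ! (i mod length w)"
proof (induction n arbitrary: i)
  case (Suc n)
  then show ?case by (auto simp: nth_append le_mod_geq)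
qed simp

lemma walk_nth:
  "walk \<pi> h a xs b \<Longrightarrow> i < length xs \<Longrightarrow>
     h (\<pi> (xs ! i)) = (if Suc i < length xs then h (xs ! Suc i) else b)"
proof (induction xs arbitrary: a i)
  case (Cons x xs)
  show ?case
  proof (cases i)
    case 0
    then show ?thesis using Cons.prems by (cases xs) auto
  next
    case (Suc j)
    then show ?thesis using Cons by auto
  qed
qed simp

text \<open>Pairing the sides of a polygon labelled by \<open>r^N\<close> gives a ribbon graph with
  a single boundary circle: \<open>\<sigma>\<close> is the cyclic successor along the polygon, and
  positions in \<open>r\<close> are indices modulo \<open>length r\<close>.\<close>

lemma ribbon_of_comm_prod:
  assumes r: "r \<in> carrier (free_group S)" "r \<noteq> []" and N: "N \<ge> 1"
    and g: "comm_prod (free_group S) g (r [^]\<^bsub>free_group S\<^esub> N)"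
  shows "\<exists>(D :: nat set) \<sigma> \<pi> p h. ribbon r D \<sigma> \<pi> p h \<and> card D = N * length r \<and>
     card D + 2 \<le> 4 * g + 2 * card (h ` D)"
proof -
  have "surface_word g (concat (replicate N r))"
    using surface_word_comm_prod[OF g] reduce_concat_replicate[OF r(1), of N] surface_word_reduce
    by metis
  then obtain ds :: "nat list" and \<pi> and h :: "nat \<Rightarrow> nat" and l a where
    dist: "distinct ds" and wk: "walk \<pi> h a ds a" and
    inv: "\<And>x. x \<in> set ds \<Longrightarrow> \<pi> x \<in> set ds \<and> \<pi> (\<pi> x) = x \<and> l (\<pi> x) = flip (l x)" and
    lds: "map l ds = concat (replicate N r)" and
    len: "length ds + 2 \<le> 4 * g + 2 * card (insert a (h ` set ds))"
    unfolding surface_word_def by metis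
  have L: "length r > 0" using r by simp
  define m where "m = length ds"
  have m: "m = N * length r"
    using arg_cong[OF lds, of length] by (simp add: m_def length_concat sum_list_replicate)
  have m0: "m > 0" using m N L by simp
  define idx where "idx = the_inv_into {..<m} (\<lambda>i. ds ! i)"
  have inj: "inj_on (\<lambda>i. ds ! i) {..<m}" using dist by (auto simp: inj_on_def nth_eq_iff_index_eq m_def)
  have idx: "idx (ds ! i) = i" if "i < m" for i
    unfolding idx_def using the_inv_into_f_f[OF inj] that by simp
  have D: "set ds = (\<lambda>i. ds ! i) ` {..<m}" by (auto simp: m_def set_conv_nth)
  define \<sigma> where "\<sigma> x = ds ! (Suc (idx x) mod m)" for x
  define p where "p x = idx x mod length r" for x
  have \<sigma>: "\<sigma> (ds ! i) = ds ! (Suc i mod m)" if "i < m" for i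
    using idx[OF that] by (simp add: \<sigma>_def)
  have lp: "l (ds ! i) = r ! p (ds ! i)" if "i < m" for i
  proof -
    have "l (ds ! i) = concat (replicate N r) ! i" using that by (simp flip: lds add: m_def)
    then show ?thesis using that nth_concat_replicate[of i N r] idx[OF that] by (simp add: m p_def)
  qed
  have surj: "\<sigma> ` set ds = set ds"
  proof (intro equalityI subsetI)
    fix x assume "x \<in> \<sigma> ` set ds"
    then show "x \<in> set ds" using \<sigma> m0 unfolding D by auto
  next
    fix x assume "x \<in> set ds"
    then obtain i where i: "i < m" "x = ds ! i" unfolding D by auto
    define j where "j = (if i = 0 then m - 1 else i - 1)"
    have "j < m" "Suc j mod m = i" using i m0 by (auto simp: j_def)
    then have "\<sigma> (ds ! j) = x" using \<sigma>[of j] i by simp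
    then show "x \<in> \<sigma> ` set ds" using \<open>j < m\<close> unfolding D by blast
  qed
  then have "bij_betw \<sigma> (set ds) (set ds)"
    by (simp add: bij_betw_def eq_card_imp_inj_on)
  moreover have "\<pi> x \<in> set ds \<and> \<pi> (\<pi> x) = x \<and> p x < length r \<and> r ! p (\<pi> x) = flip (r ! p x) \<and>
        p (\<sigma> x) = Suc (p x) mod length r \<and> h (\<sigma> x) = h (\<pi> x)" if x: "x \<in> set ds" for x
  proof -
    obtain i where i: "i < m" "x = ds ! i" using x unfolding D by auto
    obtain j where j: "j < m" "\<pi> x = ds ! j" using inv[OF x] unfolding D by auto
    have "r ! p (\<pi> x) = flip (r ! p x)" using inv[OF x] lp[OF i(1)] lp[OF j(1)] i j by simp
    moreover have "p (\<sigma> x) = Suc (p x) mod length r"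
    proof -
      have "Suc i mod m < m" using m0 by simp
      then have "p (\<sigma> x) = Suc i mod m mod length r" using \<sigma>[OF i(1)] i idx by (simp add: p_def)
      also have "\<dots> = Suc i mod length r" by (simp add: m mod_mod_cancel)
      also have "\<dots> = Suc (p x) mod length r" using idx[OF i(1)] i by (simp add: p_def mod_Suc_eq)
      finally show ?thesis .
    qed
    \<comment> \<open>Each side ends where the next one starts; for the last side this is the
      closedness of the walk at \<open>a\<close>.\<close>
    moreover have "h (\<sigma> x) = h (\<pi> x)"
    proof -
      have "h (\<pi> x) = (if Suc i < m then h (ds ! Suc i) else a)"
        using walk_nth[OF wk, of i] i by (simp add: m_def)
      moreover have "h (ds ! 0) = a" using wk m0 by (cases ds) (auto simp: m_def)
      moreover have "Suc i mod m = (if Suc i < m then Suc i else 0)" using i(1) by (auto simp: mod_Suc)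
      ultimately show ?thesis using \<sigma>[OF i(1)] i by auto
    qed
    ultimately show ?thesis using inv[OF x] L by (simp add: p_def)
  qed
  ultimately have "ribbon r (set ds) \<sigma> \<pi> p h" unfolding ribbon_def by simp
  moreover have "card (set ds) = N * length r" using dist m by (simp add: distinct_card m_def)
  moreover have "a \<in> h ` set ds"
  proof -
    obtain x xs where "ds = x # xs" using m0 by (cases ds) (auto simp: m_def)
    then show ?thesis using wk by auto
  qed
  then have "card (set ds) + 2 \<le> 4 * g + 2 * card (h ` set ds)"
    using len dist by (simp add: insert_absorb distinct_card)
  ultimately show ?thesis
    by (intro exI[of _ "set ds"] exI[of _ \<sigma>] exI[of _ \<pi>] exI[of _ p] exI[of _ h]) simp
qed

section \<open>Existence of an optimal gluing\<close>

lemma finite_polygon: "polygon r q \<Longrightarrow> finite q"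
  unfolding polygon_def by (meson finite_SigmaI finite_lessThan finite_subset)

lemma polygon_neq_empty: "polygon r q \<Longrightarrow> q \<noteq> {}"
  by (simp add: polygon_def)

lemma finite_polygons: "finite {q. polygon r q}"
  by (rule finite_subset[of _ "Pow ({..<length r} \<times> {..<length r})"]) (auto simp: polygon_def)

lemma gluing_Diff:
  assumes "gluing r u" "gluing r v" "u \<subseteq># v"
  shows "gluing r (v - u)"
proof -
  have "size {#q \<in># v - u. P q#} = size {#q \<in># v. P q#} - size {#q \<in># u. P q#}" for P
    using assms(3) by (simp add: filter_diff_mset size_Diff_submset multiset_filter_mono)
  then show ?thesis using assms unfolding gluing_def by (auto dest: in_diffD)
qed

text \<open>The weights \<open>card q - 2\<close> count the triangles of a triangulated polygon.\<close>

lemma ex_efficient_gluing: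
  assumes r: "r \<in> derived (free_group S) (carrier (free_group S))" "r \<noteq> []"
  defines "s \<equiv> stable_commutator_length (free_group S) r"
  shows "\<exists>v. gluing r v \<and> v \<noteq> {#} \<and> (\<Sum>q\<in>#v. real (card q) - 2 - 4 * s * real (card q) / real (length r)) \<le> 0"
proof (rule ccontr)
  interpret group "free_group S" by (rule group_free_group)
  assume neg: "\<not> ?thesis"
  have rc: "r \<in> carrier (free_group S)"
    using r derived_in_carrier[of "carrier (free_group S)"] by blast
  have L: "real (length r) > 0" using r by simp
  define e where "e q = real (card q) - 2 - 4 * s * real (card q) / real (length r)" for q :: "(nat \<times> nat) set"
  \<comment> \<open>If no gluing is efficient, the excess \<open>e\<close> is positive on every
    nonempty gluing and hence bounded below by a multiple of the number of sides.\<close>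
  have "\<exists>\<delta>>0. \<forall>v. gluing r v \<longrightarrow> \<delta> * (\<Sum>q\<in>#v. real (card q)) \<le> (\<Sum>q\<in>#v. e q)"
  proof (rule uniform_positivity[OF finite_polygons[of r]])
    show "set_mset v \<subseteq> {q. polygon r q}" if "gluing r v" for v
      using that by (auto simp: gluing_def)
    show "0 < real (card q)" if "gluing r v" "q \<in># v" for v q
    proof -
      have "polygon r q" using that by (simp add: gluing_def)
      then show ?thesis using finite_polygon polygon_neq_empty by (metis card_gt_0_iff of_nat_0_less_iff)
    qed
    show "0 < (\<Sum>q\<in>#v. e q)" if "gluing r v" "v \<noteq> {#}" for v
      using neg that unfolding e_def by force
  qed (rule gluing_Diff)
  then obtain \<delta> where \<delta>: "\<delta> > 0" "\<And>v. gluing r v \<Longrightarrow> \<delta> * (\<Sum>q\<in>#v. real (card q)) \<le> (\<Sum>q\<in>#v. e q)"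
    by blast
  \<comment> \<open>An optimal surface bounding \<open>r^N\<close> has \<open>N * length r\<close>
    sides, so its excess grows linearly in \<open>N\<close>. As the excess is at most
    \<open>4 (g - s N)\<close>, where \<open>g\<close> is the commutator length of
    \<open>r^N\<close>, the quotients \<open>g / N\<close> stay away from \<open>s\<close>.\<close>
  have bound: "\<delta> * length r / 4 \<le> real (commutator_length (free_group S) (r [^]\<^bsub>free_group S\<^esub> N)) / N - s"
    if N: "N \<ge> 1" for N :: nat
  proof -
    define g where "g = commutator_length (free_group S) (r [^]\<^bsub>free_group S\<^esub> N)"
    obtain t where "comm_prod (free_group S) t r" using comm_prod_derived r by blast
    from comm_prod_pow[OF this, of N] have "comm_prod (free_group S) g (r [^]\<^bsub>free_group S\<^esub> N)"
      unfolding g_def commutator_length_eq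
      by (rule LeastI[of "\<lambda>k. comm_prod (free_group S) k (r [^]\<^bsub>free_group S\<^esub> N)"])
    from ribbon_of_comm_prod[OF rc r(2) N this]
    obtain D :: "nat set" and \<sigma> \<pi> p h where R: "ribbon r D \<sigma> \<pi> p h" and
      cD: "card D = N * length r" and ub: "card D + 2 \<le> 4 * g + 2 * card (h ` D)"
      by (elim exE conjE)
    obtain v where v: "gluing r v" "(\<Sum>q\<in>#v. card q) = card D" "card (h ` D) \<le> size v"
      using gluing_of_ribbon[OF R] by (elim exE conjE)
    have sum: "(\<Sum>q\<in>#v. real (card q)) = real (N * length r)"
      using v(2) cD using arg_cong[OF v(2), of real] by (simp add: cD image_mset.compositionality comp_def)
    have "(\<Sum>q\<in>#v. e q) = (\<Sum>q\<in>#v. real (card q)) - 2 * size v - 4 * s * (\<Sum>q\<in>#v. real (card q)) / length r"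
      by (induction v) (auto simp: e_def algebra_simps add_divide_distrib)
    also have "\<dots> = real (card D) - 2 * size v - 4 * s * N"
      using L by (simp add: sum cD)
    also have "\<dots> \<le> 4 * real g - 4 * s * N" using ub v(3) by linarith
    finally have "\<delta> * real (N * length r) \<le> 4 * real g - 4 * s * N" using \<delta>(2)[OF v(1)] sum by simp
    then show ?thesis using N by (simp add: g_def field_simps)
  qed
  have "(\<lambda>n. real (commutator_length (free_group S) (r [^]\<^bsub>free_group S\<^esub> n)) / real n - s) \<longlonglongrightarrow> s - s"
    unfolding s_def by (intro tendsto_intros stable_commutator_length_LIMSEQ r)
  then have "\<delta> * length r / 4 \<le> s - s"
    by (rule LIMSEQ_le_const) (use bound in blast)
  then show False using \<delta>(1) L by (simp add: mult_le_0_iff)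
qed

text \<open>If every polygon were a bigon, the letters of \<open>r\<close> would be matched by an orientation
  reversing symmetry of the circle; such a symmetry fixes a letter or swaps two adjacent ones.\<close>

lemma gluing_not_all_bigons:
  assumes red: "\<And>i. i < length r \<Longrightarrow> r ! (Suc i mod length r) \<noteq> flip (r ! i)" and v: "gluing r v" "v \<noteq> {#}"
  shows "(\<Sum>q\<in>#v. real (card q) - 2) > 0"
proof (rule ccontr)
  assume neg: "\<not> ?thesis"
  have poly: "polygon r q" if "q \<in># v" for q using v that by (auto simp: gluing_def)
  have fin: "finite q" if "q \<in># v" for q
    using poly[OF that] by (rule finite_polygon)
  \<comment> \<open>A monogon would glue a letter to its cyclic successor, which cyclic reducedness
    forbids.\<close>
  have ge2: "card q \<ge> 2" if "q \<in># v" for q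
  proof (rule ccontr)
    assume "\<not> ?thesis"
    moreover have "card q \<noteq> 0" using poly[OF that] fin[OF that] by (simp add: polygon_def)
    ultimately have "card q = 1" by simp
    then obtain a b where q: "q = {(a, b)}" by (metis card_1_singletonE surj_pair)
    then have "a = Suc b mod length r" "r ! b = flip (r ! a)" "b < length r"
      using poly[OF that] by (auto simp: polygon_def next_corner_def)
    then show False using red[of b] by simp
  qed
  have eq2: "card q = 2" if q: "q \<in># v" for q
  proof (rule ccontr)
    assume "card q \<noteq> 2"
    then have "card q > 2" using ge2[OF q] by simp
    obtain v' where v': "v = add_mset q v'" using multi_member_split[OF q] by blast
    have nonneg: "\<forall>q\<in>#u. card q \<ge> 2 \<Longrightarrow> (\<Sum>q\<in>#u. real (card q) - 2) \<ge> 0"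
      for u :: "(nat \<times> nat) set multiset"
      by (induction u) auto
    have "(\<Sum>q\<in>#v'. real (card q) - 2) \<ge> 0"
      by (rule nonneg) (use ge2 v' in auto)
    then show False using neg \<open>card q > 2\<close> by (simp add: v')
  qed
  define arcs where "arcs = {e. \<exists>q\<in>#v. e \<in> q}"
  \<comment> \<open>A bigon makes two edges parallel: besides \<open>(a, b)\<close> it contains
    \<open>(b + 1, a - 1)\<close>, modulo \<open>length r\<close>.\<close>
  have step: "(Suc b mod length r, a') \<in> q \<and> Suc a' mod length r = a \<and> a' < length r"
    if q: "q \<in># v" and x: "q = {(a, b), (x, a')}" "(a, b) \<noteq> (x, a')" for a b x a' q
  proof -
    have p: "inj_on fst q" "fst ` q = next_corner r ` q" "\<forall>e\<in>q. r ! snd e = flip (r ! fst e)"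
        "q \<subseteq> {..<length r} \<times> {..<length r}"
      using poly[OF q] by (simp_all add: polygon_def)
    have mem: "(a, b) \<in> q" "(x, a') \<in> q" by (simp_all add: x(1))
    have P: "a' < length r" "b < length r" "r ! b = flip (r ! a)"
      using mem p(3,4) by auto
    have ax: "a \<noteq> x" using inj_onD[OF p(1) _ mem] x(2) by auto
    have "{a, x} = {Suc b mod length r, Suc a' mod length r}"
      using p(2) unfolding x(1) by (simp add: next_corner_def)
    moreover have "a \<noteq> Suc b mod length r" using P(2,3) red[of b] by auto
    ultimately have "x = Suc b mod length r" "a = Suc a' mod length r" using ax by (auto simp: doubleton_eq_iff)
    then show ?thesis using mem(2) P(1) by simp
  qed
  \<comment> \<open>By the gluing condition the reversed pair \<open>(a - 1, b + 1)\<close> occurs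
    as well, so the step can be iterated.\<close>
  have arc_step: "\<exists>a'. (a', Suc b mod length r) \<in> arcs \<and> Suc a' mod length r = a \<and> a' < length r"
    if "(a, b) \<in> arcs" for a b
  proof -
    obtain q where q: "q \<in># v" "(a, b) \<in> q" using \<open>(a, b) \<in> arcs\<close> by (auto simp: arcs_def)
    have "card (q - {(a, b)}) = 1" using eq2[OF q(1)] q fin[OF q(1)] by simp
    then obtain x a' where x: "q - {(a, b)} = {(x, a')}" by (metis card_1_singletonE surj_pair)
    have "(x, a') \<in> q - {(a, b)}" unfolding x by simp
    then have "(a, b) \<noteq> (x, a')" by blast
    moreover have "q = {(a, b), (x, a')}" using insert_Diff[OF q(2)] x by simp
    ultimately have "(Suc b mod length r, a') \<in> q" "Suc a' mod length r = a" "a' < length r"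
      using step[OF q(1)] by blast+
    then have *: "(Suc b mod length r, a') \<in> arcs" "Suc a' mod length r = a" "a' < length r"
      using q(1) by (auto simp: arcs_def)
    have arcs: "e \<in> arcs \<longleftrightarrow> size {#q \<in># v. e \<in> q#} \<noteq> 0" for e
      unfolding size_eq_0_iff_empty set_mset_eq_empty_iff[symmetric] set_mset_filter arcs_def by blast
    have "(a', Suc b mod length r) \<in> arcs"
      using *(1) v(1) unfolding arcs gluing_def by (elim conjE) (simp only: not_False_eq_True)
    then show ?thesis using * by blast
  qed
  obtain q where "q \<in># v" using v(2) by blast
  then obtain a b where ab: "(a, b) \<in> arcs" using poly[of q] by (auto simp: polygon_def arcs_def)
  have arcD: "x < length r \<and> y < length r \<and> r ! y = flip (r ! x)" if "(x, y) \<in> arcs" for x y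
    using that poly by (fastforce simp: arcs_def polygon_def)
  define L where "L = length r"
  \<comment> \<open>A representative of \<open>a - b\<close> modulo \<open>L\<close> that avoids
    truncated subtraction.\<close>
  define d where "d = a + L - b"
  have "\<exists>a'<L. (a', (b + i) mod L) \<in> arcs \<and> (a' + i) mod L = a" for i
  proof (induction i)
    case 0
    then show ?case using ab arcD[OF ab] by (auto simp: L_def)
  next
    case (Suc i)
    then obtain a' where a': "a' < L" "(a', (b + i) mod L) \<in> arcs" "(a' + i) mod L = a" by blast
    obtain a'' where a'': "(a'', Suc ((b + i) mod L) mod L) \<in> arcs" "Suc a'' mod L = a'" "a'' < L"
      using arc_step[OF a'(2)] by (auto simp: L_def)
    have "(a'' + Suc i) mod L = (Suc a'' mod L + i) mod L" by (simp add: mod_add_left_eq)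
    then show ?case using a' a'' by (intro exI[of _ a'']) (auto simp: mod_Suc_eq)
  qed
  \<comment> \<open>Moving \<open>a\<close> back and \<open>b\<close> forward halfway brings them
    together up to \<open>d mod 2\<close>. They become equal or adjacent, but a letter is inverse
    neither to itself nor to its successor.\<close>
  from this[of "d div 2"] obtain a' where a': "a' < L" "(a', (b + d div 2) mod L) \<in> arcs" "(a' + d div 2) mod L = a"
    by blast
  define y where "y = (b + d div 2) mod L"
  have bL: "b < L" "a < L" using arcD[OF ab] by (auto simp: L_def)
  have Lp: "L > 0" using bL by simp
  have eq: "(a' + d div 2) mod L = (y + d mod 2 + d div 2) mod L"
  proof -
    have "(y + d mod 2 + d div 2) mod L = (y + (d mod 2 + d div 2)) mod L" by (simp add: add.assoc)
    also have "\<dots> = (b + d div 2 + (d mod 2 + d div 2)) mod L" by (simp add: y_def mod_add_left_eq)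
    also have "b + d div 2 + (d mod 2 + d div 2) = b + d" by presburger
    also have "b + d = a + L" using bL by (simp add: d_def)
    finally show ?thesis using a'(3) bL by simp
  qed
  have yL: "y < L" using Lp by (simp add: y_def)
  have "a' mod L = (y + d mod 2) mod L"
  proof -
    obtain q1 q2 where "a' + d div 2 + L * q1 = y + d mod 2 + d div 2 + L * q2"
      using eq unfolding nat_mod_eq_iff by blast
    then have "a' + L * q1 = y + d mod 2 + L * q2" by linarith
    then show ?thesis unfolding nat_mod_eq_iff by blast
  qed
  then have "a' = (y + d mod 2) mod L" using a'(1) by simp
  moreover have "r ! y = flip (r ! a')" using arcD[OF a'(2)] by (simp add: y_def)
  moreover have "d mod 2 = 0 \<or> d mod 2 = 1" by auto
  ultimately show False using yL red[of y] by (auto simp: L_def)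
qed

lemma efficient_surface_cyclically_reduced:
  assumes r: "r \<in> derived (free_group S) (carrier (free_group S))" "r \<noteq> []"
    and red: "\<And>i. i < length r \<Longrightarrow> r ! (Suc i mod length r) \<noteq> flip (r ! i)"
  shows "\<exists>n k w. n \<ge> 1 \<and> conj_prod (free_group S) r n w \<and> comm_prod (free_group S) (Suc k) w \<and>
     real k < n * stable_commutator_length (free_group S) r"
proof -
  interpret group "free_group S" by (rule group_free_group)
  define s where "s = stable_commutator_length (free_group S) r"
  have rc: "r \<in> carrier (free_group S)"
    using r derived_in_carrier[of "carrier (free_group S)"] by blast
  have L: "real (length r) > 0" using r by simp
  define e where "e q = real (card q) - 2 - 4 * s * real (card q) / real (length r)" for q :: "(nat \<times> nat) set"
  obtain v where v: "gluing r v" "v \<noteq> {#}" "(\<Sum>q\<in>#v. e q) \<le> 0"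
    using ex_efficient_gluing[OF r] unfolding s_def e_def by blast
  have sum: "(\<Sum>q\<in>#u. e q) = (\<Sum>q\<in>#u. real (card q) - 2) - 4 * s * real (\<Sum>q\<in>#u. card q) / length r" for u
    by (induction u) (auto simp: e_def algebra_simps add_divide_distrib)
  \<comment> \<open>If \<open>s \<le> 0\<close>, the total excess would be at least the sum of
    \<open>card q - 2\<close>, which is positive as \<open>r\<close> is cyclically reduced.\<close>
  have "s > 0"
  proof (rule ccontr)
    assume "\<not> s > 0"
    then have "4 * s \<le> 0" by simp
    from mult_nonpos_nonneg[OF this of_nat_0_le_iff]
    have "4 * s * real (\<Sum>q\<in>#v. card q) / length r \<le> 0"
      by (rule divide_nonpos_nonneg) simp
    then show False using gluing_not_all_bigons[OF red v(1,2)] v(3) sum[of v] by linarith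
  qed
  from ribbon_of_gluing[OF v(1)]
  obtain D :: "(nat \<times> nat \<times> nat) set" and \<sigma> \<pi> p h where R: "ribbon r D \<sigma> \<pi> p h"
      and D: "card D = (\<Sum>q\<in>#v. card q)" "card (h ` D) = size v"
    by (elim exE conjE)
  have "h ` D \<noteq> {}" using D(2) v(2) by (metis card.empty size_eq_0_iff_empty)
  then have "D \<noteq> {}" by blast
  have "(\<Sum>q\<in>#u. real (card q) - 2) = real (\<Sum>q\<in>#u. card q) - 2 * real (size u)"
    for u :: "(nat \<times> nat) set multiset"
    by (induction u) auto
  then have "real (card D) - 2 * real (card (h ` D)) \<le> 4 * s * real (card D) / real (length r)"
    using v(3) sum[of v] D by simp
  from comm_prod_of_ribbon[OF rc r(2) R \<open>D \<noteq> {}\<close> this]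
  obtain n t w where w: "n \<ge> 1" "conj_prod (free_group S) r n w" "comm_prod (free_group S) t w"
      "real t < real n * s + 1"
    by (elim exE conjE)
  \<comment> \<open>For \<open>t = 0\<close>, a sphere, a trivial commutator is added; then
    \<open>k = 0\<close>, and the strict bound is the positivity of \<open>s\<close>.\<close>
  have "comm_prod (free_group S) (Suc (t - 1)) w" by (rule comm_prod_mono[OF w(3)]) simp
  moreover have "real (t - 1) < real n * s" using w(1,4) \<open>s > 0\<close> by (cases t) auto
  ultimately show ?thesis using w(1,2) unfolding s_def by blast
qed

text \<open>As long as the first and the last letter are inverse to each other, they are stripped
  off as a conjugation.\<close>

lemma cyclic_reduction:
  assumes "r \<in> carrier (free_group S)" "r \<noteq> []"
  shows "\<exists>h r'. h \<in> carrier (free_group S) \<and> r' \<in> carrier (free_group S) \<and> r' \<noteq> [] \<and>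
     r = h \<otimes>\<^bsub>free_group S\<^esub> r' \<otimes>\<^bsub>free_group S\<^esub> inv\<^bsub>free_group S\<^esub> h \<and>
     (\<forall>i<length r'. r' ! (Suc i mod length r') \<noteq> flip (r' ! i))"
  using assms
proof (induction "length r" arbitrary: r rule: less_induct)
  case less
  interpret group "free_group S" by (rule group_free_group)
  have red: "reduced_word r" and sub: "fst ` set r \<subseteq> S" using less.prems by (auto simp: carrier_free_group)
  have nth: "r ! Suc i \<noteq> flip (r ! i)" if "Suc i < length r" for i
    using red that by (auto simp: reduced_word_def successively_conv_nth)
  show ?case
  proof (cases "hd r = flip (last r)")
    case True
    obtain x m0 where r1: "r = x # m0" using less.prems by (cases r) auto
    then have "m0 \<noteq> []" using True by auto
    then obtain m y where m0: "m0 = m @ [y]" by (cases m0 rule: rev_cases) auto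
    have y: "y = flip x" using True r1 m0 by simp
    have rm: "r = [x] @ m @ [flip x]" by (simp add: r1 m0 y)
    have "m \<noteq> []" using nth[of 0] by (auto simp: rm)
    have "reduced_word m" using red by (simp add: rm reduced_word_def successively_append_iff successively_Cons)
    then have mc: "m \<in> carrier (free_group S)" using sub by (simp add: carrier_free_group rm)
    obtain h r' where h: "h \<in> carrier (free_group S)" "r' \<in> carrier (free_group S)" "r' \<noteq> []"
       "m = h \<otimes>\<^bsub>free_group S\<^esub> r' \<otimes>\<^bsub>free_group S\<^esub> inv\<^bsub>free_group S\<^esub> h"
       "\<forall>i<length r'. r' ! (Suc i mod length r') \<noteq> flip (r' ! i)"
      using less.hyps[OF _ mc \<open>m \<noteq> []\<close>] by (auto simp: rm)
    have X: "reduce [x] \<in> carrier (free_group S)" using sub by (intro reduce_in_carrier) (auto simp: rm)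
    have "r = reduce [x] \<otimes>\<^bsub>free_group S\<^esub> m \<otimes>\<^bsub>free_group S\<^esub> reduce [flip x]"
      using red \<open>reduced_word m\<close> X mc sub
      by (metis (no_types, lifting) rm reduce_append reduce_reduced m_assoc inv_closed reduce_single_flip
          image_subset_iff list.set_intros(1) r1)
    also have "reduce [flip x] = inv\<^bsub>free_group S\<^esub> reduce [x]"
      using sub by (intro reduce_single_flip) (auto simp: rm)
    finally have "r = (reduce [x] \<otimes>\<^bsub>free_group S\<^esub> h) \<otimes>\<^bsub>free_group S\<^esub> r' \<otimes>\<^bsub>free_group S\<^esub>
        inv\<^bsub>free_group S\<^esub> (reduce [x] \<otimes>\<^bsub>free_group S\<^esub> h)"
      using X h(1,2) by (simp add: h(4) m_assoc inv_mult_group)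
    then show ?thesis using X h by (metis m_closed)
  next
    case False
    have "r ! (Suc i mod length r) \<noteq> flip (r ! i)" if i: "i < length r" for i
    proof (cases "Suc i < length r")
      case True
      then show ?thesis using nth by simp
    next
      case f: False
      then have "Suc i = length r" using i by simp
      then have "Suc i mod length r = 0" "i = length r - 1" by auto
      then show ?thesis using False less.prems by (simp add: hd_conv_nth last_conv_nth)
    qed
    then show ?thesis
      using less.prems by (intro exI[of _ "\<one>\<^bsub>free_group S\<^esub>"] exI[of _ r]) auto
  qed
qed

text \<open>Stable commutator length and being a product of \<open>n\<close> conjugates depend only
  on the conjugacy class of \<open>r\<close>, so a cyclically reduced representative
  suffices.\<close>

theorem efficient_surface:
  assumes "r \<in> derived (free_group S) (carrier (free_group S)) - {\<one>\<^bsub>free_group S\<^esub>}"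
  shows "\<exists>n k w. n \<ge> 1 \<and> conj_prod (free_group S) r n w \<and> comm_prod (free_group S) (Suc k) w \<and>
     real k < n * stable_commutator_length (free_group S) r"
proof -
  interpret group "free_group S" by (rule group_free_group)
  have rc: "r \<in> carrier (free_group S)"
    using assms derived_in_carrier[of "carrier (free_group S)"] by blast
  have "r \<noteq> []" using assms by (simp add: one_free_group)
  from cyclic_reduction[OF rc this]
  obtain h r' where h: "h \<in> carrier (free_group S)" "r' \<in> carrier (free_group S)" "r' \<noteq> []"
     "r = h \<otimes>\<^bsub>free_group S\<^esub> r' \<otimes>\<^bsub>free_group S\<^esub> inv\<^bsub>free_group S\<^esub> h"
     "\<And>i. i < length r' \<Longrightarrow> r' ! (Suc i mod length r') \<noteq> flip (r' ! i)"
    by blast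
  obtain t where "comm_prod (free_group S) t r" using comm_prod_derived assms by blast
  from comm_prod_conj[OF this, of "inv\<^bsub>free_group S\<^esub> h"]
  have "comm_prod (free_group S) t r'" using h(1,2) by (simp add: h(4) m_assoc)
  then have "r' \<in> derived (free_group S) (carrier (free_group S))"
    by (rule comm_prod_in_derived)
  from efficient_surface_cyclically_reduced[OF this h(3,5)]
  show ?thesis
    using conj_prod_conj_base[OF h(2,1)] stable_commutator_length_conj[OF h(2,1)]
    unfolding h(4)[symmetric] by metis
qed

section \<open>Horn filling in the singular complex\<close>

abbreviation simplex_top :: "nat \<Rightarrow> (nat \<Rightarrow> real) topology" where
  "simplex_top p \<equiv> subtopology (powertop_real UNIV) (standard_simplex p)"

lemma continuous_map_coordinate: "continuous_map (simplex_top p) euclideanreal (\<lambda>x. x i)"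
  by (intro continuous_map_from_subtopology continuous_map_product_projection) simp

text \<open>A left inverse of \<open>simplical_face k\<close>: it reads a point of face
  \<open>k\<close> in the coordinates of the smaller simplex.\<close>

definition drop_coord :: "nat \<Rightarrow> (nat \<Rightarrow> real) \<Rightarrow> nat \<Rightarrow> real" where
  "drop_coord k y = (\<lambda>l. if l < k then y l else y (Suc l))"

lemma drop_coord_simplical_face: "drop_coord k (simplical_face k w) = w"
  by (auto simp: drop_coord_def simplical_face_def)

lemma simplical_face_drop_coord: "y k = 0 \<Longrightarrow> simplical_face k (drop_coord k y) = y"
  by (rule ext) (auto simp: drop_coord_def simplical_face_def)

lemma simplical_face_drop_coord2:
  "i < k \<Longrightarrow> y k = 0 \<Longrightarrow> simplical_face (k - 1) (drop_coord i (drop_coord k y)) = drop_coord i y"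
proof (rule ext)
  fix l assume *: "i < k" "y k = 0"
  then consider "l < k - 1" | "l = k - 1" | "l \<ge> k" by linarith
  then show "simplical_face (k - 1) (drop_coord i (drop_coord k y)) l = drop_coord i y l"
    by cases (use * in \<open>auto simp: drop_coord_def simplical_face_def\<close>)
qed

lemma drop_coord_in_simplex:
  assumes "y \<in> standard_simplex (Suc p)" "k \<le> Suc p" "y k = 0"
  shows "drop_coord k y \<in> standard_simplex p"
proof -
  have "sum (drop_coord k y) {..p} = sum y {..Suc p}"
  proof -
    have "sum y {..Suc p} = sum y ({..Suc p} - {k})"
      using assms(2,3) sum.remove[of "{..Suc p}" k y] by (simp del: sum.atMost_Suc)
    also have "\<dots> = sum (drop_coord k y) {..p}"
      by (rule sum.reindex_bij_witness[of _ "\<lambda>l. if l < k then l else Suc l" "\<lambda>l. if l < k then l else l - 1"])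
        (use assms(2) in \<open>auto simp: drop_coord_def\<close>)
    finally show ?thesis ..
  qed
  then show ?thesis using assms(1,2) by (auto simp: standard_simplex_def drop_coord_def)
qed

text \<open>The retraction of the 3-simplex onto a horn subtracts the smallest of the coordinates opposite
  to the horn's faces from all of them, and gives the difference to the remaining coordinate \<open>j\<close>.\<close>

definition horn_retraction :: "nat \<Rightarrow> nat \<Rightarrow> (nat \<Rightarrow> real) \<Rightarrow> nat \<Rightarrow> real" where
  "horn_retraction j i x = (\<lambda>l. if l = j then x j + 3 * x i else if l \<le> 3 then x l - x i else 0)"

text \<open>Three coordinates lose \<open>x i\<close> and coordinate \<open>j\<close> gains
  \<open>3 * x i\<close>, so the sum is kept; minimality of \<open>x i\<close> keeps the coordinates
  nonnegative.\<close>

lemma horn_retraction_in_simplex: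
  assumes x: "x \<in> standard_simplex 3" and "j \<le> 3" "i \<le> 3" "i \<noteq> j"
    and min: "\<And>k. k \<le> 3 \<Longrightarrow> k \<noteq> j \<Longrightarrow> x i \<le> x k"
  shows "horn_retraction j i x \<in> standard_simplex 3"
proof -
  have nn: "0 \<le> x l" for l using x by (simp add: standard_simplex_def)
  have four: "{..3::nat} = {0, 1, 2, 3}" by auto
  have s: "x 0 + x 1 + x 2 + x 3 = 1" using x by (simp add: standard_simplex_def four)
  have j: "j = 0 \<or> j = 1 \<or> j = 2 \<or> j = 3" using assms(2) by auto
  have "sum (horn_retraction j i x) {..3} = 1"
    unfolding four using s j by (auto simp: horn_retraction_def)
  moreover have nn': "0 \<le> horn_retraction j i x l" for l
    using nn min[of l] nn[of i] by (auto simp: horn_retraction_def)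
  moreover have "horn_retraction j i x l \<le> 1" if "l \<le> 3" for l
    using member_le_sum[of l "{..3}" "horn_retraction j i x"] that nn' calculation(1) by simp
  moreover have "horn_retraction j i x l = 0" if "l > 3" for l
    using that assms(2) by (auto simp: horn_retraction_def)
  ultimately show ?thesis
    unfolding standard_simplex_def by (auto simp: not_le) (metis linorder_not_le zero_le_one)
qed

text \<open>The simplex is covered by the closed pieces \<open>T i\<close> on which coordinate
  \<open>i\<close> is smallest among those other than \<open>j\<close>. There the retraction lands
  in face \<open>i\<close>, where \<open>f i\<close> is applied; compatibility of the faces gives
  agreement on overlaps, and the pieces are pasted.\<close>

lemma horn_filler:
  fixes f :: "nat \<Rightarrow> (nat \<Rightarrow> real) \<Rightarrow> 'x"
  assumes j: "j \<le> 3" and f: "\<And>i. i \<le> 3 \<Longrightarrow> i \<noteq> j \<Longrightarrow> singular_simplex 2 X (f i)"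
    and compat: "\<And>i k. i < k \<Longrightarrow> k \<le> 3 \<Longrightarrow> i \<noteq> j \<Longrightarrow> k \<noteq> j \<Longrightarrow>
      singular_face 2 i (f k) = singular_face 2 (k - 1) (f i)"
  shows "\<exists>F. singular_simplex 3 X F \<and> (\<forall>i\<le>3. i \<noteq> j \<longrightarrow> singular_face 3 i F = f i)"
proof -
  define I where "I = {..3} - {j}"
  have I: "i \<in> I \<longleftrightarrow> i \<le> 3 \<and> i \<noteq> j" for i by (auto simp: I_def)
  define T where "T i = {x \<in> standard_simplex 3. \<forall>k\<in>I. x i \<le> x k}" for i
  define g where "g = (\<lambda>i x. f i (drop_coord i (horn_retraction j i x)))"
  have R: "horn_retraction j i x \<in> standard_simplex 3" "horn_retraction j i x i = 0"
    if "i \<in> I" "x \<in> T i" for i x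
    using that horn_retraction_in_simplex[of x j i] j by (auto simp: T_def I horn_retraction_def)
  have D: "drop_coord i (horn_retraction j i x) \<in> standard_simplex 2" if "i \<in> I" "x \<in> T i" for i x
    using R[OF that] drop_coord_in_simplex[of "horn_retraction j i x" 2 i] that by (simp add: I numeral_3_eq_3)
  have agree: "g i x = g k x" if ik: "i < k" "i \<in> I" "k \<in> I" and x: "x \<in> T i" "x \<in> T k" for i k x
  proof -
    have "x i = x k" using x ik by (auto simp: T_def intro: antisym)
    then have y: "horn_retraction j i x = horn_retraction j k x"
      by (auto simp: horn_retraction_def)
    define y where "y = horn_retraction j k x"
    have y0: "y i = 0" "y k = 0" "y \<in> standard_simplex 3"
      using R[OF ik(2) x(1)] R[OF ik(3) x(2)] y by (auto simp: y_def)
    define u where "u = drop_coord k y"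
    define w where "w = drop_coord i u"
    have u: "u \<in> standard_simplex 2" using D[OF ik(3) x(2)] by (simp add: u_def y_def)
    have u0: "u i = 0" using y0 ik by (simp add: u_def drop_coord_def)
    have w: "w \<in> standard_simplex 1"
      unfolding w_def using drop_coord_in_simplex[of u 1 i] u u0 ik by (simp add: numeral_2_eq_2 I)
    have "f k u = singular_face 2 i (f k) w"
      using w simplical_face_drop_coord[of u i] u0 by (simp add: singular_face_def w_def)
    also have "\<dots> = singular_face 2 (k - 1) (f i) w" using compat[of i k] ik by (simp add: I)
    also have "\<dots> = f i (simplical_face (k - 1) w)" using w by (simp add: singular_face_def)
    also have "simplical_face (k - 1) w = drop_coord i y"
      unfolding w_def u_def using simplical_face_drop_coord2 ik y0 by blast
    finally show ?thesis using y by (simp add: g_def u_def y_def)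
  qed
  have clo: "closedin (simplex_top 3) (T i)" for i
  proof -
    have "I \<noteq> {}" using j I[of 0] I[of 1] by auto
    then have "T i = (\<Inter>k\<in>I. {x \<in> topspace (simplex_top 3). x i - x k \<in> {..0}})"
      by (auto simp: T_def)
    moreover have "closedin (simplex_top 3) {x \<in> topspace (simplex_top 3). x i - x k \<in> {..0}}" for k
      by (intro closedin_continuous_map_preimage[where Y = euclideanreal] continuous_intros
            continuous_map_coordinate) simp
    ultimately show ?thesis using \<open>I \<noteq> {}\<close> by (auto intro!: closedin_Inter)
  qed
  have cont: "continuous_map (subtopology (simplex_top 3) (T i)) X (g i)" if i: "i \<in> I" for i
  proof -
    have Ti: "T i \<subseteq> standard_simplex 3" by (auto simp: T_def)
    have "continuous_map (subtopology (simplex_top 3) (T i)) (simplex_top 2)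
        (\<lambda>x. drop_coord i (horn_retraction j i x))"
      unfolding continuous_map_in_subtopology continuous_map_componentwise_UNIV
    proof (intro conjI allI)
      fix l
      have "continuous_map (subtopology (simplex_top 3) (T i)) euclideanreal (\<lambda>x. horn_retraction j i x m)" for m
        unfolding horn_retraction_def
        by (cases "m = j"; cases "m \<le> 3")
          (auto intro!: continuous_intros continuous_map_from_subtopology[OF continuous_map_coordinate])
      then show "continuous_map (subtopology (simplex_top 3) (T i)) euclideanreal
          (\<lambda>x. drop_coord i (horn_retraction j i x) l)"
        by (cases "l < i") (simp_all add: drop_coord_def)
    qed (use D[OF i] in auto)
    from continuous_map_compose[OF this, of X "f i"] f[of i] i show ?thesis
      by (simp add: I g_def singular_simplex_def comp_def)
  qed
  have cover: "topspace (simplex_top 3) \<subseteq> \<Union> (T ` I)"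
  proof
    fix x assume x: "x \<in> topspace (simplex_top 3)"
    have "finite I" by (simp add: I_def)
    moreover have "I \<noteq> {}" using j I[of 0] I[of 1] by auto
    ultimately have "Min (x ` I) \<in> x ` I" by simp
    then obtain i where "i \<in> I" "x i = Min (x ` I)" by auto
    then have "x \<in> T i" using x \<open>finite I\<close> by (auto simp: T_def)
    then show "x \<in> \<Union> (T ` I)" using \<open>i \<in> I\<close> by blast
  qed
  have ag: "g i x = g k x" if "i \<in> I" "k \<in> I" "x \<in> topspace (simplex_top 3) \<inter> T i \<inter> T k" for i k x
    using agree[of i k x] agree[of k i x] that by (metis IntD1 IntD2 linorder_neqE_nat)
  have "finite I" by (simp add: I_def)
  from pasting_lemma_exists_closed[OF this cover clo cont ag]
  obtain G where G: "continuous_map (simplex_top 3) X G"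
      "\<And>x i. i \<in> I \<Longrightarrow> x \<in> topspace (simplex_top 3) \<inter> T i \<Longrightarrow> G x = g i x" by metis
  define F where "F = restrict G (standard_simplex 3)"
  have "continuous_map (simplex_top 3) X F"
    by (rule continuous_map_eq[OF G(1)]) (simp add: F_def)
  then have "singular_simplex 3 X F" by (simp add: singular_simplex_def F_def)
  moreover have "singular_face 3 i F = f i" if i: "i \<le> 3" "i \<noteq> j" for i
  proof
    fix w
    show "singular_face 3 i F w = f i w"
    proof (cases "w \<in> standard_simplex 2")
      case True
      define x where "x = simplical_face i w"
      have x: "x \<in> standard_simplex 3"
        using simplical_face_in_standard_simplex[of 3 i w] True i by (simp add: x_def)
      have xi: "x i = 0" by (simp add: x_def simplical_face_def)
      have xT: "x \<in> T i" using x xi by (auto simp: T_def standard_simplex_def)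
      have "horn_retraction j i x = x"
        using xi x by (auto simp: horn_retraction_def standard_simplex_def)
      then have "G x = f i w"
        using G(2)[of i x] xT x i by (simp add: I g_def x_def drop_coord_simplical_face)
      then show ?thesis using True x by (simp add: singular_face_def F_def x_def)
    next
      case False
      then show ?thesis using f[OF i] by (simp add: singular_face_def singular_simplex_def extensional_def)
    qed
  qed
  ultimately show ?thesis by blast
qed

lemma singular_face_singular_face:
  assumes "i < k" "k \<le> Suc p" "p > 0"
  shows "singular_face p i (singular_face (Suc p) k f) = singular_face p (k - 1) (singular_face (Suc p) i f)"
proof -
  have "simplical_face k (simplical_face i x) = simplical_face i (simplical_face (k - 1) x)" for x :: "nat \<Rightarrow> real"
  proof
    fix l
    show "simplical_face k (simplical_face i x) l = simplical_face i (simplical_face (k - 1) x) l"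
      using assms(1) by (auto simp: simplical_face_def)
  qed
  then show ?thesis
    using assms simplical_face_in_standard_simplex[of p i] simplical_face_in_standard_simplex[of p "k - 1"]
    by (intro ext) (auto simp: singular_face_def restrict_def)
qed

lemma chain_boundary_2:
  "chain_boundary 2 (frag_of s) =
     frag_of (singular_face 2 0 s) - frag_of (singular_face 2 1 s) + frag_of (singular_face 2 2 s)"
  by (simp add: chain_boundary_of numeral_2_eq_2)

lemma chain_boundary_3:
  "chain_boundary 3 (frag_of s) =
     frag_of (singular_face 3 0 s) - frag_of (singular_face 3 1 s) +
     frag_of (singular_face 3 2 s) - frag_of (singular_face 3 3 s)"
  by (simp add: chain_boundary_of numeral_3_eq_3 numeral_2_eq_2)

text \<open>
  A singular triangle with the edges \<open>a\<close>, \<open>b\<close> and \<open>c\<close> from vertex 0 to 1, 1 to 2 and 0 to 2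
  whose relative homology class is \<open>n\<close> times the class of \<open>d\<close>.
\<close>

definition triangle ::
  "'x topology \<Rightarrow> 'x set \<Rightarrow> 'x chain \<Rightarrow> int \<Rightarrow> ((nat \<Rightarrow> real) \<Rightarrow> 'x) \<Rightarrow>
   ((nat \<Rightarrow> real) \<Rightarrow> 'x) \<Rightarrow> ((nat \<Rightarrow> real) \<Rightarrow> 'x) \<Rightarrow> bool" where
  "triangle X K d n a b c \<longleftrightarrow>
     (\<exists>s. singular_simplex 2 X s \<and> singular_face 2 2 s = a \<and> singular_face 2 0 s = b \<and>
          singular_face 2 1 s = c \<and> singular_relboundary 2 X K (frag_of s - frag_cmul n d))"

lemma triangle_in_subset:
  assumes "singular_simplex 2 (subtopology X K) s"
    and "singular_face 2 2 s = a" "singular_face 2 0 s = b" "singular_face 2 1 s = c"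
  shows "triangle X K d 0 a b c"
  unfolding triangle_def using assms
  by (intro exI[of _ s]) (auto simp: singular_simplex_subtopology singular_chain_imp_relboundary singular_chain_of)

lemma relboundary_of_tetrahedron:
  assumes "singular_simplex 3 X F"
  shows "singular_relboundary 2 X K (frag_of (singular_face 3 0 F) - frag_of (singular_face 3 1 F) +
     frag_of (singular_face 3 2 F) - frag_of (singular_face 3 3 F))"
proof -
  have "singular_chain (Suc 2) X (frag_of F)" using assms by (simp add: singular_chain_of)
  moreover have "singular_chain 2 (subtopology X K) 0" by simp
  ultimately show ?thesis
    unfolding singular_relboundary chain_boundary_3[symmetric] by (metis add.right_neutral eval_nat_numeral(3))
qed

text \<open>In a tetrahedron with vertices 0 to 3 the edges 01, 12, 23, 02, 13, 03 are
  \<open>a\<close>, \<open>b\<close>, \<open>c\<close>, \<open>p\<close>, \<open>q\<close>,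
  \<open>s\<close>. The alternating sum of its faces is a boundary, so the degrees may be assigned
  with \<open>n0 - n1 + n2 - n3 = 0\<close>; here face 1 is missing.\<close>

lemma triangle_fill_1:
  assumes 3: "triangle X K d n3 a b p" and 0: "triangle X K d n0 b c q" and 2: "triangle X K d n2 a q s"
  shows "triangle X K d (n0 + n2 - n3) p c s"
proof -
  obtain f3 where f3: "singular_simplex 2 X f3" "singular_face 2 2 f3 = a" "singular_face 2 0 f3 = b"
     "singular_face 2 1 f3 = p" "singular_relboundary 2 X K (frag_of f3 - frag_cmul n3 d)"
    using 3 by (auto simp: triangle_def)
  obtain f0 where f0: "singular_simplex 2 X f0" "singular_face 2 2 f0 = b" "singular_face 2 0 f0 = c"
     "singular_face 2 1 f0 = q" "singular_relboundary 2 X K (frag_of f0 - frag_cmul n0 d)"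
    using 0 by (auto simp: triangle_def)
  obtain f2 where f2: "singular_simplex 2 X f2" "singular_face 2 2 f2 = a" "singular_face 2 0 f2 = q"
     "singular_face 2 1 f2 = s" "singular_relboundary 2 X K (frag_of f2 - frag_cmul n2 d)"
    using 2 by (auto simp: triangle_def)
  define f where "f i = (if i = 0 then f0 else if i = 2 then f2 else f3)" for i :: nat
  have "\<exists>F. singular_simplex 3 X F \<and> (\<forall>i\<le>3. i \<noteq> 1 \<longrightarrow> singular_face 3 i F = f i)"
  proof (rule horn_filler)
    fix i k :: nat assume "i < k" "k \<le> 3" "i \<noteq> 1" "k \<noteq> 1"
    then have "(i = 0 \<and> k = 2) \<or> (i = 0 \<and> k = 3) \<or> (i = 2 \<and> k = 3)" by auto
    then show "singular_face 2 i (f k) = singular_face 2 (k - 1) (f i)"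
      using f0 f2 f3 by (auto simp: f_def)
  qed (use f0 f2 f3 in \<open>auto simp: f_def\<close>)
  then obtain F where F: "singular_simplex 3 X F" "\<And>i. i \<le> 3 \<Longrightarrow> i \<noteq> 1 \<Longrightarrow> singular_face 3 i F = f i"
    by blast
  have faces: "singular_face 3 0 F = f0" "singular_face 3 2 F = f2" "singular_face 3 3 F = f3"
    using F(2)[of 0] F(2)[of 2] F(2)[of 3] by (auto simp: f_def)
  define f1 where "f1 = singular_face 3 1 F"
  have S: "Suc 2 = 3" by simp
  have 1: "singular_face 2 0 f1 = c" "singular_face 2 1 f1 = s" "singular_face 2 2 f1 = p"
    using singular_face_singular_face[of 0 1 2 F] singular_face_singular_face[of 1 2 2 F]
      singular_face_singular_face[of 1 3 2 F] faces f0 f2 f3 unfolding f1_def S by simp_all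
  have "singular_simplex 2 X f1"
    using singular_simplex_singular_face[OF F(1), of 1] by (simp add: f1_def numeral_3_eq_3 numeral_2_eq_2)
  moreover have "singular_relboundary 2 X K (frag_of f1 - frag_cmul (n0 + n2 - n3) d)"
  proof -
    have "singular_relboundary 2 X K (((frag_of f0 - frag_cmul n0 d) + (frag_of f2 - frag_cmul n2 d)
        - (frag_of f3 - frag_cmul n3 d)) - (frag_of f0 - frag_of f1 + frag_of f2 - frag_of f3))"
      (is "singular_relboundary 2 X K ?z")
      using singular_relboundary_diff[OF singular_relboundary_diff[OF singular_relboundary_add[OF f0(5) f2(5)]
          f3(5)] relboundary_of_tetrahedron[OF F(1), of K]] unfolding faces f1_def .
    also have "?z = frag_of f1 - frag_cmul (n0 + n2 - n3) d"
      by (rule poly_mapping_eqI) (simp add: lookup_add lookup_minus algebra_simps)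
    finally show ?thesis .
  qed
  ultimately show ?thesis unfolding triangle_def using 1 by blast
qed

text \<open>The same tetrahedron with face 2 missing: the relation of degrees is solved for
  \<open>n2\<close>.\<close>

lemma triangle_fill_2:
  assumes 3: "triangle X K d n3 a b p" and 0: "triangle X K d n0 b c q" and 1: "triangle X K d n1 p c s"
  shows "triangle X K d (n1 - n0 + n3) a q s"
proof -
  obtain f3 where f3: "singular_simplex 2 X f3" "singular_face 2 2 f3 = a" "singular_face 2 0 f3 = b"
     "singular_face 2 1 f3 = p" "singular_relboundary 2 X K (frag_of f3 - frag_cmul n3 d)"
    using 3 by (auto simp: triangle_def)
  obtain f0 where f0: "singular_simplex 2 X f0" "singular_face 2 2 f0 = b" "singular_face 2 0 f0 = c"
     "singular_face 2 1 f0 = q" "singular_relboundary 2 X K (frag_of f0 - frag_cmul n0 d)"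
    using 0 by (auto simp: triangle_def)
  obtain f1 where f1: "singular_simplex 2 X f1" "singular_face 2 2 f1 = p" "singular_face 2 0 f1 = c"
     "singular_face 2 1 f1 = s" "singular_relboundary 2 X K (frag_of f1 - frag_cmul n1 d)"
    using 1 by (auto simp: triangle_def)
  define f where "f i = (if i = 0 then f0 else if i = 1 then f1 else f3)" for i :: nat
  have "\<exists>F. singular_simplex 3 X F \<and> (\<forall>i\<le>3. i \<noteq> 2 \<longrightarrow> singular_face 3 i F = f i)"
  proof (rule horn_filler)
    fix i k :: nat assume "i < k" "k \<le> 3" "i \<noteq> 2" "k \<noteq> 2"
    then have "(i = 0 \<and> k = 1) \<or> (i = 0 \<and> k = 3) \<or> (i = 1 \<and> k = 3)" by auto
    then show "singular_face 2 i (f k) = singular_face 2 (k - 1) (f i)"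
      using f0 f1 f3 by (auto simp: f_def)
  qed (use f0 f1 f3 in \<open>auto simp: f_def\<close>)
  then obtain F where F: "singular_simplex 3 X F" "\<And>i. i \<le> 3 \<Longrightarrow> i \<noteq> 2 \<Longrightarrow> singular_face 3 i F = f i"
    by blast
  have faces: "singular_face 3 0 F = f0" "singular_face 3 1 F = f1" "singular_face 3 3 F = f3"
    using F(2)[of 0] F(2)[of 1] F(2)[of 3] by (auto simp: f_def)
  define f2 where "f2 = singular_face 3 2 F"
  have S: "Suc 2 = 3" by simp
  have 2: "singular_face 2 0 f2 = q" "singular_face 2 1 f2 = s" "singular_face 2 2 f2 = a"
    using singular_face_singular_face[of 0 2 2 F] singular_face_singular_face[of 1 2 2 F]
      singular_face_singular_face[of 2 3 2 F] faces f0 f1 f3 unfolding f2_def S by simp_all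
  have "singular_simplex 2 X f2"
    using singular_simplex_singular_face[OF F(1), of 2] by (simp add: f2_def numeral_3_eq_3 numeral_2_eq_2)
  moreover have "singular_relboundary 2 X K (frag_of f2 - frag_cmul (n1 - n0 + n3) d)"
  proof -
    have "singular_relboundary 2 X K ((frag_of f0 - frag_of f1 + frag_of f2 - frag_of f3) -
        (frag_of f0 - frag_cmul n0 d) + (frag_of f1 - frag_cmul n1 d) + (frag_of f3 - frag_cmul n3 d))"
      (is "singular_relboundary 2 X K ?z")
      using singular_relboundary_add[OF singular_relboundary_add[OF singular_relboundary_diff[OF
          relboundary_of_tetrahedron[OF F(1), of K] f0(5)] f1(5)] f3(5)] unfolding faces f2_def .
    also have "?z = frag_of f2 - frag_cmul (n1 - n0 + n3) d"
      by (rule poly_mapping_eqI) (simp add: lookup_add lookup_minus algebra_simps)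
    finally show ?thesis .
  qed
  ultimately show ?thesis unfolding triangle_def using 2 by blast
qed

section \<open>Real chains\<close>

abbreviation real_of_chain :: "'x chain \<Rightarrow> 'x real_chain" where
  "real_of_chain \<equiv> Poly_Mapping.map real_of_int"

lemma lookup_map_0: "f 0 = 0 \<Longrightarrow> Poly_Mapping.lookup (Poly_Mapping.map f c) x = f (Poly_Mapping.lookup c x)"
  by transfer (auto simp: when_def)

lemma real_of_chain_add: "real_of_chain (a + b) = real_of_chain a + real_of_chain b"
  by (rule poly_mapping_eqI) (simp add: lookup_map_0 lookup_add)

lemma real_of_chain_diff: "real_of_chain (a - b) = real_of_chain a - real_of_chain b"
  by (rule poly_mapping_eqI) (simp add: lookup_map_0 lookup_minus)

lemma real_of_chain_0: "real_of_chain 0 = 0"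
  by (rule poly_mapping_eqI) (simp add: lookup_map_0)

lemma real_of_chain_of: "real_of_chain (frag_of s) = Poly_Mapping.single s 1"
  by (rule poly_mapping_eqI) (simp add: lookup_map_0 lookup_single when_def)

lemma real_of_chain_sum: "real_of_chain (sum f I) = (\<Sum>i\<in>I. real_of_chain (f i))"
  by (induction I rule: infinite_finite_induct) (simp_all add: real_of_chain_add real_of_chain_0)

lemma real_of_chain_cmul_of: "real_of_chain (frag_cmul k (frag_of x)) = Poly_Mapping.single x (real_of_int k)"
  by (rule poly_mapping_eqI) (simp add: lookup_map_0 lookup_single when_def)

definition scale :: "real \<Rightarrow> 'x real_chain \<Rightarrow> 'x real_chain" where
  "scale k = Poly_Mapping.map (\<lambda>t. k * t)"

lemma lookup_scale: "Poly_Mapping.lookup (scale k z) x = k * Poly_Mapping.lookup z x"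
  by (simp add: scale_def lookup_map_0)

lemma keys_scale: "Poly_Mapping.keys (scale k z) \<subseteq> Poly_Mapping.keys z"
  by (auto simp: in_keys_iff lookup_scale)

lemma keys_real_of_chain: "Poly_Mapping.keys (real_of_chain c) = Poly_Mapping.keys c"
  by (auto simp: in_keys_iff lookup_map_0)

lemma l1_norm_eq:
  assumes "finite A" "Poly_Mapping.keys z \<subseteq> A"
  shows "l1_norm z = (\<Sum>x\<in>A. \<bar>Poly_Mapping.lookup z x\<bar>)"
  unfolding l1_norm_def by (rule sum.mono_neutral_left) (use assms in \<open>auto simp: in_keys_iff\<close>)

lemma l1_norm_add: "l1_norm (y + z) \<le> l1_norm y + l1_norm z"
proof -
  let ?A = "Poly_Mapping.keys y \<union> Poly_Mapping.keys z"
  have "l1_norm (y + z) = (\<Sum>x\<in>?A. \<bar>Poly_Mapping.lookup (y + z) x\<bar>)"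
    by (rule l1_norm_eq) (use Poly_Mapping.keys_add[of y z] in auto)
  also have "\<dots> \<le> (\<Sum>x\<in>?A. \<bar>Poly_Mapping.lookup y x\<bar> + \<bar>Poly_Mapping.lookup z x\<bar>)"
    by (intro sum_mono) (simp add: lookup_add)
  also have "\<dots> = l1_norm y + l1_norm z"
    by (simp add: sum.distrib l1_norm_eq[of ?A y] l1_norm_eq[of ?A z])
  finally show ?thesis .
qed

lemma l1_norm_scale: "l1_norm (scale k z) = \<bar>k\<bar> * l1_norm z"
  using l1_norm_eq[of "Poly_Mapping.keys z" "scale k z"] keys_scale[of k z]
  by (simp add: lookup_scale abs_mult sum_distrib_left l1_norm_def)

lemma scale_minus_one: "scale (- 1) z = - z"
  by (rule poly_mapping_eqI) (simp add: lookup_scale lookup_uminus)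

lemma l1_norm_diff: "l1_norm (y - z) \<le> l1_norm y + l1_norm z"
  using l1_norm_add[of y "- z"] l1_norm_scale[of "- 1" z] by (simp add: scale_minus_one)

lemma l1_norm_single: "l1_norm (Poly_Mapping.single s k) = \<bar>k\<bar>"
  using l1_norm_eq[of "{s}" "Poly_Mapping.single s k"] by (simp add: keys_single lookup_single)

lemma l1_norm_nonneg: "0 \<le> l1_norm z"
  unfolding l1_norm_def by (intro sum_nonneg) simp

text \<open>Replacing the support by a fixed finite superset makes the boundary visibly linear in
  \<open>z\<close>.\<close>

lemma real_chain_boundary_eq:
  assumes "finite A" "Poly_Mapping.keys z \<subseteq> A" "p > 0"
  shows "real_chain_boundary p z =
    (\<Sum>s\<in>A. \<Sum>k\<le>p. Poly_Mapping.single (singular_face p k s) ((-1) ^ k * Poly_Mapping.lookup z s))"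
  unfolding real_chain_boundary_def using assms
  by (auto intro!: sum.mono_neutral_left simp: in_keys_iff)

lemma real_chain_boundary_add:
  "real_chain_boundary p (y + z) = real_chain_boundary p y + real_chain_boundary p z"
proof (cases "p = 0")
  case False
  let ?A = "Poly_Mapping.keys y \<union> Poly_Mapping.keys z"
  show ?thesis
    using False Poly_Mapping.keys_add[of y z]
    by (simp add: real_chain_boundary_eq[of ?A] lookup_add distrib_left single_add sum.distrib)
qed (simp add: real_chain_boundary_def)

lemma scale_single: "scale k (Poly_Mapping.single x t) = Poly_Mapping.single x (k * t)"
  by (rule poly_mapping_eqI) (simp add: lookup_scale lookup_single when_def)

lemma scale_add: "scale k (y + z) = scale k y + scale k z"
  by (rule poly_mapping_eqI) (simp add: lookup_scale lookup_add distrib_left)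

lemma scale_0: "scale k 0 = 0"
  by (rule poly_mapping_eqI) (simp add: lookup_scale)

lemma scale_sum: "scale k (sum f A) = (\<Sum>x\<in>A. scale k (f x))"
  by (induction A rule: infinite_finite_induct) (simp_all add: scale_add scale_0)

lemma real_chain_boundary_scale: "real_chain_boundary p (scale k z) = scale k (real_chain_boundary p z)"
proof (cases "p = 0")
  case False
  show ?thesis
    using False keys_scale[of k z]
    by (simp add: real_chain_boundary_eq[of "Poly_Mapping.keys z"] lookup_scale scale_sum scale_single
        mult.left_commute)
qed (simp add: real_chain_boundary_def scale_0)

lemma real_chain_boundary_of_chain:
  "real_chain_boundary p (real_of_chain c) = real_of_chain (chain_boundary p c)"
proof (cases "p = 0")
  case False
  have single: "real_chain_boundary p (real_of_chain (frag_of s)) = real_of_chain (chain_boundary p (frag_of s))" for s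
  proof -
    show ?thesis
      using False unfolding real_of_chain_of
      by (simp add: real_chain_boundary_eq[of "{s}"] keys_single lookup_single chain_boundary_of real_of_chain_sum real_of_chain_cmul_of)
  qed
  show ?thesis
  proof (rule frag_induction[of c UNIV])
    show "real_chain_boundary p (real_of_chain (a - b)) = real_of_chain (chain_boundary p (a - b))"
      if "real_chain_boundary p (real_of_chain a) = real_of_chain (chain_boundary p a)"
        "real_chain_boundary p (real_of_chain b) = real_of_chain (chain_boundary p b)" for a b :: "'b chain"
    proof -
      have "real_chain_boundary p (- z) = - real_chain_boundary p z" for z :: "'b real_chain"
        using real_chain_boundary_scale[of p "- 1" z] by (simp add: scale_minus_one)
      then have "real_chain_boundary p (y - z) = real_chain_boundary p y - real_chain_boundary p z" for y z :: "'b real_chain"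
        using real_chain_boundary_add[of p y "- z"] by simp
      then show ?thesis using that by (simp add: real_of_chain_diff chain_boundary_diff)
    qed
  qed (use single in \<open>auto simp: real_of_chain_0 real_chain_boundary_def\<close>)
qed (simp add: real_chain_boundary_def chain_boundary_def real_of_chain_0)

lemma l1_norm_sum: "l1_norm (\<Sum>x\<in>A. f x) \<le> (\<Sum>x\<in>A. l1_norm (f x))"
proof (induction A rule: infinite_finite_induct)
  case (insert x A)
  then show ?case using l1_norm_add[of "f x" "\<Sum>x\<in>A. f x"] by simp
qed (simp_all add: l1_norm_def)

text \<open>Distinct simplices may acquire the same image; then their coefficients are added, and
  absolute values do not grow in total.\<close>

lemma l1_norm_chain_map: "l1_norm (real_of_chain (chain_map p g c)) \<le> l1_norm (real_of_chain c)"
proof -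
  have "real_of_chain (chain_map p g c) =
      (\<Sum>s\<in>Poly_Mapping.keys c. Poly_Mapping.single (simplex_map p g s) (real_of_int (Poly_Mapping.lookup c s)))"
    by (simp add: chain_map_def frag_extend_def real_of_chain_sum real_of_chain_cmul_of)
  also have "l1_norm \<dots> \<le> (\<Sum>s\<in>Poly_Mapping.keys c. l1_norm
      (Poly_Mapping.single (simplex_map p g s) (real_of_int (Poly_Mapping.lookup c s))))"
    by (rule l1_norm_sum)
  also have "\<dots> = l1_norm (real_of_chain c)"
    unfolding l1_norm_single by (simp add: l1_norm_def keys_real_of_chain lookup_map_0)
  finally show ?thesis .
qed

section \<open>Paths and discs in the presentation complex\<close>

lemma edge_map_in_skeleton: "s \<in> S \<Longrightarrow> edge_map s t \<in> pres_skeleton1 S"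
  by (auto simp: edge_map_def pres_skeleton1_def)

lemma attaching_loop_index:
  assumes "r \<noteq> []"
  shows "nat \<lfloor>real (length r) * Arg2pi z / (2 * pi)\<rfloor> < length r"
proof -
  have "Arg2pi z / (2 * pi) < 1" using Arg2pi_lt_2pi[of z] by simp
  then have "real (length r) * (Arg2pi z / (2 * pi)) < real (length r) * 1"
    using assms by (intro mult_strict_left_mono) auto
  moreover have "0 \<le> real (length r) * Arg2pi z / (2 * pi)" using Arg2pi_ge_0[of z] by simp
  ultimately show ?thesis by (simp add: nat_less_iff floor_less_iff)
qed

lemma attaching_loop_in_skeleton:
  assumes "r \<noteq> []" "fst ` set r \<subseteq> S"
  shows "attaching_loop r z \<in> pres_skeleton1 S"
proof -
  have "fst (r ! nat \<lfloor>real (length r) * Arg2pi z / (2 * pi)\<rfloor>) \<in> S"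
    using assms(2) nth_mem[OF attaching_loop_index[OF assms(1), of z]] by blast
  then show ?thesis unfolding attaching_loop_def Let_def by (rule edge_map_in_skeleton)
qed

lemma face_map_in_points:
  assumes "r \<noteq> []" "fst ` set r \<subseteq> S"
  shows "face_map r z \<in> pres_points S"
  using attaching_loop_in_skeleton[OF assms] by (auto simp: face_map_def pres_points_def)

lemma skeleton_subset_points: "pres_skeleton1 S \<subseteq> pres_points S"
  by (simp add: pres_points_def)

lemma topspace_pres_complex:
  assumes "r \<noteq> []" "fst ` set r \<subseteq> S"
  shows "topspace (pres_complex S r) = pres_points S"
proof
  show "topspace (pres_complex S r) \<subseteq> pres_points S"
    unfolding topspace_def by (auto simp: openin_pres_complex pres_open_def)
  have "pres_open S r (pres_points S)"
    unfolding pres_open_def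
  proof (intro conjI ballI)
    fix s assume "s \<in> S"
    then have "{t \<in> {0..1}. edge_map s t \<in> pres_points S} = {0..1}"
      using subsetD[OF skeleton_subset_points edge_map_in_skeleton] by auto
    then show "openin (top_of_set {0..1}) {t \<in> {0..1}. edge_map s t \<in> pres_points S}" by simp
  next
    have "{z \<in> cball 0 1. face_map r z \<in> pres_points S} = cball 0 1"
      using face_map_in_points[OF assms] by blast
    then show "openin (top_of_set (cball 0 1)) {z \<in> cball 0 1. face_map r z \<in> pres_points S}" by simp
  qed simp
  then show "pres_points S \<subseteq> topspace (pres_complex S r)"
    by (auto simp: topspace_def openin_pres_complex)
qed

lemma continuous_map_face_map:
  assumes "r \<noteq> []" "fst ` set r \<subseteq> S"
  shows "continuous_map (top_of_set (cball 0 1)) (pres_complex S r) (face_map r)"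
  unfolding continuous_map_def
  using face_map_in_points[OF assms]
  by (auto simp: topspace_pres_complex[OF assms] openin_pres_complex pres_open_def)

text \<open>Outside the unit interval \<open>edge_map s\<close> rests at the vertex, so it factors
  through clamping to \<open>{0..1}\<close>.\<close>

lemma continuous_map_edge_map:
  assumes r: "r \<noteq> []" "fst ` set r \<subseteq> S" and s: "s \<in> S"
  shows "continuous_map euclideanreal (pres_complex S r) (edge_map s)"
proof -
  have 1: "continuous_map (top_of_set {0..1}) (pres_complex S r) (edge_map s)"
    unfolding continuous_map_def
    using edge_map_in_skeleton[OF s] skeleton_subset_points s
    by (auto simp: topspace_pres_complex[OF r] openin_pres_complex pres_open_def)
  have 2: "continuous_map euclideanreal (top_of_set {0..1}) (\<lambda>t. max 0 (min 1 t))"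
    by (auto simp: continuous_map_in_subtopology intro!: continuous_intros)
  have "edge_map s \<circ> (\<lambda>t. max 0 (min 1 t)) = edge_map s"
    by (rule ext) (auto simp: edge_map_def max_def min_def)
  then show ?thesis using continuous_map_compose[OF 2 1] by simp
qed

definition letter_map :: "'a \<times> bool \<Rightarrow> real \<Rightarrow> 'a pres_point" where
  "letter_map x t = edge_map (fst x) (if snd x then t else 1 - t)"

text \<open>Each letter takes one unit of time, and the path rests at the vertex before 0 and after
  \<open>length u\<close>. Being defined on the whole line, it can be composed with any affine
  function on a simplex.\<close>

primrec word_path :: "'a word \<Rightarrow> real \<Rightarrow> 'a pres_point" where
  "word_path [] t = Vertex"
| "word_path (x # u) t = (if t \<le> 1 then letter_map x t else word_path u (t - 1))"

lemma letter_map_Vertex: "t \<le> 0 \<or> 1 \<le> t \<Longrightarrow> letter_map x t = Vertex"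
  by (auto simp: letter_map_def edge_map_def)

lemma letter_map_flip: "letter_map (flip x) t = letter_map x (1 - t)"
  by (simp add: letter_map_def flip_def)

lemma word_path_le_0: "t \<le> 0 \<Longrightarrow> word_path u t = Vertex"
  by (cases u) (auto simp: letter_map_Vertex)

lemma word_path_ge_length: "real (length u) \<le> t \<Longrightarrow> word_path u t = Vertex"
  by (induction u arbitrary: t) (auto simp: letter_map_Vertex)

lemma word_path_in_skeleton: "fst ` set u \<subseteq> S \<Longrightarrow> word_path u t \<in> pres_skeleton1 S"
proof (induction u arbitrary: t)
  case Nil
  then show ?case by (simp add: pres_skeleton1_def)
next
  case (Cons x u)
  then show ?case by (auto simp: letter_map_def edge_map_in_skeleton)
qed

lemma continuous_map_letter_map:
  assumes "continuous_map euclideanreal X (edge_map (fst x))"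
  shows "continuous_map euclideanreal X (letter_map x)"
proof -
  have "continuous_map euclideanreal euclideanreal (\<lambda>t. 1 - t)" by (intro continuous_intros) simp
  note e' = continuous_map_compose[OF this assms]
  have "letter_map x = (if snd x then edge_map (fst x) else edge_map (fst x) \<circ> (\<lambda>t. 1 - t))"
    by (rule ext) (simp add: letter_map_def)
  then show ?thesis using assms e' by simp
qed

lemma continuous_map_word_path:
  assumes edge: "\<And>s. s \<in> S \<Longrightarrow> continuous_map euclideanreal X (edge_map s)"
    and V: "Vertex \<in> topspace X"
  shows "fst ` set u \<subseteq> S \<Longrightarrow> continuous_map euclideanreal X (word_path u)"
proof (induction u)
  case Nil
  show ?case using V by simp
next
  case (Cons x u)
  then have x: "fst x \<in> S" and u: "continuous_map euclideanreal X (word_path u)" by auto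
  have "continuous_map euclideanreal euclideanreal (\<lambda>t. t - 1)" by (intro continuous_intros) simp
  from continuous_map_compose[OF this u]
  have u': "continuous_map euclideanreal X (\<lambda>t. word_path u (t - 1))"
    by (simp add: comp_def)
  have "continuous_map euclideanreal X
      (\<lambda>t. if t \<le> 1 then letter_map x t else word_path u (t - 1))"
    by (rule continuous_map_cases_le)
      (auto intro: continuous_map_from_subtopology continuous_map_letter_map[OF edge[OF x]] u'
        simp: letter_map_Vertex word_path_le_0)
  then show ?case by simp
qed

lemma continuous_map_word_path_pres:
  assumes r: "r \<noteq> []" "fst ` set r \<subseteq> S" and u: "fst ` set u \<subseteq> S"
  shows "continuous_map euclideanreal (pres_complex S r) (word_path u)"
  by (rule continuous_map_word_path[OF continuous_map_edge_map[OF r] _ u])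
    (simp_all add: topspace_pres_complex[OF r] pres_points_def pres_skeleton1_def)

lemma word_path_eq:
  assumes "0 \<le> t" "t < real (length u)"
  shows "word_path u t =
    edge_map (fst (u ! nat \<lfloor>t\<rfloor>)) (if snd (u ! nat \<lfloor>t\<rfloor>) then frac t else 1 - frac t)"
  using assms
proof (induction u arbitrary: t)
  case (Cons x u)
  consider "t < 1" | "t = 1" | "t > 1" by linarith
  then show ?case
  proof cases
    case 1
    then have "\<lfloor>t\<rfloor> = 0" "frac t = t" using Cons.prems by (auto simp: frac_eq floor_eq_iff)
    then show ?thesis using 1 by (simp add: letter_map_def)
  next
    case 2
    then show ?thesis by (simp add: letter_map_Vertex edge_map_def)
  next
    case 3
    have "nat \<lfloor>t\<rfloor> = Suc (nat \<lfloor>t - 1\<rfloor>)" using 3 by (simp add: nat_eq_iff)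
    moreover have "frac t = frac (t - 1)" using frac_1_eq[of "t - 1"] by simp
    ultimately show ?thesis using Cons.IH[of "t - 1"] Cons.prems 3 by simp
  qed
qed simp

text \<open>At \<open>t = 1\<close> the angle jumps back to 0; this is harmless because the path
  starts and ends at the vertex.\<close>

lemma attaching_loop_cis:
  assumes "r \<noteq> []" "0 \<le> t" "t \<le> 1"
  shows "attaching_loop r (cis (2 * pi * t)) = word_path r (real (length r) * t)"
proof (cases "t = 1")
  case True
  have "Arg2pi 1 = 0" by (rule Arg2pi_unique[of 1]) auto
  with True show ?thesis
    by (simp add: attaching_loop_def Let_def edge_map_def word_path_ge_length)
next
  case False
  have "Arg2pi (exp (\<i> * of_real (2 * pi * t))) = 2 * pi * t"
    using assms False by (intro Arg2pi_unique[of 1]) auto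
  then have "Arg2pi (cis (2 * pi * t)) = 2 * pi * t" by (simp add: cis_conv_exp)
  then have u: "real (length r) * Arg2pi (cis (2 * pi * t)) / (2 * pi) = real (length r) * t" by simp
  have "real (length r) * t < real (length r)" using assms False by simp
  then show ?thesis
    unfolding attaching_loop_def Let_def u using assms by (intro word_path_eq[symmetric]) auto
qed

definition word_simplex :: "'a word \<Rightarrow> (nat \<Rightarrow> real) \<Rightarrow> 'a pres_point" where
  "word_simplex u = restrict (\<lambda>x. word_path u (real (length u) * x 1)) (standard_simplex 1)"

lemma standard_simplex_1D:
  assumes "y \<in> standard_simplex 1"
  shows "y 0 = 1 - y 1" "0 \<le> y 1" "y 1 \<le> 1"
  using assms by (auto simp: standard_simplex_def)

lemma simplical_face_simps:
  "simplical_face 2 y (Suc 0) = y (Suc 0)" "simplical_face 2 y 2 = 0"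
  "simplical_face 0 y (Suc 0) = y 0" "simplical_face 0 y 2 = y (Suc 0)"
  "simplical_face (Suc 0) y (Suc 0) = 0" "simplical_face (Suc 0) y 2 = y (Suc 0)"
  for y :: "nat \<Rightarrow> real"
  by (auto simp: simplical_face_def)

lemma singular_face_2I:
  assumes "k \<le> 2" "\<And>y. y \<in> standard_simplex 1 \<Longrightarrow> g (simplical_face k y) = f y"
  shows "singular_face 2 k (restrict g (standard_simplex 2)) = restrict f (standard_simplex 1)"
  using assms simplical_face_in_standard_simplex[of 2 k] by (intro ext) (auto simp: singular_face_def)

lemma singular_simplex_restrict:
  assumes "continuous_map (simplex_top p) X f"
  shows "singular_simplex p X (restrict f (standard_simplex p))"
  unfolding singular_simplex_def
  by (intro conjI continuous_map_eq[OF assms]) auto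

section \<open>Multiplication of words by triangles in the graph\<close>

context
  fixes S :: "'a set" and r :: "'a word" and d :: "'a pres_point chain"
  assumes r: "r \<noteq> []" "fst ` set r \<subseteq> S"
begin

abbreviation (input) tri where
  "tri \<equiv> triangle (pres_complex S r) (pres_skeleton1 S) d"

text \<open>A triangle that factors through a path in the graph has degree 0. The applications
  differ only in the linear time function \<open>c\<close>, which is determined by its values at the
  three vertices.\<close>

lemma triangle_along_word_path:
  assumes u: "fst ` set u \<subseteq> S" and c: "continuous_map (simplex_top 2) euclideanreal c"
    and "\<And>y. y \<in> standard_simplex 1 \<Longrightarrow> word_path u (c (simplical_face 2 y)) = f2 y"
    and "\<And>y. y \<in> standard_simplex 1 \<Longrightarrow> word_path u (c (simplical_face 0 y)) = f0 y"
    and "\<And>y. y \<in> standard_simplex 1 \<Longrightarrow> word_path u (c (simplical_face 1 y)) = f1 y"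
  shows "tri 0 (restrict f2 (standard_simplex 1)) (restrict f0 (standard_simplex 1)) (restrict f1 (standard_simplex 1))"
proof (rule triangle_in_subset)
  define s where "s = restrict (\<lambda>x. word_path u (c x)) (standard_simplex 2)"
  have "continuous_map (simplex_top 2) (pres_complex S r) (\<lambda>x. word_path u (c x))"
    using continuous_map_compose[OF c continuous_map_word_path_pres[OF r u]] by (simp add: comp_def)
  then have "singular_simplex 2 (pres_complex S r) s"
    unfolding s_def by (rule singular_simplex_restrict)
  then show "singular_simplex 2 (subtopology (pres_complex S r) (pres_skeleton1 S)) s"
    using word_path_in_skeleton[OF u] by (auto simp: singular_simplex_subtopology s_def)
  show "singular_face 2 2 s = restrict f2 (standard_simplex 1)"
    "singular_face 2 0 s = restrict f0 (standard_simplex 1)"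
    "singular_face 2 1 s = restrict f1 (standard_simplex 1)"
    unfolding s_def by (rule singular_face_2I; use assms in simp)+
qed

lemma triangle_Cons:
  assumes "fst ` set (x # u) \<subseteq> S"
  shows "tri 0 (word_simplex [x]) (word_simplex u) (word_simplex (x # u))"
  unfolding word_simplex_def
\<comment> \<open>The vertices 0, 1, 2 are sent to the times 0, 1 and
  \<open>length u + 1\<close>.\<close>
proof (rule triangle_along_word_path[OF assms, where c = "\<lambda>t. t 1 + t 2 * (real (length u) + 1)"])
  show "continuous_map (simplex_top 2) euclideanreal (\<lambda>t. t 1 + t 2 * (real (length u) + 1))"
    by (intro continuous_intros continuous_map_coordinate) simp
  fix y assume "y \<in> standard_simplex 1"
  note y = standard_simplex_1D[OF this]
  show "word_path (x # u) (simplical_face 2 y 1 + simplical_face 2 y 2 * (real (length u) + 1)) =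
      word_path [x] (real (length [x]) * y 1)"
    using y by (simp add: simplical_face_simps)
  show "word_path (x # u) (simplical_face 1 y 1 + simplical_face 1 y 2 * (real (length u) + 1)) =
      word_path (x # u) (real (length (x # u)) * y 1)"
    by (simp add: simplical_face_simps mult.commute add.commute)
  have eq: "simplical_face 0 y 1 + simplical_face 0 y 2 * (real (length u) + 1) = 1 + real (length u) * y 1"
    using y by (simp add: simplical_face_simps algebra_simps)
  have "word_path (x # u) (1 + t) = word_path u t" if "t \<ge> 0" for t
    using that by (cases "t = 0") (auto simp: letter_map_Vertex word_path_le_0)
  then show "word_path (x # u) (simplical_face 0 y 1 + simplical_face 0 y 2 * (real (length u) + 1)) =
      word_path u (real (length u) * y 1)"
    unfolding eq using y by (simp del: word_path.simps)
qed

lemma triangle_cancel: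
  assumes "fst x \<in> S"
  shows "tri 0 (word_simplex [x]) (word_simplex [flip x]) (word_simplex [])"
  unfolding word_simplex_def
\<comment> \<open>With the times 0, 1, 0 the letter is read forwards and then backwards.\<close>
proof (rule triangle_along_word_path[where c = "\<lambda>t. t 1" and u = "[x]"])
  show "continuous_map (simplex_top 2) euclideanreal (\<lambda>t. t 1)" by (rule continuous_map_coordinate)
  fix y assume "y \<in> standard_simplex 1"
  note y = standard_simplex_1D[OF this]
  show "word_path [x] (simplical_face 2 y 1) = word_path [x] (real (length [x]) * y 1)"
    using y by (simp add: simplical_face_simps)
  show "word_path [x] (simplical_face 0 y 1) = word_path [flip x] (real (length [flip x]) * y 1)"
    using y by (simp add: simplical_face_simps letter_map_flip)
  show "word_path [x] (simplical_face 1 y 1) = word_path [] (real (length []) * y 1)"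
    by (simp add: simplical_face_simps letter_map_Vertex)
qed (use assms in auto)

lemma triangle_left_unit:
  assumes "fst ` set u \<subseteq> S"
  shows "tri 0 (word_simplex []) (word_simplex u) (word_simplex u)"
  unfolding word_simplex_def
proof (rule triangle_along_word_path[OF assms, where c = "\<lambda>t. real (length u) * t 2"])
  show "continuous_map (simplex_top 2) euclideanreal (\<lambda>t. real (length u) * t 2)"
    by (intro continuous_intros continuous_map_coordinate) simp
qed (auto simp: simplical_face_simps word_path_le_0)

lemma triangle_right_unit:
  assumes "fst ` set u \<subseteq> S"
  shows "tri 0 (word_simplex u) (word_simplex []) (word_simplex u)"
  unfolding word_simplex_def
proof (rule triangle_along_word_path[OF assms, where c = "\<lambda>t. real (length u) * (t 1 + t 2)"])
  show "continuous_map (simplex_top 2) euclideanreal (\<lambda>t. real (length u) * (t 1 + t 2))"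
    by (intro continuous_intros continuous_map_coordinate) simp
  fix y assume "y \<in> standard_simplex 1"
  note y = standard_simplex_1D[OF this]
  show "word_path u (real (length u) * (simplical_face 0 y 1 + simplical_face 0 y 2)) =
      word_path [] (real (length []) * y 1)"
    using y by (simp add: simplical_face_simps word_path_ge_length)
qed (auto simp: simplical_face_simps)

text \<open>If \<open>u = x^-1 u'\<close>, a tetrahedron with faces for the products
  \<open>x x^-1 = 1\<close>, \<open>x^-1 u' = u\<close> and \<open>1 u' = u'\<close> has the
  remaining face for \<open>x u = u'\<close>.\<close>

lemma triangle_push:
  assumes "fst x \<in> S" "fst ` set u \<subseteq> S"
  shows "tri 0 (word_simplex [x]) (word_simplex u) (word_simplex (push x u))"
proof (cases "u \<noteq> [] \<and> hd u = flip x")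
  case True
  then obtain u' where u: "u = flip x # u'" by (cases u) auto
  have "tri (0 - 0 + 0) (word_simplex [x]) (word_simplex u) (word_simplex u')"
    using assms triangle_fill_2[OF triangle_cancel triangle_Cons triangle_left_unit, of x u'] by (simp add: u)
  then show ?thesis by (simp add: u)
next
  case False
  then have "push x u = x # u" by (cases u) auto
  then show ?thesis using triangle_Cons[of x u] assms by simp
qed

text \<open>One triangle of degree 0 realises a product in the free group however much cancellation
  occurs: the intermediate triangles are absorbed by filling horns. This is why a commutator costs
  four triangles regardless of word lengths.\<close>

lemma triangle_mult:
  assumes "u \<in> carrier (free_group S)" "v \<in> carrier (free_group S)"
  shows "tri 0 (word_simplex u) (word_simplex v) (word_simplex (u \<otimes>\<^bsub>free_group S\<^esub> v))"
proof -
  have v: "fst ` set v \<subseteq> S" using assms by (simp add: free_group_def)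
  have "fst ` set u \<subseteq> S \<Longrightarrow> tri 0 (word_simplex u) (word_simplex v) (word_simplex (foldr push u v))"
  proof (induction u)
    case Nil
    then show ?case using triangle_left_unit[OF v] by simp
  next
    case (Cons x u)
    have uv: "fst ` set (foldr push u v) \<subseteq> S"
      using order_trans[OF set_foldr_push[of u v]] Cons.prems v by simp
    have "tri (0 + 0 - 0) (word_simplex (x # u)) (word_simplex v) (word_simplex (push x (foldr push u v)))"
      by (rule triangle_fill_1[OF triangle_Cons _ triangle_push]) (use Cons uv in auto)
    then show ?case by simp
  qed
  then show ?thesis using assms(1) by (simp add: free_group_def)
qed

text \<open>\<open>capped n w\<close> says that the loop \<open>w\<close> bounds a disc of degree \<open>n\<close>.\<close>

definition capped :: "int \<Rightarrow> 'a word \<Rightarrow> bool" where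
  "capped n w \<longleftrightarrow> tri n (word_simplex w) (word_simplex []) (word_simplex [])"

interpretation group "free_group S" by (rule group_free_group)

lemma capped_one: "capped 0 []"
  unfolding capped_def by (rule triangle_left_unit) simp

text \<open>Two discs become faces of one tetrahedron, and their degrees add up on a single
  triangle. The cap therefore contributes 1 to the norm whatever its degree.\<close>

lemma capped_mult:
  assumes "u \<in> carrier (free_group S)" "v \<in> carrier (free_group S)" "capped m u" "capped n v"
  shows "capped (m + n) (u \<otimes>\<^bsub>free_group S\<^esub> v)"
  using triangle_fill_1[OF triangle_mult[OF assms(1,2)] assms(4)[unfolded capped_def]
      assms(3)[unfolded capped_def]] by (simp add: capped_def add.commute)

text \<open>Three tetrahedra turn the disc bounded by \<open>w\<close> into triangles of degree
  \<open>n\<close> with the edges \<open>(h w, 1, h)\<close>, then \<open>(h w, h^-1, 1)\<close>,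
  and finally \<open>(h w h^-1, 1, 1)\<close>.\<close>

lemma capped_conj:
  assumes h: "h \<in> carrier (free_group S)" and w: "w \<in> carrier (free_group S)" and "capped n w"
  shows "capped n (h \<otimes>\<^bsub>free_group S\<^esub> w \<otimes>\<^bsub>free_group S\<^esub> inv\<^bsub>free_group S\<^esub> h)"
proof -
  define g where "g = inv\<^bsub>free_group S\<^esub> h"
  define hw where "hw = h \<otimes>\<^bsub>free_group S\<^esub> w"
  have g: "g \<in> carrier (free_group S)" "hw \<in> carrier (free_group S)" using h w by (simp_all add: g_def hw_def)
  have sub: "fst ` set u \<subseteq> S" if "u \<in> carrier (free_group S)" for u
    using that by (simp add: free_group_def)
  have hg: "tri 0 (word_simplex h) (word_simplex g) (word_simplex [])"
    using triangle_mult[OF h g(1)] h by (simp add: g_def) (simp add: free_group_def)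
  have "tri (n + 0 - 0) (word_simplex hw) (word_simplex []) (word_simplex h)"
    unfolding hw_def
    by (rule triangle_fill_1[OF triangle_mult[OF h w] assms(3)[unfolded capped_def] triangle_right_unit[OF sub[OF h]]])
  from triangle_fill_2[OF this triangle_left_unit[OF sub[OF g(1)]] hg]
  have 1: "tri (0 - 0 + (n + 0 - 0)) (word_simplex hw) (word_simplex g) (word_simplex [])" .
  have "tri (0 + (0 - 0 + (n + 0 - 0)) - 0) (word_simplex (hw \<otimes>\<^bsub>free_group S\<^esub> g)) (word_simplex []) (word_simplex [])"
    by (rule triangle_fill_1[OF triangle_mult[OF g(2,1)] triangle_right_unit[OF sub[OF g(1)]] 1])
  then show ?thesis by (simp add: capped_def hw_def g_def)
qed

end

section \<open>The class of the 2-cell\<close>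

lemma trivial_homology_group_contractible:
  assumes "contractible_space X" "p \<noteq> 0"
  shows "trivial_group (homology_group p X)"
  using trivial_reduced_homology_group_contractible_space[OF assms(1), of p] un_reduced_homology_group[OF assms(2), of X]
  by simp

lemma cycle_bounds_if_trivial:
  assumes "trivial_group (homology_group (int p) X)" "singular_relcycle p X {} c"
  shows "singular_relboundary p X {} c"
proof -
  have "homologous_rel_set p X {} c \<in> carrier (homology_group (int p) X)"
    using assms(2) by (auto simp: carrier_relative_homology_group)
  then have "homologous_rel_set p X {} c = singular_relboundary_set p X {}"
    using assms(1) by (simp add: trivial_group_def)
  then show ?thesis by (simp add: homologous_rel_set_eq_relboundary)
qed

text \<open>Injectivity of \<open>H\<^sub>p X \<rightarrow> H\<^sub>p (X, A)\<close> if \<open>H\<^sub>p A\<close> vanishes, on the level of chains.\<close>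

lemma relboundary_absolute:
  assumes "trivial_group (homology_group (int p) (subtopology X A))"
    and y: "singular_relcycle p X {} y" "singular_relboundary p X A y" and p: "p > 0"
  shows "singular_relboundary p X {} y"
proof -
  obtain d e where d: "singular_chain (Suc p) X d" and e: "singular_chain p (subtopology X A) e"
      and eq: "chain_boundary (Suc p) d + e = y"
    using y(2) unfolding singular_relboundary by blast
  have "chain_boundary p e = chain_boundary p y - chain_boundary p (chain_boundary (Suc p) d)"
    by (simp flip: eq add: chain_boundary_add)
  also have "\<dots> = 0"
    using y(1) chain_boundary_boundary_alt[OF d] by (simp add: singular_cycle)
  finally have "singular_relcycle p (subtopology X A) {} e" using e by (simp add: singular_cycle)
  then have "singular_relboundary p (subtopology X A) {} e" by (rule cycle_bounds_if_trivial[OF assms(1)])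
  then obtain f where f: "singular_chain (Suc p) (subtopology X A) f" "chain_boundary (Suc p) f = e"
    by (auto simp: singular_boundary)
  have "singular_chain (Suc p) X (d + f)"
    using d f(1) by (intro singular_chain_add) (auto simp: singular_chain_subtopology)
  moreover have "chain_boundary (Suc p) (d + f) = y" using f(2) eq by (simp add: chain_boundary_add)
  ultimately show ?thesis by (auto simp: singular_boundary)
qed

text \<open>
  A map from the 2-simplex to the disc that wraps the edge opposite to vertex 2 once around the
  circle and is constant on the other two edges. The circle is contracted to the point 1 along
  straight lines while its parameter \<open>u\<close> is stretched, so that it stays in \<open>{0, 1}\<close> on the
  other two edges until the contraction is complete.
\<close>

definition disc_map :: "(nat \<Rightarrow> real) \<Rightarrow> complex" where
  "disc_map x =
     (let u = max 0 (min 1 (x 1 + x 2 / 2 + (x 1 + x 2 / 2 - 1 / 2) * (2 * x 2)));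
          l = max 0 (1 - 2 * x 2)
      in 1 + of_real l * (cis (2 * pi * u) - 1))"

definition disc_simplex :: "(nat \<Rightarrow> real) \<Rightarrow> complex" where
  "disc_simplex = restrict disc_map (standard_simplex 2)"

lemma disc_map_in_cball: "x \<in> standard_simplex 2 \<Longrightarrow> disc_map x \<in> cball 0 1"
proof -
  assume "x \<in> standard_simplex 2"
  then have x2: "0 \<le> x 2" by (simp add: standard_simplex_def)
  define l where "l = max 0 (1 - 2 * x 2)"
  have l: "0 \<le> l" "l \<le> 1" using x2 by (auto simp: l_def)
  obtain u where u: "disc_map x = 1 + of_real l * (cis u - 1)"
    unfolding disc_map_def Let_def l_def by blast
  also have "\<dots> = of_real (1 - l) + of_real l * cis u" by (simp add: algebra_simps)
  finally have "norm (disc_map x) \<le> norm (of_real (1 - l) :: complex) + norm (of_real l * cis u)"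
    by (metis norm_triangle_ineq)
  also have "\<dots> = 1" using l unfolding norm_of_real norm_mult norm_cis by simp
  finally show ?thesis by simp
qed

lemma continuous_map_compose_real:
  fixes g :: "real \<Rightarrow> 'b::topological_space"
  assumes "continuous_map X euclideanreal a" "continuous_on UNIV g"
  shows "continuous_map X euclidean (\<lambda>x. g (a x))"
  using continuous_map_compose[OF assms(1), of euclidean g] assms(2) by (simp add: comp_def)

lemma continuous_map_disc_map: "continuous_map (simplex_top 2) (top_of_set (cball 0 1)) disc_map"
proof -
  define u where "u x = max 0 (min 1 (x 1 + x 2 / 2 + (x 1 + x 2 / 2 - 1 / 2) * (2 * x 2)))" for x :: "nat \<Rightarrow> real"
  define l where "l x = max 0 (1 - 2 * x 2)" for x :: "nat \<Rightarrow> real"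
  have half: "continuous_map (simplex_top 2) euclideanreal (\<lambda>x. x 2 / 2)"
    using continuous_map_real_mult_right[OF continuous_map_coordinate[of 2 2], of "1/2"] by simp
  have u: "continuous_map (simplex_top 2) euclideanreal u"
    unfolding u_def by (intro continuous_intros continuous_map_coordinate half) simp_all
  have l: "continuous_map (simplex_top 2) euclideanreal l"
    unfolding l_def by (intro continuous_intros continuous_map_coordinate) simp_all
  have eq: "disc_map = (\<lambda>x. of_real (1 + l x * (cos (2 * pi * u x) - 1)) + \<i> * of_real (l x * sin (2 * pi * u x)))"
    by (rule ext) (simp add: disc_map_def Let_def l_def u_def complex_eq_iff)
  have "continuous_map (simplex_top 2) euclidean disc_map"
    unfolding eq
    by (intro continuous_map_add
          continuous_map_compose_real[where g = "\<lambda>t. of_real t :: complex"]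
          continuous_map_compose_real[where g = "\<lambda>t. \<i> * (of_real t :: complex)"]
          continuous_map_compose_real[where g = "\<lambda>t. cos (2 * pi * t)"]
          continuous_map_compose_real[where g = "\<lambda>t. sin (2 * pi * t)"]
          continuous_intros l u)
      (simp_all add: continuous_intros)
  then show ?thesis
    using disc_map_in_cball by (auto simp: continuous_map_in_subtopology)
qed

lemma disc_map_side:
  assumes "x \<in> standard_simplex 2" "x 0 = 0 \<or> x 1 = 0"
  shows "disc_map x = 1"
proof (cases "x 2 \<le> 1 / 2")
  case True
  have two: "{..2::nat} = {0, 1, 2}" by auto
  have x: "x 0 + x 1 + x 2 = 1" "0 \<le> x 2" using assms(1) by (auto simp: standard_simplex_def two)
  \<comment> \<open>With \<open>p = x 1 + x 2 / 2\<close> this is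
    \<open>1/2 + (p - 1/2) (1 + 2 * x 2)\<close>: the parameter \<open>p\<close> stretched about its
    midpoint, beyond \<open>{0..1}\<close> on the two sides.\<close>
  define v where "v = x 1 + x 2 / 2 + (x 1 + x 2 / 2 - 1 / 2) * (2 * x 2)"
  from assms(2) have "max 0 (min 1 v) \<in> {0, 1}"
  proof
    assume "x 0 = 0"
    then have x1: "x 1 = 1 - x 2" using x by simp
    have "v = 1 + x 2 * (1 / 2 - x 2)" unfolding v_def x1 by (simp add: field_simps)
    then show ?thesis using True x by simp
  next
    assume "x 1 = 0"
    then have "v = - (x 2 * (1 / 2 - x 2))" unfolding v_def by (simp add: algebra_simps)
    then have "v \<le> 0" using True x by (simp add: mult_nonneg_nonneg)
    then show ?thesis by simp
  qed
  then have "cis (2 * pi * max 0 (min 1 v)) = 1" by auto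
  then show ?thesis unfolding disc_map_def Let_def v_def by simp
next
  case False
  then show ?thesis by (simp add: disc_map_def Let_def)
qed

lemma disc_map_bottom: "0 \<le> x 1 \<Longrightarrow> x 1 \<le> 1 \<Longrightarrow> x 2 = 0 \<Longrightarrow> disc_map x = cis (2 * pi * x 1)"
  by (simp add: disc_map_def Let_def)

lemma disc_simplex_faces:
  "singular_face 2 2 disc_simplex = circle_simplex"
  "singular_face 2 0 disc_simplex = restrict (\<lambda>_. 1) (standard_simplex 1)"
  "singular_face 2 1 disc_simplex = restrict (\<lambda>_. 1) (standard_simplex 1)"
proof -
  have mem: "simplical_face k y \<in> standard_simplex 2" if "y \<in> standard_simplex 1" "k \<le> 2" for k y
    using simplical_face_in_standard_simplex[of 2 k y] that by simp
  have side: "disc_map (simplical_face k y) = 1" if "y \<in> standard_simplex 1" "k = 0 \<or> k = 1" for k y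
    by (rule disc_map_side[OF mem[OF that(1)]]) (use that(2) in \<open>auto simp: simplical_face_def\<close>)
  show "singular_face 2 2 disc_simplex = circle_simplex"
    unfolding disc_simplex_def circle_simplex_def
    by (rule singular_face_2I)
      (use standard_simplex_1D in \<open>auto simp: simplical_face_simps disc_map_bottom\<close>)
  show "singular_face 2 0 disc_simplex = restrict (\<lambda>_. 1) (standard_simplex 1)"
    unfolding disc_simplex_def
    by (rule singular_face_2I) (use side in auto)
  show "singular_face 2 1 disc_simplex = restrict (\<lambda>_. 1) (standard_simplex 1)"
    unfolding disc_simplex_def
    by (rule singular_face_2I) (use side in auto)
qed

lemma singular_simplex_disc: "singular_simplex 2 (top_of_set (cball 0 1)) disc_simplex"
  unfolding disc_simplex_def by (rule singular_simplex_restrict[OF continuous_map_disc_map])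

lemma chain_boundary_disc: "chain_boundary 2 (frag_of disc_simplex) = frag_of circle_simplex"
  unfolding chain_boundary_2 disc_simplex_faces by simp

lemma singular_simplex_circle: "singular_simplex 1 (subtopology (top_of_set (cball 0 1)) (sphere 0 1)) circle_simplex"
proof (rule iffD2[OF singular_simplex_subtopology], rule conjI)
  show "singular_simplex 1 (top_of_set (cball 0 1)) circle_simplex"
    using singular_simplex_singular_face[OF singular_simplex_disc, of 2]
    unfolding disc_simplex_faces by simp
qed (auto simp: circle_simplex_def)

lemma relcycle_disc: "singular_relcycle 2 (top_of_set (cball 0 1)) (sphere 0 1) (frag_of disc_simplex)"
  using singular_simplex_disc singular_simplex_circle
  by (simp add: singular_relcycle chain_boundary_disc singular_chain_of)

text \<open>The disc is contractible, so the boundary map from H_2 of the pair to H_1 of the circle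
  is injective and the characterisation of \<open>disc_class\<close> determines it. The boundary of
  the chosen simplex is the circle by construction.\<close>

lemma disc_class_eq:
  "disc_class = homologous_rel_set 2 (top_of_set (cball 0 1)) (sphere 0 1) (frag_of disc_simplex)"
proof -
  let ?D = "top_of_set (cball (0::complex) 1)" and ?S = "sphere (0::complex) 1"
  have hb: "hom_boundary 2 ?D ?S (homologous_rel_set 2 ?D ?S c) =
      homologous_rel_set 1 (subtopology ?D ?S) {} (chain_boundary 2 c)"
    if "singular_relcycle 2 ?D ?S c" for c
    using hom_boundary_chain_boundary[OF that] by simp
  have car: "carrier (relative_homology_group 2 ?D ?S) = homologous_rel_set 2 ?D ?S ` singular_relcycle_set 2 ?D ?S"
    using carrier_relative_homology_group[of 2 ?D ?S] by simp
  have contr: "trivial_group (homology_group (int 2) ?D)"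
    by (rule trivial_homology_group_contractible) (simp_all add: convex_imp_contractible)
  show ?thesis
    unfolding disc_class_def Let_def
  proof (rule the_equality)
    show "homologous_rel_set 2 ?D ?S (frag_of disc_simplex) \<in> carrier (relative_homology_group 2 ?D ?S) \<and>
      hom_boundary 2 ?D ?S (homologous_rel_set 2 ?D ?S (frag_of disc_simplex)) =
      homologous_rel_set 1 (subtopology ?D ?S) {} (frag_of circle_simplex)"
      using relcycle_disc hb[OF relcycle_disc] by (auto simp: car chain_boundary_disc)
  next
    fix g
    assume g: "g \<in> carrier (relative_homology_group 2 ?D ?S) \<and>
      hom_boundary 2 ?D ?S g = homologous_rel_set 1 (subtopology ?D ?S) {} (frag_of circle_simplex)"
    then obtain c where c: "singular_relcycle 2 ?D ?S c" "g = homologous_rel_set 2 ?D ?S c"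
      unfolding car by blast
    have "homologous_rel 1 (subtopology ?D ?S) {} (chain_boundary 2 c) (frag_of circle_simplex)"
      using g hb[OF c(1)] c(2) by (simp flip: homologous_rel_set_eq)
    then obtain e where e: "singular_chain 2 (subtopology ?D ?S) e"
        "chain_boundary 2 e = chain_boundary 2 c - frag_of circle_simplex"
      by (auto simp: homologous_rel_def singular_boundary numeral_2_eq_2)
    have e': "singular_chain 2 ?D e" using e(1) by (simp add: singular_chain_subtopology)
    define z where "z = c - frag_of disc_simplex - e"
    have "singular_chain 2 ?D z"
      unfolding z_def using c(1) e' singular_simplex_disc
      by (intro singular_chain_diff) (auto simp: singular_relcycle singular_chain_of)
    moreover have "chain_boundary 2 z = 0"
      by (simp add: z_def chain_boundary_diff chain_boundary_disc e(2))
    ultimately have "singular_relboundary 2 ?D {} z"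
      by (intro cycle_bounds_if_trivial[OF contr]) (simp add: singular_cycle)
    then obtain f where "singular_chain (Suc 2) ?D f" "chain_boundary (Suc 2) f = z"
      by (auto simp: singular_boundary)
    then have "singular_relboundary 2 ?D ?S (z + e)"
      unfolding singular_relboundary using e(1) by blast
    then have "homologous_rel 2 ?D ?S c (frag_of disc_simplex)"
      by (simp add: homologous_rel_def z_def)
    then show "g = homologous_rel_set 2 ?D ?S (frag_of disc_simplex)"
      by (simp add: c(2) homologous_rel_set_eq)
  qed
qed

section \<open>Cycles from surfaces\<close>

context
  fixes S :: "'a set" and r :: "'a word"
  assumes r: "r \<noteq> []" "fst ` set r \<subseteq> S"
begin

abbreviation (input) cell :: "(nat \<Rightarrow> real) \<Rightarrow> 'a pres_point" where
  "cell \<equiv> simplex_map 2 (face_map r) disc_simplex"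

abbreviation (input) P where "P \<equiv> pres_complex S r"
abbreviation (input) K where "K \<equiv> pres_skeleton1 S"

lemma triangle_cell:
  "triangle P K (frag_of cell) 1 (word_simplex r) (word_simplex []) (word_simplex [])"
  unfolding triangle_def
proof (intro exI[of _ cell] conjI)
  show "singular_simplex 2 P cell"
    by (rule singular_simplex_simplex_map[OF singular_simplex_disc continuous_map_face_map[OF r]])
  have face: "singular_face 2 k cell = simplex_map 1 (face_map r) (singular_face 2 k disc_simplex)" if "k \<le> 2" for k
    using that singular_face_simplex_map[of 2 k "face_map r" disc_simplex]
    by (auto simp: simplex_map_def singular_face_def)
  have V: "face_map r 1 = Vertex"
    using attaching_loop_cis[OF r(1), of 0] by (simp add: face_map_def word_path_le_0)
  have one: "simplex_map 1 (face_map r) (restrict (\<lambda>_. 1) (standard_simplex 1)) = word_simplex []"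
    by (rule ext) (simp add: simplex_map_def word_simplex_def V)
  have two: "simplex_map 1 (face_map r) circle_simplex = word_simplex r"
    using standard_simplex_1D
    by (intro ext) (auto simp: simplex_map_def word_simplex_def circle_simplex_def face_map_def
        attaching_loop_cis[OF r(1)])
  show "singular_face 2 0 cell = word_simplex []" "singular_face 2 1 cell = word_simplex []"
      "singular_face 2 2 cell = word_simplex r"
    using face[of 0] face[of 1] face[of 2] unfolding disc_simplex_faces one two by simp_all
qed simp

interpretation group "free_group S" by (rule group_free_group)

lemma capped_conj_prod:
  assumes "r \<in> carrier (free_group S)"
  shows "conj_prod (free_group S) r n w \<Longrightarrow> capped S r (frag_of cell) (int n) w"
proof (induction rule: conj_prod.induct)
  case conj_prod_one
  then show ?case using capped_one[OF r] by (simp add: one_free_group)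
next
  case (conj_prod_step n w h)
  have "capped S r (frag_of cell) 1 r" using triangle_cell by (simp add: capped_def[OF r])
  then have "capped S r (frag_of cell) 1 (h \<otimes>\<^bsub>free_group S\<^esub> r \<otimes>\<^bsub>free_group S\<^esub> inv\<^bsub>free_group S\<^esub> h)"
    by (rule capped_conj[OF r conj_prod_step.hyps(2) assms])
  then have "capped S r (frag_of cell) (int n + 1)
      (w \<otimes>\<^bsub>free_group S\<^esub> (h \<otimes>\<^bsub>free_group S\<^esub> r \<otimes>\<^bsub>free_group S\<^esub> inv\<^bsub>free_group S\<^esub> h))"
    by (intro capped_mult[OF r] conj_prod_step.IH)
      (use conj_prod_step.hyps assms conj_prod_closed[OF conj_prod_step.hyps(1) assms] in auto)
  then show ?case by (simp add: add.commute)
qed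

text \<open>
  The four triangles of a commutator come from \<open>[a, b] (b a) = a b\<close>, and one joins it to
  the rest of the product.
\<close>

lemma chain_of_comm_prod:
  "comm_prod (free_group S) t w \<Longrightarrow>
     \<exists>y. singular_chain 2 P y \<and> chain_boundary 2 y = frag_of (word_simplex w) \<and>
         singular_relboundary 2 P K y \<and> l1_norm (real_of_chain y) \<le> 4 * t + 1"
proof (induction t arbitrary: w)
  have tr: "\<exists>s. singular_simplex 2 P s \<and> singular_relboundary 2 P K (frag_of s) \<and>
      chain_boundary 2 (frag_of s) =
        frag_of (word_simplex v) - frag_of (word_simplex (u \<otimes>\<^bsub>free_group S\<^esub> v)) + frag_of (word_simplex u)"
    if "u \<in> carrier (free_group S)" "v \<in> carrier (free_group S)" for u v
    using triangle_mult[OF r that, of 0] by (auto simp: triangle_def chain_boundary_2)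
  case 0
  then have w: "w = \<one>\<^bsub>free_group S\<^esub>" by simp
  \<comment> \<open>All three edges are the trivial loop and the boundary is 1 - 1 + 1: this
    triangle is the summand 1 in \<open>4 * t + 1\<close>.\<close>
  obtain s where s: "singular_simplex 2 P s" "singular_relboundary 2 P K (frag_of s)"
      "chain_boundary 2 (frag_of s) = frag_of (word_simplex w) - frag_of (word_simplex w) + frag_of (word_simplex w)"
    using tr[of w w] by (auto simp: w)
  then show ?case
    by (intro exI[of _ "frag_of s"]) (simp add: singular_chain_of real_of_chain_of l1_norm_single)
next
  case (Suc t)
  have tr: "\<exists>s. singular_simplex 2 P s \<and> singular_relboundary 2 P K (frag_of s) \<and>
      chain_boundary 2 (frag_of s) =
        frag_of (word_simplex v) - frag_of (word_simplex (u \<otimes>\<^bsub>free_group S\<^esub> v)) + frag_of (word_simplex u)"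
    if "u \<in> carrier (free_group S)" "v \<in> carrier (free_group S)" for u v
    using triangle_mult[OF r that, of 0] by (auto simp: triangle_def chain_boundary_2)
  obtain a b v where ab: "a \<in> carrier (free_group S)" "b \<in> carrier (free_group S)"
      and v: "comm_prod (free_group S) t v"
      and w: "w = (a \<otimes>\<^bsub>free_group S\<^esub> b \<otimes>\<^bsub>free_group S\<^esub> inv\<^bsub>free_group S\<^esub> a \<otimes>\<^bsub>free_group S\<^esub> inv\<^bsub>free_group S\<^esub> b)
         \<otimes>\<^bsub>free_group S\<^esub> v"
    using Suc.prems unfolding comm_prod_Suc by blast
  have vc: "v \<in> carrier (free_group S)" using comm_prod_closed[OF v] .
  define x where "x = a \<otimes>\<^bsub>free_group S\<^esub> b \<otimes>\<^bsub>free_group S\<^esub> inv\<^bsub>free_group S\<^esub> a \<otimes>\<^bsub>free_group S\<^esub> inv\<^bsub>free_group S\<^esub> b"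
  have x: "x \<in> carrier (free_group S)" using ab by (simp add: x_def)
  have xba: "x \<otimes>\<^bsub>free_group S\<^esub> (b \<otimes>\<^bsub>free_group S\<^esub> a) = a \<otimes>\<^bsub>free_group S\<^esub> b"
    using ab by (simp add: x_def m_assoc)
  obtain y where y: "singular_chain 2 P y" "chain_boundary 2 y = frag_of (word_simplex v)"
      "singular_relboundary 2 P K y" "l1_norm (real_of_chain y) \<le> 4 * t + 1"
    using Suc.IH[OF v] by blast
  obtain s1 where s1: "singular_simplex 2 P s1" "singular_relboundary 2 P K (frag_of s1)"
    "chain_boundary 2 (frag_of s1) = frag_of (word_simplex v) - frag_of (word_simplex w) + frag_of (word_simplex x)"
    using tr[OF x vc] by (auto simp: w x_def)
  obtain s2 where s2: "singular_simplex 2 P s2" "singular_relboundary 2 P K (frag_of s2)"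
    "chain_boundary 2 (frag_of s2) = frag_of (word_simplex (b \<otimes>\<^bsub>free_group S\<^esub> a)) -
      frag_of (word_simplex (a \<otimes>\<^bsub>free_group S\<^esub> b)) + frag_of (word_simplex x)"
    using tr[OF x, of "b \<otimes>\<^bsub>free_group S\<^esub> a"] ab unfolding xba by auto
  obtain s3 where s3: "singular_simplex 2 P s3" "singular_relboundary 2 P K (frag_of s3)"
    "chain_boundary 2 (frag_of s3) = frag_of (word_simplex b) -
      frag_of (word_simplex (a \<otimes>\<^bsub>free_group S\<^esub> b)) + frag_of (word_simplex a)"
    using tr[OF ab] by blast
  obtain s4 where s4: "singular_simplex 2 P s4" "singular_relboundary 2 P K (frag_of s4)"
    "chain_boundary 2 (frag_of s4) = frag_of (word_simplex a) -
      frag_of (word_simplex (b \<otimes>\<^bsub>free_group S\<^esub> a)) + frag_of (word_simplex b)"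
    using tr[OF ab(2,1)] by blast
  \<comment> \<open>In \<open>s2 - s3 + s4\<close> the edges \<open>a\<close>, \<open>b\<close>,
    \<open>a b\<close>, \<open>b a\<close> cancel, leaving the boundary \<open>x\<close>; that of
    \<open>y - s1\<close> is \<open>w - x\<close>.\<close>
  define y' where "y' = y - frag_of s1 + frag_of s2 - frag_of s3 + frag_of s4"
  have "singular_chain 2 P y'"
    unfolding y'_def using y(1) s1(1) s2(1) s3(1) s4(1)
    by (intro singular_chain_add singular_chain_diff) (simp_all add: singular_chain_of)
  moreover have "chain_boundary 2 y' = frag_of (word_simplex w)"
    unfolding y'_def chain_boundary_add chain_boundary_diff y(2) s1(3) s2(3) s3(3) s4(3) by simp
  moreover have "singular_relboundary 2 P K y'"
    unfolding y'_def
    by (rule singular_relboundary_add[OF singular_relboundary_diff[OF singular_relboundary_add[OF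
          singular_relboundary_diff[OF y(3) s1(2)] s2(2)] s3(2)] s4(2)])
  moreover have "l1_norm (real_of_chain y') \<le> 4 * Suc t + 1"
  proof -
    have n: "l1_norm (real_of_chain (frag_of s)) = 1" for s :: "(nat \<Rightarrow> real) \<Rightarrow> 'a pres_point"
      by (simp add: real_of_chain_of l1_norm_single)
    have add: "l1_norm (real_of_chain (c + c')) \<le> l1_norm (real_of_chain c) + l1_norm (real_of_chain c')"
      "l1_norm (real_of_chain (c - c')) \<le> l1_norm (real_of_chain c) + l1_norm (real_of_chain c')"
      for c c' :: "'a pres_point chain"
      using l1_norm_add l1_norm_diff by (simp_all add: real_of_chain_add real_of_chain_diff)
    have "l1_norm (real_of_chain y') \<le> l1_norm (real_of_chain y) + 1 + 1 + 1 + 1"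
      unfolding y'_def
      using add(2)[of y "frag_of s1"] add(1)[of "y - frag_of s1" "frag_of s2"]
        add(2)[of "y - frag_of s1 + frag_of s2" "frag_of s3"]
        add(1)[of "y - frag_of s1 + frag_of s2 - frag_of s3" "frag_of s4"]
      unfolding n by linarith
    then show ?thesis using y(4) by simp
  qed
  ultimately show ?case by blast
qed

text \<open>The chain of commutators has degree 0 and boundary \<open>w\<close>. One triangle of
  degree \<open>n\<close> with the same boundary closes it up, which gives the norm
  \<open>(4 t + 1) + 1\<close>.\<close>

lemma cycle_of_surface:
  assumes "r \<in> carrier (free_group S)" "conj_prod (free_group S) r n w" "comm_prod (free_group S) t w"
  shows "\<exists>y. singular_relcycle 2 P {} y \<and> singular_relboundary 2 P K (y - frag_cmul (int n) (frag_of cell)) \<and>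
     l1_norm (real_of_chain y) \<le> 4 * t + 2"
proof -
  obtain y where y: "singular_chain 2 P y" "chain_boundary 2 y = frag_of (word_simplex w)"
      "singular_relboundary 2 P K y" "l1_norm (real_of_chain y) \<le> 4 * t + 1"
    using chain_of_comm_prod[OF assms(3)] by blast
  obtain s where s: "singular_simplex 2 P s" "chain_boundary 2 (frag_of s) = frag_of (word_simplex w)"
      "singular_relboundary 2 P K (frag_of s - frag_cmul (int n) (frag_of cell))"
    using capped_conj_prod[OF assms(1,2)] by (auto simp: capped_def[OF r] triangle_def chain_boundary_2)
  have "singular_relcycle 2 P {} (frag_of s - y)"
    using s y by (simp add: singular_cycle singular_chain_diff singular_chain_of chain_boundary_diff)
  moreover have "singular_relboundary 2 P K (frag_of s - y - frag_cmul (int n) (frag_of cell))"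
    using singular_relboundary_diff[OF s(3) y(3)] by (simp add: algebra_simps)
  moreover have "l1_norm (real_of_chain (frag_of s - y)) \<le> 4 * t + 2"
    using l1_norm_diff[of "real_of_chain (frag_of s)" "real_of_chain y"] y(4)
    by (simp add: real_of_chain_diff real_of_chain_of l1_norm_single)
  ultimately show ?thesis by blast
qed

context
  assumes acyclic: "trivial_group (homology_group 2 (subtopology P K))"
begin

text \<open>The vanishing of H_2 of the graph makes H_2(P) inject into H_2(P, K), so a cycle that
  agrees with the cell relative to the graph represents the class.\<close>

lemma pres_class_eq:
  assumes y: "singular_relcycle 2 P {} y" "singular_relboundary 2 P K (y - frag_of cell)"
  shows "pres_class S r = homologous_rel_set 2 P {} y"
proof -
  have ac: "trivial_group (homology_group (int 2) (subtopology P K))" using acyclic by simp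
  have car: "carrier (homology_group 2 P) = homologous_rel_set 2 P {} ` singular_relcycle_set 2 P {}"
    using carrier_relative_homology_group[of 2 P "{}"] by simp
  have ind: "hom_induced 2 P {} P K id (homologous_rel_set 2 P {} z) = homologous_rel_set 2 P K z"
    if z: "singular_relcycle 2 P {} z" for z
    using hom_induced_chain_map[of P P id "{}" K 2 z] z chain_map_id_gen[of 2 P z id]
    by (simp add: singular_cycle)
  have cell: "hom_induced 2 (top_of_set (cball 0 1)) (sphere 0 1) P K (face_map r) disc_class =
      homologous_rel_set 2 P K (frag_of cell)"
  proof -
    have "face_map r \<in> sphere 0 1 \<rightarrow> K"
      using attaching_loop_in_skeleton[OF r] by (auto simp: face_map_def)
    then show ?thesis
      using hom_induced_chain_map[OF continuous_map_face_map[OF r] _ relcycle_disc, of K]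
      by (simp add: disc_class_eq)
  qed
  show ?thesis
    unfolding pres_class_def Let_def cell
  proof (rule the_equality)
    show "homologous_rel_set 2 P {} y \<in> carrier (homology_group 2 P) \<and>
      hom_induced 2 P {} P K id (homologous_rel_set 2 P {} y) = homologous_rel_set 2 P K (frag_of cell)"
    proof
      show "homologous_rel_set 2 P {} y \<in> carrier (homology_group 2 P)" unfolding car using y(1) by blast
      have "homologous_rel 2 P K y (frag_of cell)" using y(2) unfolding homologous_rel_def .
      then show "hom_induced 2 P {} P K id (homologous_rel_set 2 P {} y) = homologous_rel_set 2 P K (frag_of cell)"
        unfolding ind[OF y(1)] homologous_rel_set_eq .
    qed
  next
    fix a assume a: "a \<in> carrier (homology_group 2 P) \<and>
      hom_induced 2 P {} P K id a = homologous_rel_set 2 P K (frag_of cell)"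
    then obtain z where z: "singular_relcycle 2 P {} z" "a = homologous_rel_set 2 P {} z"
      unfolding car by blast
    have "homologous_rel 2 P K z (frag_of cell)"
      using a unfolding z(2) ind[OF z(1)] homologous_rel_set_eq by blast
    then have "singular_relboundary 2 P K ((z - frag_of cell) - (y - frag_of cell))"
      unfolding homologous_rel_def by (rule singular_relboundary_diff[OF _ y(2)])
    then have "singular_relboundary 2 P K (z - y)" by simp
    moreover have "singular_relcycle 2 P {} (z - y)" using z(1) y(1) by (rule singular_relcycle_diff)
    ultimately have "singular_relboundary 2 P {} (z - y)"
      by (intro relboundary_absolute[OF ac]) auto
    then have "homologous_rel 2 P {} z y" unfolding homologous_rel_def .
    then show "a = homologous_rel_set 2 P {} y" unfolding z(2) homologous_rel_set_eq .
  qed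
qed

text \<open>Relative to the graph the surface cycle \<open>y\<close> is homologous to
  \<open>n\<close> times an integral representative \<open>y1\<close>, hence also absolutely. Over
  the reals it can be divided by \<open>n\<close>, and pushing it forward along \<open>c\<close>
  does not increase the norm.\<close>

lemma simplicial_volume_le:
  fixes X :: "'x topology"
  assumes c: "continuous_map P X c" and rd: "r \<in> derived (free_group S) (carrier (free_group S))"
    and n: "n \<ge> 1" "conj_prod (free_group S) r n w" "comm_prod (free_group S) t w"
  shows "simplicial_volume S r X c \<le> (4 * real t + 2) / real n"
proof -
  have ac: "trivial_group (homology_group (int 2) (subtopology P K))" using acyclic by simp
  have rc: "r \<in> carrier (free_group S)"
    using rd derived_in_carrier[of "carrier (free_group S)"] by blast
  \<comment> \<open>A representative \<open>y1\<close> of the class comes from \<open>r\<close>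
    itself, which is one conjugate and bounds a surface of some genus \<open>t0\<close>.\<close>
  obtain t0 where "comm_prod (free_group S) t0 r" using comm_prod_derived[OF rd] by blast
  from cycle_of_surface[OF rc conj_prod_self[OF rc] this]
  obtain y1 where y1: "singular_relcycle 2 P {} y1" "singular_relboundary 2 P K (y1 - frag_of cell)"
    by auto
  obtain y where y: "singular_relcycle 2 P {} y"
      "singular_relboundary 2 P K (y - frag_cmul (int n) (frag_of cell))"
      "l1_norm (real_of_chain y) \<le> 4 * t + 2"
    using cycle_of_surface[OF rc n(2,3)] by blast
  have "singular_relboundary 2 P K ((y - frag_cmul (int n) (frag_of cell)) - frag_cmul (int n) (y1 - frag_of cell))"
    by (rule singular_relboundary_diff[OF y(2) singular_relboundary_cmul[OF y1(2)]])
  also have "(y - frag_cmul (int n) (frag_of cell)) - frag_cmul (int n) (y1 - frag_of cell) = y - frag_cmul (int n) y1"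
    by (rule poly_mapping_eqI) (simp add: lookup_add lookup_minus algebra_simps)
  finally have "singular_relboundary 2 P {} (y - frag_cmul (int n) y1)"
    by (intro relboundary_absolute[OF ac] singular_relcycle_diff singular_relcycle_cmul y(1) y1(1)) auto
  then obtain b where b: "singular_chain 3 P b" "chain_boundary 3 b = y - frag_cmul (int n) y1"
    by (auto simp: singular_boundary numeral_3_eq_3)
  define F where "F = chain_map 2 c"
  have fund: "fundamental_class S r X c = homologous_rel_set 2 X {} (F y1)"
    unfolding fundamental_class_def pres_class_eq[OF y1] F_def
    using hom_induced_chain_map[OF c, of "{}" "{}" 2 y1] y1(1) by simp
  have cyc: "singular_chain 2 X (F u)" "chain_boundary 2 (F u) = 0" if "singular_relcycle 2 P {} u" for u
  proof -
    have "singular_chain 2 P u" "chain_boundary 2 u = 0" using that by (auto simp: singular_cycle)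
    then show "singular_chain 2 X (F u)" "chain_boundary 2 (F u) = 0"
      using singular_chain_chain_map[OF _ c, of 2 u] chain_boundary_chain_map[of 2 P u c]
      by (auto simp: F_def)
  qed
  define z where "z = scale (1 / real n) (real_of_chain (F y))"
  have "z \<in> real_class 2 X (fundamental_class S r X c)"
    unfolding real_class_def fund
  proof (intro CollectI conjI bexI[of _ "F y1"])
    show "real_singular_cycle 2 X z"
      using cyc[OF y(1)] keys_scale[of "1 / real n" "real_of_chain (F y)"]
      by (auto simp: real_singular_cycle_def real_singular_chain_def z_def keys_real_of_chain
          real_chain_boundary_scale real_chain_boundary_of_chain real_of_chain_0 scale_0 singular_chain_def)
    show "real_singular_boundary 2 X (z - real_of_chain (F y1))"
      unfolding real_singular_boundary_def
    proof (intro exI conjI)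
      define b' where "b' = scale (1 / real n) (real_of_chain (chain_map 3 c b))"
      have "singular_chain 3 X (chain_map 3 c b)" using singular_chain_chain_map[OF b(1) c] .
      then show "real_singular_chain (Suc 2) X b'"
        using keys_scale[of "1 / real n" "real_of_chain (chain_map 3 c b)"]
        by (auto simp: b'_def real_singular_chain_def keys_real_of_chain singular_chain_def numeral_3_eq_3)
      have "chain_boundary 3 (chain_map 3 c b) = F (y - frag_cmul (int n) y1)"
        using chain_boundary_chain_map[OF b(1), of c] b(2) by (simp add: F_def)
      also have "\<dots> = F y - frag_cmul (int n) (F y1)" by (simp add: F_def chain_map_diff)
      finally have "real_chain_boundary 3 b' = scale (1 / real n) (real_of_chain (F y - frag_cmul (int n) (F y1)))"
        by (simp add: b'_def real_chain_boundary_scale real_chain_boundary_of_chain)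
      also have "\<dots> = z - real_of_chain (F y1)"
        using n(1) by (intro poly_mapping_eqI) (simp add: z_def lookup_scale lookup_map_0 lookup_minus field_simps)
      finally show "real_chain_boundary (Suc 2) b' = z - real_of_chain (F y1)" by (simp add: numeral_3_eq_3)
    qed
  qed simp
  then have "simplicial_volume S r X c \<le> l1_norm z"
    unfolding simplicial_volume_def l1_seminorm_def
    by (intro cINF_lower bdd_belowI2[of _ 0]) (auto simp: l1_norm_nonneg)
  also have "\<dots> = l1_norm (real_of_chain (F y)) / real n" by (simp add: z_def l1_norm_scale)
  also have "\<dots> \<le> (4 * real t + 2) / real n"
    using l1_norm_chain_map[of 2 c y] y(3) by (intro divide_right_mono) (auto simp: F_def)
  finally show ?thesis .
qed

end

end

section \<open>The second homology of the 1-skeleton\<close>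

definition graph_topology :: "'a set \<Rightarrow> 'a pres_point topology" where
  "graph_topology S = topology (\<lambda>U. U \<subseteq> pres_skeleton1 S \<and>
     (\<forall>s\<in>S. openin (top_of_set {0..1}) {t \<in> {0..1}. edge_map s t \<in> U}))"

lemma openin_graph_topology:
  "openin (graph_topology S) U \<longleftrightarrow> U \<subseteq> pres_skeleton1 S \<and>
     (\<forall>s\<in>S. openin (top_of_set {0..1}) {t \<in> {0..1}. edge_map s t \<in> U})"
proof -
  have int: "{x \<in> A. f x \<in> U \<inter> V} = {x \<in> A. f x \<in> U} \<inter> {x \<in> A. f x \<in> V}"
    for A :: "real set" and f :: "real \<Rightarrow> 'a pres_point" and U V by auto
  have un: "{x \<in> A. f x \<in> \<Union>\<K>} = (\<Union>U\<in>\<K>. {x \<in> A. f x \<in> U})"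
    for A :: "real set" and f :: "real \<Rightarrow> 'a pres_point" and \<K> by auto
  have "istopology (\<lambda>U. U \<subseteq> pres_skeleton1 S \<and>
     (\<forall>s\<in>S. openin (top_of_set {0..1}) {t \<in> {0..1}. edge_map s t \<in> U}))"
    unfolding istopology_def int un by (auto intro!: openin_Int openin_Union)
  then show ?thesis by (simp add: graph_topology_def topology_inverse')
qed

lemma topspace_graph_topology: "topspace (graph_topology S) = pres_skeleton1 S"
proof
  show "topspace (graph_topology S) \<subseteq> pres_skeleton1 S"
    unfolding topspace_def by (auto simp: openin_graph_topology)
  have "{t \<in> {0..1}. edge_map s t \<in> pres_skeleton1 S} = {0..1}" if "s \<in> S" for s
    using edge_map_in_skeleton[OF that] by auto
  then have "openin (graph_topology S) (pres_skeleton1 S)" by (simp add: openin_graph_topology)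
  then show "pres_skeleton1 S \<subseteq> topspace (graph_topology S)" by (rule openin_subset)
qed

lemma continuous_map_edge_map_graph:
  assumes "s \<in> S"
  shows "continuous_map (top_of_set {0..1}) (graph_topology S) (edge_map s)"
  unfolding continuous_map_def
  using edge_map_in_skeleton[OF assms] assms by (auto simp: topspace_graph_topology openin_graph_topology)

text \<open>The circle is a quotient of the unit interval, and on the interval the attaching loop
  becomes the continuous path \<open>word_path r\<close>.\<close>

lemma openin_sphere_attaching_loop:
  assumes r: "r \<noteq> []" "fst ` set r \<subseteq> S" and W: "openin (graph_topology S) W"
  shows "openin (top_of_set (sphere 0 1)) {z \<in> sphere 0 1. attaching_loop r z \<in> W}"
proof -
  have edge: "continuous_map euclideanreal (graph_topology S) (edge_map s)" if "s \<in> S" for s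
  proof -
    have 2: "continuous_map euclideanreal (top_of_set {0..1}) (\<lambda>t. max 0 (min 1 t))"
      by (auto simp: continuous_map_in_subtopology intro!: continuous_intros)
    have "edge_map s \<circ> (\<lambda>t. max 0 (min 1 t)) = edge_map s"
      by (rule ext) (auto simp: edge_map_def max_def min_def)
    then show ?thesis using continuous_map_compose[OF 2 continuous_map_edge_map_graph[OF that]] by simp
  qed
  have path: "continuous_map euclideanreal (graph_topology S) (word_path r)"
    by (rule continuous_map_word_path[OF edge _ r(2)]) (simp_all add: topspace_graph_topology pres_skeleton1_def)
  have c: "continuous_on {0..1} (\<lambda>t. cis (2 * pi * t))" by (intro continuous_intros)
  have im: "(\<lambda>t. cis (2 * pi * t)) ` {0..1} = sphere 0 1"
  proof (intro equalityI subsetI)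
    fix z :: complex assume "z \<in> sphere 0 1"
    then have "z = cis (2 * pi * (Arg2pi z / (2 * pi)))" "Arg2pi z / (2 * pi) \<in> {0..1}"
      using Arg2pi_eq[of z] Arg2pi_ge_0[of z] Arg2pi_lt_2pi[of z] by (auto simp: cis_conv_exp)
    then show "z \<in> (\<lambda>t. cis (2 * pi * t)) ` {0..1}" by (rule image_eqI)
  qed auto
  have "continuous_map (top_of_set {0..1}) (graph_topology S) (\<lambda>t. word_path r (real (length r) * t))"
  proof -
    have "continuous_map (top_of_set {0..1}) euclideanreal (\<lambda>t. real (length r) * t)"
      by (auto intro!: continuous_intros)
    from continuous_map_compose[OF this path] show ?thesis by (simp add: comp_def)
  qed
  then have "openin (top_of_set {0..1}) {t \<in> topspace (top_of_set {0..1}). word_path r (real (length r) * t) \<in> W}"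
    using W by (rule openin_continuous_map_preimage)
  also have "{t \<in> topspace (top_of_set {0..1}). word_path r (real (length r) * t) \<in> W} =
      {0..1} \<inter> (\<lambda>t. cis (2 * pi * t)) -` {z \<in> sphere 0 1. attaching_loop r z \<in> W}"
    using attaching_loop_cis[OF r(1)] by auto
  finally show ?thesis
    using Abstract_Topology_2.continuous_imp_quotient_map[OF c im, of "{z \<in> sphere 0 1. attaching_loop r z \<in> W}"]
    by (simp add: subset_iff)
qed

text \<open>An open subset of the graph is thickened radially into the 2-cell.\<close>

lemma subtopology_skeleton:
  assumes r: "r \<noteq> []" "fst ` set r \<subseteq> S"
  shows "subtopology (pres_complex S r) (pres_skeleton1 S) = graph_topology S"
proof (rule topology_eq[THEN iffD2], intro allI iffI)
  fix W
  assume "openin (subtopology (pres_complex S r) (pres_skeleton1 S)) W"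
  then obtain U where U: "openin (pres_complex S r) U" "W = U \<inter> pres_skeleton1 S"
    by (auto simp: openin_subtopology)
  have "{t \<in> {0..1}. edge_map s t \<in> W} = {t \<in> {0..1}. edge_map s t \<in> U}" if "s \<in> S" for s
    using edge_map_in_skeleton[OF that] by (auto simp: U(2))
  then show "openin (graph_topology S) W"
    using U by (simp add: openin_graph_topology openin_pres_complex pres_open_def)
next
  fix W assume W: "openin (graph_topology S) W"
  then have WK: "W \<subseteq> pres_skeleton1 S" by (simp add: openin_graph_topology)
  define A where "A = {z \<in> sphere 0 1. attaching_loop r z \<in> W}"
  \<comment> \<open>The centre of the cell is left out, as the radial projection \<open>sgn\<close>
    is discontinuous there.\<close>
  define U where "U = W \<union> Face ` {z \<in> ball 0 1. z \<noteq> 0 \<and> attaching_loop r (sgn z) \<in> W}"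
  have nf: "Face z \<notin> pres_skeleton1 S" for z by (auto simp: pres_skeleton1_def)
  have "openin (pres_complex S r) U"
    unfolding openin_pres_complex pres_open_def
  proof (intro conjI ballI)
    show "U \<subseteq> pres_points S" using WK by (auto simp: U_def pres_points_def)
    fix s assume s: "s \<in> S"
    have "edge_map s t \<in> U \<longleftrightarrow> edge_map s t \<in> W" for t
      using edge_map_in_skeleton[OF s, of t] nf by (auto simp: U_def)
    then show "openin (top_of_set {0..1}) {t \<in> {0..1}. edge_map s t \<in> U}"
      using W s by (simp add: openin_graph_topology)
  next
    have loop: "attaching_loop r z \<in> U \<longleftrightarrow> attaching_loop r z \<in> W" for z
      using attaching_loop_in_skeleton[OF r, of z] nf by (auto simp: U_def)
    have "{z \<in> cball 0 1. face_map r z \<in> U} = {z \<in> cball 0 1. z \<noteq> 0 \<and> sgn z \<in> A}"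
    proof (intro Collect_cong conj_cong refl)
      fix z :: complex assume z: "z \<in> cball 0 1"
      show "face_map r z \<in> U \<longleftrightarrow> z \<noteq> 0 \<and> sgn z \<in> A"
      proof (cases "norm z < 1")
        case True
        then show ?thesis using WK nf by (auto simp: face_map_def U_def A_def norm_sgn)
      next
        case False
        then have "norm z = 1" using z by simp
        then show ?thesis using loop by (auto simp: face_map_def A_def sgn_div_norm)
      qed
    qed
    also have "\<dots> = cball 0 1 \<inter> ((- {0}) \<inter> sgn -` A)" by auto
    finally have eq: "{z \<in> cball 0 1. face_map r z \<in> U} = cball 0 1 \<inter> ((- {0}) \<inter> sgn -` A)" .
    have "openin (top_of_set (- {0})) ((- {0}) \<inter> sgn -` A)"
    proof (rule continuous_openin_preimage)
      show "continuous_on (- {0}) (sgn :: complex \<Rightarrow> complex)"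
        by (auto intro!: continuous_intros)
      show "openin (top_of_set (sphere 0 1)) A"
        unfolding A_def by (rule openin_sphere_attaching_loop[OF r W])
    qed (auto simp: norm_sgn)
    then have "open ((- {0}) \<inter> sgn -` A)" by (rule openin_open_trans) (rule open_Compl, rule closed_singleton)
    then show "openin (top_of_set (cball 0 1)) {z \<in> cball 0 1. face_map r z \<in> U}"
      unfolding eq by (rule openin_open_Int)
  qed
  moreover have "W = U \<inter> pres_skeleton1 S" using WK nf by (auto simp: U_def)
  ultimately show "openin (subtopology (pres_complex S r) (pres_skeleton1 S)) W"
    unfolding openin_subtopology by blast
qed

text \<open>The disjoint union of copies of \<open>J\<close>, one for each generator; for
  \<open>J = {0..1}\<close> the graph is its quotient.\<close>

definition edge_space :: "'a set \<Rightarrow> real set \<Rightarrow> ('a \<times> real) topology" where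
  "edge_space S J = prod_topology (discrete_topology S) (top_of_set J)"

lemma openin_edge_space:
  "openin (edge_space S J) W \<longleftrightarrow> W \<subseteq> S \<times> J \<and> (\<forall>s\<in>S. openin (top_of_set J) {t \<in> J. (s, t) \<in> W})"
proof
  assume W: "openin (edge_space S J) W"
  have "openin (top_of_set J) {t \<in> J. (s, t) \<in> W}" if "s \<in> S" for s
  proof -
    have "continuous_map (top_of_set J) (edge_space S J) (\<lambda>t. (s, t))"
      unfolding edge_space_def using that by (simp add: continuous_map_pairwise comp_def)
    from openin_continuous_map_preimage[OF this W] show ?thesis by simp
  qed
  then show "W \<subseteq> S \<times> J \<and> (\<forall>s\<in>S. openin (top_of_set J) {t \<in> J. (s, t) \<in> W})"
    using openin_subset[OF W] by (simp add: edge_space_def)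
next
  assume W: "W \<subseteq> S \<times> J \<and> (\<forall>s\<in>S. openin (top_of_set J) {t \<in> J. (s, t) \<in> W})"
  have "openin (edge_space S J) (\<Union>s\<in>S. {s} \<times> {t \<in> J. (s, t) \<in> W})"
    unfolding edge_space_def by (intro openin_Union) (use W in \<open>auto simp: openin_prod_Times_iff\<close>)
  also have "(\<Union>s\<in>S. {s} \<times> {t \<in> J. (s, t) \<in> W}) = W" using W by auto
  finally show "openin (edge_space S J) W" .
qed

lemma quotient_map_edges:
  assumes "S \<noteq> {}"
  shows "quotient_map (edge_space S {0..1}) (graph_topology S) (\<lambda>(s, t). edge_map s t)"
  unfolding quotient_map_def
proof (intro conjI allI impI)
  show "(\<lambda>(s, t). edge_map s t) ` topspace (edge_space S {0..1}) = topspace (graph_topology S)"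
  proof (intro equalityI subsetI)
    fix x assume "x \<in> topspace (graph_topology S)"
    then consider "x = Vertex" | s t where "s \<in> S" "0 < t" "t < 1" "x = Edge s t"
      by (auto simp: topspace_graph_topology pres_skeleton1_def)
    then show "x \<in> (\<lambda>(s, t). edge_map s t) ` topspace (edge_space S {0..1})"
    proof cases
      case 1
      obtain s where "s \<in> S" using assms by blast
      then show ?thesis using 1 by (intro image_eqI[of _ _ "(s, 0)"]) (auto simp: edge_space_def edge_map_def)
    next
      case 2
      then show ?thesis by (intro image_eqI[of _ _ "(s, t)"]) (auto simp: edge_space_def edge_map_def)
    qed
  qed (auto simp: edge_space_def topspace_graph_topology edge_map_in_skeleton)
next
  fix U assume "U \<subseteq> topspace (graph_topology S)"
  then have "U \<subseteq> pres_skeleton1 S" by (simp add: topspace_graph_topology)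
  moreover have "{t \<in> {0..1}. (s, t) \<in> {x \<in> topspace (edge_space S {0..1}). (case x of (s, t) \<Rightarrow> edge_map s t) \<in> U}} =
      {t \<in> {0..1}. edge_map s t \<in> U}" if "s \<in> S" for s
    using that by (auto simp: edge_space_def)
  ultimately show "openin (edge_space S {0..1}) {x \<in> topspace (edge_space S {0..1}). (case x of (s, t) \<Rightarrow> edge_map s t) \<in> U} \<longleftrightarrow>
      openin (graph_topology S) U"
    unfolding openin_edge_space openin_graph_topology by (auto simp: edge_space_def)
qed

definition move_edges :: "(real \<Rightarrow> real) \<Rightarrow> 'a pres_point \<Rightarrow> 'a pres_point" where
  "move_edges f x = (case x of Edge s t \<Rightarrow> edge_map s (f t) | _ \<Rightarrow> x)"

lemma move_edges_edge_map:
  "t \<in> {0..1} \<Longrightarrow> (t = 0 \<or> t = 1 \<Longrightarrow> f t = t) \<Longrightarrow> move_edges f (edge_map s t) = edge_map s (f t)"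
  by (cases "t = 0 \<or> t = 1") (auto simp: move_edges_def edge_map_def)

text \<open>A homotopy of edge parameters that fixes the ends acts on all edges at once. It descends
  to the graph, even for infinite \<open>S\<close>, because the product of a quotient map with the
  locally compact unit interval is again a quotient map.\<close>

lemma homotopic_move_edges:
  fixes \<phi> :: "real \<times> real \<Rightarrow> real"
  assumes S: "S \<noteq> {}" and W: "openin (graph_topology S) W" and J: "J \<subseteq> {0..1}"
    and WJ: "\<And>s t. s \<in> S \<Longrightarrow> t \<in> {0..1} \<Longrightarrow> edge_map s t \<in> W \<longleftrightarrow> t \<in> J"
    and \<phi>: "continuous_on ({0..1} \<times> J) \<phi>" "\<phi> ` ({0..1} \<times> J) \<subseteq> J"
    and ends: "\<And>t x. x \<in> J \<Longrightarrow> x = 0 \<or> x = 1 \<Longrightarrow> \<phi> (t, x) = x"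
    and \<phi>0: "\<And>x. x \<in> J \<Longrightarrow> \<phi> (0, x) = x"
  shows "homotopic_with (\<lambda>_. True) (subtopology (graph_topology S) W) (subtopology (graph_topology S) W)
           id (move_edges (\<lambda>x. \<phi> (1, x)))"
proof -
  let ?G = "subtopology (graph_topology S) W" and ?I = "top_of_set {0..1::real}"
  define q where "q = (\<lambda>(s, t). edge_map s t :: 'a pres_point)"
  have WK: "W \<subseteq> pres_skeleton1 S" using W by (simp add: openin_graph_topology)
  have "{x \<in> topspace (edge_space S {0..1}). q x \<in> W} = S \<times> J"
    using WJ J by (auto simp: edge_space_def q_def)
  then have "quotient_map (subtopology (edge_space S {0..1}) (S \<times> J)) ?G q"
    using quotient_map_restriction[OF quotient_map_edges[OF S]] W unfolding q_def by blast
  moreover have "subtopology (edge_space S {0..1}) (S \<times> J) = edge_space S J"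
  proof -
    have "top_of_set J = subtopology (top_of_set {0..1}) J"
      using J by (simp add: subtopology_subtopology inf.absorb2)
    then show ?thesis
      using prod_topology_subtopology(2)[of "discrete_topology S" "top_of_set {0..1}" J]
      by (simp add: edge_space_def)
  qed
  ultimately have q: "quotient_map (edge_space S J) ?G q" by simp
  have cc: "locally_compact_space ?I"
    by (simp add: compact_imp_locally_compact_space compact_space_subtopology)
  have quot: "quotient_map (prod_topology ?I (edge_space S J)) (prod_topology ?I ?G) (\<lambda>(t, y). (t, q y))"
    by (rule quotient_map_prod_right[OF cc _ q]) (simp add: Hausdorff_space_subtopology)
  define h where "h = (\<lambda>(t, x). move_edges (\<lambda>x. \<phi> (t, x)) x :: 'a pres_point)"
  define k where "k = (\<lambda>(t, s, x). (s :: 'a, \<phi> (t, x)))"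
  have top: "topspace (edge_space S J) = S \<times> J" by (simp add: edge_space_def)
  have "continuous_map (prod_topology ?I (edge_space S J)) (edge_space S J) k"
  proof -
    let ?X = "prod_topology ?I (edge_space S J)"
    have snd: "continuous_map ?X (edge_space S J) snd" and fst: "continuous_map ?X ?I fst"
      by (rule continuous_map_snd continuous_map_fst)+
    have fst': "continuous_map (edge_space S J) (discrete_topology S) fst"
      and snd': "continuous_map (edge_space S J) (top_of_set J) snd"
      unfolding edge_space_def by (rule continuous_map_snd continuous_map_fst)+
    have 1: "continuous_map ?X (discrete_topology S) (\<lambda>x. fst (snd x))"
      using continuous_map_compose[OF snd fst'] by (simp add: comp_def)
    have "continuous_map ?X (top_of_set J) (\<lambda>x. snd (snd x))"
      using continuous_map_compose[OF snd snd'] by (simp add: comp_def)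
    then have 2: "continuous_map ?X (prod_topology ?I (top_of_set J)) (\<lambda>x. (fst x, snd (snd x)))"
      using fst by (simp only: continuous_map_paired simp_thms)
    have 3: "continuous_map (prod_topology ?I (top_of_set J)) (top_of_set J) \<phi>"
      using \<phi> by (simp add: continuous_map_in_subtopology image_subset_iff Pi_iff)
    from continuous_map_compose[OF 2 3] have "continuous_map ?X (top_of_set J) (\<lambda>x. \<phi> (fst x, snd (snd x)))"
      by (simp add: comp_def)
    with 1 have "continuous_map ?X (edge_space S J) (\<lambda>x. (fst (snd x), \<phi> (fst x, snd (snd x))))"
      by (simp add: edge_space_def continuous_map_paired)
    then show ?thesis by (simp add: k_def case_prod_unfold)
  qed
  from continuous_map_compose[OF this quotient_imp_continuous_map[OF q]]
  have "continuous_map (prod_topology ?I (edge_space S J)) ?G (q \<circ> k)" .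
  then have "continuous_map (prod_topology ?I (edge_space S J)) ?G (h \<circ> (\<lambda>(t, y). (t, q y)))"
  proof (rule continuous_map_eq)
    fix x assume "x \<in> topspace (prod_topology ?I (edge_space S J))"
    then obtain t s y where "x = (t, s, y)" "t \<in> {0..1}" "s \<in> S" "y \<in> J" by (auto simp: top)
    then show "(q \<circ> k) x = (h \<circ> (\<lambda>(t, y). (t, q y))) x"
      using J ends move_edges_edge_map[of y "\<lambda>x. \<phi> (t, x)" s] by (auto simp: k_def h_def q_def)
  qed
  then have "continuous_map (prod_topology ?I ?G) ?G h"
    by (rule continuous_compose_quotient_map[OF quot])
  moreover have "h (0, x) = x" if "x \<in> topspace ?G" for x
  proof -
    have "x \<in> W" "x \<in> topspace (graph_topology S)" using that by simp_all
    then have "x \<in> (\<lambda>(s, t). edge_map s t) ` (S \<times> {0..1})"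
      using quotient_imp_surjective_map[OF quotient_map_edges[OF S]] by (simp add: edge_space_def)
    then obtain s t where "s \<in> S" "t \<in> {0..1}" "x = edge_map s t" by auto
    then show ?thesis
      using WJ \<phi>0 ends \<open>x \<in> W\<close> move_edges_edge_map[of t "\<lambda>x. \<phi> (0, x)" s] by (simp add: h_def)
  qed
  ultimately show ?thesis
    by (subst homotopic_with) (auto intro!: exI[of _ h] simp: h_def)
qed

lemma continuous_on_pair_contraction:
  fixes \<rho> :: "real \<Rightarrow> real"
  assumes "continuous_on J \<rho>"
  shows "continuous_on ({0..1} \<times> J) (\<lambda>(t, x). (1 - t) * x + t * \<rho> x)"
proof -
  have "continuous_on ({0..1::real} \<times> J) (\<lambda>x. \<rho> (snd x))"
    by (rule continuous_on_compose2[OF assms]) (auto intro: continuous_intros)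
  then show ?thesis by (auto simp: case_prod_unfold intro!: continuous_intros)
qed

text \<open>Additivity reduces this to single points, where the dimension axiom applies.\<close>

lemma trivial_group_discrete_homology:
  assumes "p \<noteq> 0"
  shows "trivial_group (homology_group p (discrete_topology D))"
proof -
  define \<U> where "\<U> = (\<lambda>a. {a}) ` D"
  let ?SG = "sum_group \<U> (\<lambda>V. homology_group p (subtopology (discrete_topology D) V))"
  let ?h = "\<lambda>x. gfinprod (homology_group p (discrete_topology D))
              (\<lambda>V. hom_induced p (subtopology (discrete_topology D) V) {} (discrete_topology D) {} id (x V)) \<U>"
  have "?h \<in> iso ?SG (homology_group p (discrete_topology D))"
    by (rule homology_additivity_axiom) (auto simp: \<U>_def pairwise_def disjnt_def)
  then have surj: "carrier (homology_group p (discrete_topology D)) = ?h ` carrier ?SG"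
    by (simp add: iso_def bij_betw_def)
  have triv: "trivial_group (homology_group p (subtopology (discrete_topology D) V))" if "V \<in> \<U>" for V
    using that assms by (auto simp: \<U>_def intro!: homology_dimension_axiom)
  have "x = (\<lambda>V\<in>\<U>. \<one>\<^bsub>homology_group p (subtopology (discrete_topology D) V)\<^esub>)" if "x \<in> carrier ?SG" for x
  proof (rule PiE_ext)
    show "x \<in> (\<Pi>\<^sub>E V\<in>\<U>. carrier (homology_group p (subtopology (discrete_topology D) V)))"
      using that by (simp add: carrier_sum_group)
    then show "x V = (\<lambda>V\<in>\<U>. \<one>\<^bsub>homology_group p (subtopology (discrete_topology D) V)\<^esub>) V" if "V \<in> \<U>" for V
      using triv[OF that] that by (auto simp: trivial_group_def PiE_iff)
  qed (auto simp: PiE_iff intro!: monoid.one_closed group.is_monoid)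
  then have "carrier (homology_group p (discrete_topology D)) \<subseteq>
      {?h (\<lambda>V\<in>\<U>. \<one>\<^bsub>homology_group p (subtopology (discrete_topology D) V)\<^esub>)}"
    unfolding surj by blast
  then show ?thesis using group.trivial_group_alt[OF group_relative_homology_group] by blast
qed

text \<open>The identity is homotopic to a map through a discrete space, so it is trivial on
  homology in degree \<open>p\<close>.\<close>

lemma trivial_homology_group_via_discrete:
  assumes k: "continuous_map X (discrete_topology D) k" and g: "g ` D \<subseteq> topspace X"
    and h: "homotopic_with (\<lambda>_. True) X X id h" and hgk: "\<And>x. x \<in> topspace X \<Longrightarrow> h x = g (k x)"
    and p: "p \<noteq> 0"
  shows "trivial_group (homology_group p X)"
proof -
  let ?D = "discrete_topology D"
  have g: "continuous_map ?D X g" using g by auto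
  have "homotopic_with (\<lambda>_. True) X X id (g \<circ> k)"
    using h by (rule homotopic_with_eq) (simp_all add: hgk)
  then have eq: "hom_induced p X {} X {} id = hom_induced p ?D {} X {} g \<circ> hom_induced p X {} ?D {} k"
    by (simp add: homology_homotopy_empty hom_induced_compose_empty[OF k g])
  have "c = \<one>\<^bsub>homology_group p X\<^esub>" if "c \<in> carrier (homology_group p X)" for c
  proof -
    have "hom_induced p X {} ?D {} k c \<in> carrier (homology_group p ?D)"
      by (rule hom_induced_carrier)
    then have 1: "hom_induced p X {} ?D {} k c = \<one>\<^bsub>homology_group p ?D\<^esub>"
      using trivial_group_discrete_homology[OF p, of D] by (simp add: trivial_group_def)
    have "c = hom_induced p X {} X {} id c" using hom_induced_id[OF that] by simp
    also have "\<dots> = hom_induced p ?D {} X {} g \<one>\<^bsub>homology_group p ?D\<^esub>" by (simp add: eq 1)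
    also have "\<dots> = \<one>\<^bsub>homology_group p X\<^esub>"
      by (rule hom_one[OF hom_induced_empty_hom]) simp_all
    finally show ?thesis .
  qed
  then show ?thesis
    using group.trivial_group_subset[OF group_relative_homology_group] by blast
qed

text \<open>The map \<open>\<rho>\<close> is locally constant, and the segment from \<open>x\<close>
  to \<open>\<rho> x\<close> stays in \<open>J\<close>. So this part of the graph contracts onto a
  discrete set, with one point for each edge and each value of \<open>\<rho>\<close>.\<close>

lemma trivial_homology_group_edge_interiors:
  fixes \<rho> :: "real \<Rightarrow> real"
  assumes S: "S \<noteq> {}" and J: "J \<subseteq> {0<..<1}" and \<rho>: "\<And>b. open {t \<in> J. \<rho> t = b}"
    and move: "\<And>t x. t \<in> {0..1} \<Longrightarrow> x \<in> J \<Longrightarrow> (1 - t) * x + t * \<rho> x \<in> J" and p: "p \<noteq> 0"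
    and W: "W = {Edge s t |s t. s \<in> S \<and> t \<in> J}"
  shows "openin (graph_topology S) W" "trivial_group (homology_group p (subtopology (graph_topology S) W))"
proof -
  have sub: "W \<subseteq> pres_skeleton1 S" using J by (auto simp: W pres_skeleton1_def)
  have WJ: "edge_map s t \<in> W \<longleftrightarrow> t \<in> J" if "s \<in> S" for s t
    using that J by (auto simp: W edge_map_def)
  have opn: "open {t \<in> J. Q (\<rho> t)}" for Q
  proof -
    have "{t \<in> J. Q (\<rho> t)} = (\<Union>b\<in>Collect Q. {t \<in> J. \<rho> t = b})" by auto
    then show ?thesis using \<rho> by auto
  qed
  have "open J" using opn[of "\<lambda>_. True"] by simp
  have cont: "continuous_on J \<rho>"
    unfolding continuous_on_open_vimage[OF \<open>open J\<close>]
  proof (intro allI impI)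
    fix B
    have "\<rho> -` B \<inter> J = {t \<in> J. \<rho> t \<in> B}" by auto
    then show "open (\<rho> -` B \<inter> J)" using opn[of "\<lambda>b. b \<in> B"] by simp
  qed
  have preim: "openin (graph_topology S) {x \<in> W. case x of Edge s t \<Rightarrow> (s, \<rho> t) \<in> T | _ \<Rightarrow> False}" for T
    unfolding openin_graph_topology
  proof (intro conjI ballI)
    fix s assume s: "s \<in> S"
    have "{t \<in> {0..1}. edge_map s t \<in> {x \<in> W. case x of Edge s t \<Rightarrow> (s, \<rho> t) \<in> T | _ \<Rightarrow> False}} =
        {t \<in> J. (s, \<rho> t) \<in> T}"
      using WJ[OF s] J by (auto simp: edge_map_def subset_iff)
    then show "openin (top_of_set {0..1}) {t \<in> {0..1}.
        edge_map s t \<in> {x \<in> W. case x of Edge s t \<Rightarrow> (s, \<rho> t) \<in> T | _ \<Rightarrow> False}}"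
      using J by (auto intro!: open_subset opn[of "\<lambda>b. (s, b) \<in> T"])
  qed (use sub in auto)
  have "{x \<in> W. case x of Edge s t \<Rightarrow> (s, \<rho> t) \<in> UNIV | _ \<Rightarrow> False} = W" by (auto simp: W)
  then show W': "openin (graph_topology S) W" using preim[of UNIV] by simp
  let ?k = "\<lambda>x :: 'a pres_point. case x of Edge s t \<Rightarrow> (s, \<rho> t) | _ \<Rightarrow> undefined"
  have top: "topspace (subtopology (graph_topology S) W) = W"
    using sub by (auto simp: topspace_graph_topology)
  have \<rho>J: "\<rho> t \<in> J" if "t \<in> J" for t using move[of 1 t] that by simp
  show "trivial_group (homology_group p (subtopology (graph_topology S) W))"
  proof (rule trivial_homology_group_via_discrete[OF _ _ _ _ p])
    show "continuous_map (subtopology (graph_topology S) W) (discrete_topology (S \<times> \<rho> ` J)) ?k"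
      unfolding continuous_map_def
    proof (intro conjI allI impI)
      fix T assume "openin (discrete_topology (S \<times> \<rho> ` J)) T"
      have "{x \<in> topspace (subtopology (graph_topology S) W). ?k x \<in> T} =
          {x \<in> W. case x of Edge s t \<Rightarrow> (s, \<rho> t) \<in> T | _ \<Rightarrow> False}"
        unfolding top by (auto simp: W)
      then show "openin (subtopology (graph_topology S) W) {x \<in> topspace (subtopology (graph_topology S) W). ?k x \<in> T}"
        using preim[of T] W' by (auto simp: openin_open_subtopology)
    qed (auto simp: top W)
    show "(\<lambda>(s, b). edge_map s b) ` (S \<times> \<rho> ` J) \<subseteq> topspace (subtopology (graph_topology S) W)"
      unfolding top using WJ \<rho>J by auto
    show "homotopic_with (\<lambda>_. True) (subtopology (graph_topology S) W) (subtopology (graph_topology S) W)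
        id (move_edges (\<lambda>x. (\<lambda>(t, x). (1 - t) * x + t * \<rho> x) (1, x)))"
    proof (rule homotopic_move_edges[OF S W', of J])
      show "(\<lambda>(t, x). (1 - t) * x + t * \<rho> x) ` ({0..1} \<times> J) \<subseteq> J" using move by auto
    qed (use J WJ continuous_on_pair_contraction[OF cont] in auto)
    show "move_edges (\<lambda>x. (\<lambda>(t, x). (1 - t) * x + t * \<rho> x) (1, x)) x = (case ?k x of (s, b) \<Rightarrow> edge_map s b)"
      if "x \<in> topspace (subtopology (graph_topology S) W)" for x
      using that unfolding top by (auto simp: W move_edges_def)
  qed
qed

lemma trivial_relative_homology_group_iff:
  "trivial_group (relative_homology_group (int p) X A) \<longleftrightarrow>
     (\<forall>z. singular_relcycle p X A z \<longrightarrow> singular_relboundary p X A z)"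
  by (auto simp: group.trivial_group_subset[OF group_relative_homology_group] carrier_relative_homology_group
      homologous_rel_set_eq_relboundary image_subset_iff)

text \<open>\<open>U\<close>, the graph without midpoints, contracts to the vertex;
  \<open>V\<close>, the open edges, and \<open>V \<inter> U\<close>, the open half edges, are
  discrete up to homotopy. Since H_2(V) and H_1(V \<inter> U) vanish, so does H_2(V, V \<inter> U);
  excision carries this over to the graph relative to \<open>U\<close>, and H_2(U) = 0 makes it
  absolute.\<close>

lemma trivial_homology_group_graph:
  assumes S: "S \<noteq> {}"
  shows "trivial_group (homology_group 2 (graph_topology S))"
proof -
  let ?G = "graph_topology S" and ?K = "pres_skeleton1 S"
  define U V where "U = ?K - {Edge s (1 / 2) |s. s \<in> S}" and "V = ?K - {Vertex}"
  have top: "topspace ?G = ?K" by (rule topspace_graph_topology)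
  have V: "V = {Edge s t |s t. s \<in> S \<and> t \<in> {0<..<1}}"
    by (auto simp: V_def pres_skeleton1_def)
  have UV: "V \<inter> U = {Edge s t |s t. s \<in> S \<and> t \<in> {0<..<1} - {1 / 2}}"
    by (auto simp: V U_def pres_skeleton1_def)
  have convex: "(1 - t) * x + t * y \<in> A" if "convex A" "x \<in> A" "y \<in> A" "t \<in> {0..1}" for A and x y t :: real
    using convexD_alt[OF that(1-3), of t] that(4) by simp
  have 1: "open {t \<in> {0<..<1 :: real}. 1 / 2 = b}" for b :: real
    by (cases "1 / 2 = b") (simp_all del: greaterThanLessThan_iff)
  have 2: "(1 - t) * x + t * (1 / 2) \<in> {0<..<1}" if "t \<in> {0..1}" "x \<in> {0<..<1}" for t x :: real
    by (rule convex[OF _ that(2) _ that(1)]) simp_all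
  have openV: "openin ?G V"
    by (rule trivial_homology_group_edge_interiors(1)[OF S _ 1 2 _ V, of 1]) simp_all
  have H2V: "trivial_group (homology_group 2 (subtopology ?G V))"
    by (rule trivial_homology_group_edge_interiors(2)[OF S _ 1 2 _ V, of 2]) simp_all
  have H1UV: "trivial_group (homology_group 1 (subtopology ?G (V \<inter> U)))"
  proof (rule trivial_homology_group_edge_interiors(2)[OF S _ _ _ _ UV])
    let ?\<rho> = "\<lambda>x::real. if x < 1 / 2 then 1 / 4 else 3 / 4 :: real"
    show "open {t \<in> {0<..<1} - {1 / 2}. ?\<rho> t = b}" for b
    proof -
      have "{t \<in> {0<..<1} - {1 / 2}. ?\<rho> t = b} =
          (if b = 1 / 4 then {0<..<1 / 2} else if b = 3 / 4 then {1 / 2<..<1} else {})"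
        by auto
      then show ?thesis by simp
    qed
    show "(1 - t) * x + t * ?\<rho> x \<in> {0<..<1} - {1 / 2}" if "t \<in> {0..1}" "x \<in> {0<..<1} - {1 / 2}" for t x
    proof (cases "x < 1 / 2")
      case True
      then show ?thesis using convex[of "{0<..<1 / 2}" x "1 / 4" t] that by auto
    next
      case False
      then show ?thesis using convex[of "{1 / 2<..<1}" x "3 / 4" t] that by auto
    qed
  qed auto
  have UJ: "edge_map s t \<in> U \<longleftrightarrow> t \<in> {0..1} - {1 / 2}" if "s \<in> S" "t \<in> {0..1}" for s t
    using that by (auto simp: U_def pres_skeleton1_def edge_map_def)
  have openU: "openin ?G U"
    unfolding openin_graph_topology
  proof (intro conjI ballI)
    fix s assume "s \<in> S"
    then have "{t \<in> {0..1}. edge_map s t \<in> U} = {0..1} \<inter> - {1 / 2}" using UJ by auto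
    then show "openin (top_of_set {0..1}) {t \<in> {0..1}. edge_map s t \<in> U}"
      by (simp only:) (intro openin_open_Int open_Compl closed_singleton)
  qed (simp add: U_def)
  have H2U: "trivial_group (homology_group 2 (subtopology ?G U))"
  proof (rule trivial_homology_group_via_discrete)
    \<comment> \<open>This is 0 on the first half of an edge and 1 on the second: points move to the
      nearer end, and both ends are the vertex.\<close>
    let ?\<rho> = "\<lambda>x::real. (1 + sgn (2 * x - 1)) / 2"
    have topU: "topspace (subtopology ?G U) = U" by (auto simp: top U_def)
    show "continuous_map (subtopology ?G U) (discrete_topology {()}) (\<lambda>_. ())" by simp
    show "(\<lambda>_. Vertex) ` {()} \<subseteq> topspace (subtopology ?G U)"
      unfolding topU by (simp add: U_def pres_skeleton1_def)
    show "homotopic_with (\<lambda>_. True) (subtopology ?G U) (subtopology ?G U) id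
        (move_edges (\<lambda>x. (\<lambda>(t, x). (1 - t) * x + t * ?\<rho> x) (1, x)))"
    proof (rule homotopic_move_edges[OF S openU _ UJ])
      have "continuous_on ({0..1} - {1 / 2}) ?\<rho>" by (auto intro!: continuous_intros)
      then show "continuous_on ({0..1} \<times> ({0..1} - {1 / 2})) (\<lambda>(t, x). (1 - t) * x + t * ?\<rho> x)"
        by (rule continuous_on_pair_contraction)
      have "(1 - t) * x + t * ?\<rho> x \<in> {0..1} - {1 / 2}" if "t \<in> {0..1}" "x \<in> {0..1} - {1 / 2}" for t x
      proof (cases "x < 1 / 2")
        case True
        then show ?thesis using convex[of "{0..<1 / 2}" x 0 t] that by auto
      next
        case False
        then show ?thesis using convex[of "{1 / 2<..1}" x 1 t] that by auto
      qed
      then show "(\<lambda>(t, x). (1 - t) * x + t * ?\<rho> x) ` ({0..1} \<times> ({0..1} - {1 / 2})) \<subseteq> {0..1} - {1 / 2}"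
        by auto
    qed (auto simp: algebra_simps)
    show "move_edges (\<lambda>x. (\<lambda>(t, x). (1 - t) * x + t * ?\<rho> x) (1, x)) x = Vertex"
      if "x \<in> topspace (subtopology ?G U)" for x
      using that unfolding topU
      by (auto simp: U_def pres_skeleton1_def move_edges_def edge_map_def sgn_if)
  qed simp
  have "trivial_group (relative_homology_group (int 2) (subtopology ?G V) (V \<inter> U))"
    unfolding trivial_relative_homology_group_iff
  proof (intro allI impI)
    fix z assume z: "singular_relcycle 2 (subtopology ?G V) (V \<inter> U) z"
    have sub: "subtopology (subtopology ?G V) (V \<inter> U) = subtopology ?G (V \<inter> U)"
      by (simp add: subtopology_subtopology)
    from z have "singular_chain 2 (subtopology ?G V) z" and
      "singular_chain 1 (subtopology ?G (V \<inter> U)) (chain_boundary 2 z)"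
      by (simp_all add: singular_relcycle sub)
    moreover from this have "singular_relcycle 1 (subtopology ?G (V \<inter> U)) {} (chain_boundary 2 z)"
      using chain_boundary_boundary_alt[of 1 "subtopology ?G V" z] by (simp add: singular_cycle numeral_2_eq_2)
    then have "singular_relboundary 1 (subtopology ?G (V \<inter> U)) {} (chain_boundary 2 z)"
      using cycle_bounds_if_trivial[of 1] H1UV by simp
    then obtain e where e: "singular_chain 2 (subtopology ?G (V \<inter> U)) e" "chain_boundary 2 e = chain_boundary 2 z"
      by (auto simp: singular_boundary numeral_2_eq_2)
    moreover from e(1) have "singular_chain 2 (subtopology ?G V) e"
      by (auto simp: singular_chain_subtopology)
    ultimately have "singular_relcycle 2 (subtopology ?G V) {} (z - e)"
      by (simp add: singular_cycle chain_boundary_diff singular_chain_diff)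
    then have "singular_relboundary 2 (subtopology ?G V) {} (z - e)"
      using cycle_bounds_if_trivial[of 2] H2V by simp
    then obtain f where "singular_chain (Suc 2) (subtopology ?G V) f" "chain_boundary (Suc 2) f = z - e"
      by (auto simp: singular_boundary)
    then show "singular_relboundary 2 (subtopology ?G V) (V \<inter> U) z"
      using e(1) unfolding singular_relboundary sub by (intro exI[of _ f] conjI exI[of _ e]) auto
  qed
  moreover have "hom_induced 2 (subtopology ?G (?K - {Vertex})) (U - {Vertex}) (subtopology ?G ?K) U id
      \<in> iso (relative_homology_group 2 (subtopology ?G (?K - {Vertex})) (U - {Vertex}))
          (relative_homology_group 2 (subtopology ?G ?K) U)"
  proof (rule homology_excision_axiom)
    have "closedin ?G {Vertex}"
      using openV unfolding closedin_def top by (simp add: V_def pres_skeleton1_def)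
    then show "?G closure_of {Vertex} \<subseteq> ?G interior_of U"
      using openU by (auto simp: closure_of_closedin interior_of_openin U_def pres_skeleton1_def)
  qed (auto simp: U_def)
  moreover have "?K - {Vertex} = V" "U - {Vertex} = V \<inter> U" "subtopology ?G ?K = ?G"
    by (auto simp: V_def U_def top[symmetric])
  ultimately have "trivial_group (relative_homology_group (int 2) ?G U)"
    using isomorphic_group_triviality1[OF is_isoI group_relative_homology_group] by simp
  then have "singular_relboundary 2 ?G U z" if "singular_relcycle 2 ?G U z" for z
    using that unfolding trivial_relative_homology_group_iff by blast
  moreover have "singular_relcycle 2 ?G U z" if "singular_relcycle 2 ?G {} z" for z
  proof -
    have "singular_chain 2 ?G z" "chain_boundary 2 z = 0" using that unfolding singular_cycle by auto
    then show ?thesis by (simp add: singular_relcycle)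
  qed
  ultimately have "singular_relboundary 2 ?G {} z" if "singular_relcycle 2 ?G {} z" for z
    using relboundary_absolute[of 2 ?G U z] H2U that by simp
  then have "trivial_group (relative_homology_group (int 2) ?G {})"
    unfolding trivial_relative_homology_group_iff by blast
  then show ?thesis by simp
qed

theorem corollary3p12:
  fixes S :: "'a set" and r :: "'a word"
    and X :: "'x topology" and c :: "'a pres_point \<Rightarrow> 'x"
  assumes "r \<in> derived (free_group S) (carrier (free_group S)) - {\<one>\<^bsub>free_group S\<^esub>}"
    and "classifying_complex S r X c"
  shows "simplicial_volume S r X c < 4 * stable_commutator_length (free_group S) r"
proof -
  let ?F = "free_group S" and ?scl = "stable_commutator_length (free_group S) r"
  have rd: "r \<in> derived ?F (carrier ?F)" and r0: "r \<noteq> []"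
    using assms(1) by (auto simp: one_free_group)
  interpret group ?F by (rule group_free_group)
  have rc: "r \<in> carrier ?F" using rd derived_in_carrier[of "carrier ?F"] by blast
  then have rS: "fst ` set r \<subseteq> S" by (simp add: carrier_free_group)
  then have "S \<noteq> {}" using r0 by auto
  then have acyclic: "trivial_group (homology_group 2 (subtopology (pres_complex S r) (pres_skeleton1 S)))"
    unfolding subtopology_skeleton[OF r0 rS] by (rule trivial_homology_group_graph)
  have c: "continuous_map (pres_complex S r) X c"
    using assms(2) homeomorphic_imp_continuous_map
    by (fastforce simp: classifying_complex_def attaches_cells_ge3_def embedding_map_def continuous_map_in_subtopology)
  obtain n k w where n: "n \<ge> 1" and w: "conj_prod ?F r n w" "comm_prod ?F (Suc k) w"
      and k: "real k < real n * ?scl"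
    using efficient_surface[OF assms(1)] by (elim exE conjE)
  \<comment> \<open>A cover of degree \<open>m\<close> gives the bound
    \<open>(4 (m k + 1) + 2) / (m n)\<close>. Its constant part \<open>6 = 4 + 2\<close> has to be
    outweighed by \<open>m\<close> times the gap \<open>4 (n scl - k)\<close>.\<close>
  then obtain m where m: "6 < real m * (4 * (real n * ?scl - real k))"
    using reals_Archimedean3[of "4 * (real n * ?scl - real k)"] by auto
  then have "m \<ge> 1" by (cases m) auto
  with n have mn: "m * n \<ge> 1" by simp
  obtain v where v: "conj_prod ?F r (m * n) v" "comm_prod ?F (m * k + 1) v"
    using cyclic_cover[OF rc w, of m] by (elim exE conjE)
  have "simplicial_volume S r X c \<le> (4 * real (m * k + 1) + 2) / real (m * n)"
    by (rule simplicial_volume_le[OF r0 rS acyclic c rd mn v])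
  also have "\<dots> < 4 * ?scl"
  proof -
    have "4 * real (m * k + 1) + 2 < 4 * ?scl * real (m * n)"
      using m by (simp add: algebra_simps)
    moreover have "real (m * n) > 0" using mn by simp
    ultimately show ?thesis by (simp only: pos_divide_less_eq)
  qed
  finally show ?thesis .
qed

end
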